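(* Assume conditions $(\mathbf u)$, $(\mathbf{fg})$, $(\boldsymbol\partial)$. Let the pair $(x^0,u^0)\in C_{loc}(\mathbb T,\mathbb X)\times\mathfrak U$ be uniformly overtaking optimal for the problem of maximizing $\lim_{T\to\infty}J_T(u)$ over $u\in\mathfrak U$. Let the map $I_0:\mathbb T\to\mathbb X$ be bounded and let $$\lim_{\xi\to0}\|I_\xi-I_0\|_C=0.$$ Let $I_*\in\mathbb X$ be a partial limit of $I_0(\tau)$ as $\tau\to\infty$ (i.e. $I_*=\lim_{n\to\infty}I_0(\tau_n)$ for some sequence $\tau_n\to\infty$). Then there exists a solution $(x^0,u^0,\lambda^0,\psi^0)\in\mathfrak Z$ (with this $x^0,u^0$) of all relations of the Maximum Principle satisfying the transversality condition $$\liminf_{t\to\infty}\|\psi^0(t)A_*(t)\|_{\mathbb X}=0.$$ Moreover, $\lambda^0=\dfrac1{1+\|I_*\|_{\mathbb X}}>0$, and $\psi^0\in C_{loc}(\mathbb T,\mathbb X)$ is given by $$\psi^0(T)=\lambda^0\Big(I_*-\int_0^T\frac{\partial g(t,x^0(t),u^0(t))}{\partial x}A_*(t)\,dt\Big)A_*^{-1}(T)\qquad\forall T\in\mathbb T.$$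
   Context: Notation. $\mathbb T=\mathbb R_{\ge0}$, $\mathbb X=\mathbb R^m$, $\mathbb L$ is the space of real $m\times m$ matrices with unit matrix $1_{\mathbb L}$, $\mathbb U$ is a finite-dimensional Euclidean space, $U:\mathbb T\rightsquigarrow\mathbb U$ is a set-valued map with graph $\mathrm{Gr}\,U$, and $\mathfrak U$ is the set of all Borel measurable selectors of $U$. $C_{loc}(\mathbb T,E)$ is the set of continuous functions $\mathbb T\to E$ with the compact-open topology; $\|\cdot\|_C$ is the supremum norm on $\mathbb T$. $\mathcal L^1_{loc}(\mathbb T,\mathbb T)$ is the set of nonnegative locally summable functions on $\mathbb T$. A function $a:\mathbb T\times E'\times\mathbb U\to E''$ is called: (1) Carathéodory if $a(\cdot,y,u)$ is measurable for all $y\in E'$ and all $u$ belonging to some $U(t)$, and $a(t,\cdot,\cdot):E'\times U(t)\to E''$ is continuous for all $t\in\mathbb T$; (2) locally Lipschitz continuous if for each compact $K\subset\mathbb T\times E'$ there is $L^a_K\in\mathcal L^1_{loc}(\mathbb T,\mathbb T)$ with $\|a(t,x',u)-a(t,x'',u)\|\le L^a_K(t)\|x'-x''\|$ for all $(t,x'),(t,x'')\in K$, $u\in U(t)$; (3) integrally bounded (on each compact subset) if for each compact $K\subset\mathbb T\times E'$ there is $M^a_K\in\mathcal L^1_{loc}(\mathbb T,\mathbb T)$ with $\|a(t,x,u)\|\le M^a_K(t)$ for all $(t,x)\in K$, $u\in U(t)$; (4) satisfying the continuability condition if it is locally Lipschitz continuous with $L^a_K$ independent of $K$ and it is integrally bounded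 on each compact subset. Condition $(\mathbf u)$: $U$ is compact-valued, integrally bounded on each compact subset of $\mathbb T$ (norms of elements of $U(t)$ are dominated by a locally summable function of $t$), and $\mathrm{Gr}\,U$ is a Borel subset of $\mathbb T\times\mathbb U$. Condition $(\mathbf{fg})$: $f:\mathbb T\times\mathbb X\times\mathbb U\to\mathbb X$ and $g:\mathbb T\times\mathbb X\times\mathbb U\to\mathbb R$ are locally Lipschitz continuous Carathéodory maps, integrally bounded on each compact subset, and $f$ satisfies the continuability condition. Condition $(\boldsymbol\partial)$: $f$ and $g$ have partial derivatives in $x$ that are locally Lipschitz continuous Carathéodory maps, integrally bounded on each compact subset. For $u\in\mathfrak U$, $\varphi[u]$ is the unique solution on $\mathbb T$ of $\dot x=f(t,x,u(t))$, $x(0)=0$, and $J_T(u)=\int_0^Tg(t,\varphi[u](t),u(t))\,dt$. A control $u^0\in\mathfrak U$ is uniformly overtaking optimal if for each $\varepsilon>0$ there is $T>0$ such that $J_t(u^0)\ge J_t(u)-\varepsilon$ for all $u\in\mathfrak U$, $t\ge T$; the pair $(x^0,u^0)$ is then called uniformly overtaking optimal, where $x^0=\varphi[u^0]$. $\mathcal H(x,t,u,\lambda,\psi)=\psi f(t,x,u)+\lambda g(t,x,u)$ ($\psi$ a row vector). $\mathfrak Z$ is the set of $(x,u,\lambda,\psi)\in C_{loc}(\mathbb T,\mathbb X)\times\mathfrak U\times[0,1]\times C_{loc}(\mathbb T,\mathbb X)$ ($x,\psi$ locally absolutely continuous) with $x(0)=0$, $\|\psi(0)\|_{\mathbb X}+\lambda=1$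 and, a.e. on $\mathbb T$: $\dot x=f(t,x,u(t))$, $\dot\psi=-\frac{\partial\mathcal H}{\partial x}(x(t),t,u(t),\lambda,\psi(t))$, $\sup_{p\in U(t)}\mathcal H(x(t),t,p,\lambda,\psi(t))=\mathcal H(x(t),t,u(t),\lambda,\psi(t))$ (the relations of the Maximum Principle). For $\xi\in\mathbb X$, $x_\xi$ is the solution of $\dot x=f(t,x,u^0(t))$, $x(0)=\xi$; $A_\xi:\mathbb T\to\mathbb L$ is the solution of $\dot A_\xi(t)=\frac{\partial f(t,x_\xi(t),u^0(t))}{\partial x}A_\xi(t)$, $A_\xi(0)=1_{\mathbb L}$; $A_*=A_{0_{\mathbb X}}$ (so it corresponds to $x_0=x^0$); and $I_\xi(T)=\int_0^T\frac{\partial g(t,x_\xi(t),u^0(t))}{\partial x}A_\xi(t)\,dt$ (a row vector) for $T\in\mathbb T$.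
   Formalization: It is additionally assumed that for every selector u and every state y the maps t ↦ f(t,y,u(t)) and t ↦ g(t,y,u(t)) are measurable; the stated Carathéodory condition does not give this when U depends on t, and J_T(u) may then be undefined. *)

theory Defs
  imports "HOL-Analysis.Analysis"
begin

text \<open>
  Time is \<open>{0..} :: real set\<close>, the state space is \<open>real ^ 'm\<close>, controls take values in a type
  \<open>'u :: euclidean_space\<close>. Maps on the time axis are total functions on \<open>real\<close>; their values at
  negative times are irrelevant everywhere. Row vectors are elements of \<open>real ^ 'm\<close> acting through
  \<open>inner\<close> and \<open>v*\<close>. ``Measurable'', ``a.e.'' and ``summable'' refer to Lebesgue measure.
\<close>

definition L1_loc :: "(real \<Rightarrow> real) set" where
  "L1_loc = {L. (\<forall>t\<ge>0. 0 \<le> L t) \<and> (\<forall>T\<ge>0. set_integrable lebesgue {0..T} L)}"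


subsection \<open>Control maps and conditions on the data\<close>

definition graph :: "(real \<Rightarrow> 'u set) \<Rightarrow> (real \<times> 'u) set" where
  "graph U = {(t, p). 0 \<le> t \<and> p \<in> U t}"

definition selectors :: "(real \<Rightarrow> 'u::euclidean_space set) \<Rightarrow> (real \<Rightarrow> 'u) set" where
  "selectors U = {u \<in> borel_measurable (restrict_space borel {0..}). \<forall>t\<ge>0. u t \<in> U t}"

definition caratheodory ::
  "(real \<Rightarrow> 'u::euclidean_space set)
    \<Rightarrow> (real \<Rightarrow> 'x::euclidean_space \<Rightarrow> 'u \<Rightarrow> 'y::euclidean_space) \<Rightarrow> bool" where
  "caratheodory U a \<longleftrightarrow>
     (\<forall>y. \<forall>p \<in> (\<Union>s\<in>{0..}. U s). (\<lambda>t. a t y p) \<in> borel_measurable (lebesgue_on {0..})) \<and>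
     (\<forall>t\<ge>0. continuous_on (UNIV \<times> U t) (\<lambda>(y, p). a t y p))"

definition locally_lipschitz ::
  "(real \<Rightarrow> 'u::euclidean_space set)
    \<Rightarrow> (real \<Rightarrow> 'x::euclidean_space \<Rightarrow> 'u \<Rightarrow> 'y::euclidean_space) \<Rightarrow> bool" where
  "locally_lipschitz U a \<longleftrightarrow>
     (\<forall>K. compact K \<and> K \<subseteq> {0..} \<times> UNIV \<longrightarrow>
        (\<exists>L\<in>L1_loc. \<forall>t x' x''. (t, x') \<in> K \<and> (t, x'') \<in> K \<longrightarrow>
           (\<forall>p\<in>U t. norm (a t x' p - a t x'' p) \<le> L t * norm (x' - x''))))"

definition integrally_bounded ::
  "(real \<Rightarrow> 'u::euclidean_space set)
    \<Rightarrow> (real \<Rightarrow> 'x::euclidean_space \<Rightarrow> 'u \<Rightarrow> 'y::euclidean_space) \<Rightarrow> bool" where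
  "integrally_bounded U a \<longleftrightarrow>
     (\<forall>K. compact K \<and> K \<subseteq> {0..} \<times> UNIV \<longrightarrow>
        (\<exists>M\<in>L1_loc. \<forall>(t, x)\<in>K. \<forall>p\<in>U t. norm (a t x p) \<le> M t))"

definition continuability ::
  "(real \<Rightarrow> 'u::euclidean_space set)
    \<Rightarrow> (real \<Rightarrow> 'x::euclidean_space \<Rightarrow> 'u \<Rightarrow> 'y::euclidean_space) \<Rightarrow> bool" where
  "continuability U a \<longleftrightarrow>
     (\<exists>L\<in>L1_loc. \<forall>K. compact K \<and> K \<subseteq> {0..} \<times> UNIV \<longrightarrow>
        (\<forall>t x' x''. (t, x') \<in> K \<and> (t, x'') \<in> K \<longrightarrow>
           (\<forall>p\<in>U t. norm (a t x' p - a t x'' p) \<le> L t * norm (x' - x'')))) \<and>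
     integrally_bounded U a"

text \<open>
  Fixed-control measurability and continuity on \<open>UNIV \<times> U t\<close> alone do not make
  \<open>\<lambda>t. a t y (u t)\<close> measurable when \<open>U\<close> varies with time (for \<open>U t = {t}\<close> the map
  \<open>a t y p = indicator (N \<inter> {t}) p\<close> satisfies both for every set \<open>N\<close>), so this has to be
  recorded separately for the trajectories and payoffs below to be defined.
\<close>

definition superposition_measurable ::
  "(real \<Rightarrow> 'u::euclidean_space set)
    \<Rightarrow> (real \<Rightarrow> 'x::euclidean_space \<Rightarrow> 'u \<Rightarrow> 'y::euclidean_space) \<Rightarrow> bool" where
  "superposition_measurable U a \<longleftrightarrow>
     (\<forall>u\<in>selectors U. \<forall>y. (\<lambda>t. a t y (u t)) \<in> borel_measurable (lebesgue_on {0..}))"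

definition condition_u :: "(real \<Rightarrow> 'u::euclidean_space set) \<Rightarrow> bool" where
  "condition_u U \<longleftrightarrow>
     (\<forall>t\<ge>0. compact (U t)) \<and>
     (\<forall>K. compact K \<and> K \<subseteq> {0..} \<longrightarrow> (\<exists>M\<in>L1_loc. \<forall>t\<in>K. \<forall>p\<in>U t. norm p \<le> M t)) \<and>
     graph U \<in> sets borel"

definition condition_fg ::
  "(real \<Rightarrow> 'u::euclidean_space set) \<Rightarrow> (real \<Rightarrow> real ^ 'm \<Rightarrow> 'u \<Rightarrow> real ^ 'm)
    \<Rightarrow> (real \<Rightarrow> real ^ 'm \<Rightarrow> 'u \<Rightarrow> real) \<Rightarrow> bool" where
  "condition_fg U f g \<longleftrightarrow>
     caratheodory U f \<and> locally_lipschitz U f \<and> integrally_bounded U f \<and> continuability U f \<and>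
     caratheodory U g \<and> locally_lipschitz U g \<and> integrally_bounded U g"

definition condition_d ::
  "(real \<Rightarrow> 'u::euclidean_space set) \<Rightarrow> (real \<Rightarrow> real ^ 'm \<Rightarrow> 'u \<Rightarrow> real ^ 'm)
    \<Rightarrow> (real \<Rightarrow> real ^ 'm \<Rightarrow> 'u \<Rightarrow> real) \<Rightarrow> (real \<Rightarrow> real ^ 'm \<Rightarrow> 'u \<Rightarrow> real ^ 'm ^ 'm)
    \<Rightarrow> (real \<Rightarrow> real ^ 'm \<Rightarrow> 'u \<Rightarrow> real ^ 'm) \<Rightarrow> bool" where
  "condition_d U f g fx gx \<longleftrightarrow>
     (\<forall>t\<ge>0. \<forall>x p. ((\<lambda>y. f t y p) has_derivative (\<lambda>h. fx t x p *v h)) (at x)) \<and>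
     (\<forall>t\<ge>0. \<forall>x p. GDERIV (\<lambda>y. g t y p) x :> gx t x p) \<and>
     caratheodory U fx \<and> locally_lipschitz U fx \<and> integrally_bounded U fx \<and>
     caratheodory U gx \<and> locally_lipschitz U gx \<and> integrally_bounded U gx"


subsection \<open>Trajectories and optimality\<close>

text \<open>
  \<open>D division_of \<Union>D\<close> says that \<open>D\<close> is a finite set of non-overlapping compact intervals; the
  endpoints of \<open>k \<in> D\<close> are \<open>Inf k\<close> and \<open>Sup k\<close>.
\<close>

definition locally_abs_continuous :: "(real \<Rightarrow> 'a::real_normed_vector) \<Rightarrow> bool" where
  "locally_abs_continuous x \<longleftrightarrow>
     (\<forall>T\<ge>0. \<forall>e>0. \<exists>d>0. \<forall>D. D division_of \<Union>D \<and> \<Union>D \<subseteq> {0..T} \<and> (\<Sum>k\<in>D. Sup k - Inf k) < d \<longrightarrow>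
        (\<Sum>k\<in>D. norm (x (Sup k) - x (Inf k))) < e)"

definition solves_ode ::
  "(real \<Rightarrow> 'a::real_normed_vector \<Rightarrow> 'a) \<Rightarrow> 'a \<Rightarrow> (real \<Rightarrow> 'a) \<Rightarrow> bool" where
  "solves_ode F x0 x \<longleftrightarrow>
     locally_abs_continuous x \<and> x 0 = x0 \<and>
     (AE t in lebesgue_on {0..}. (x has_vector_derivative F t (x t)) (at t within {0..}))"

text \<open>
  The solution on \<open>{0..}\<close> when it exists and is unique there; \<open>SOME\<close> rather than \<open>THE\<close> because
  the values at negative times are not determined.
\<close>

definition ode_solution ::
  "(real \<Rightarrow> 'a::real_normed_vector \<Rightarrow> 'a) \<Rightarrow> 'a \<Rightarrow> real \<Rightarrow> 'a" where
  "ode_solution F x0 = (SOME x. solves_ode F x0 x)"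

definition trajectory ::
  "(real \<Rightarrow> real ^ 'm \<Rightarrow> 'u \<Rightarrow> real ^ 'm) \<Rightarrow> (real \<Rightarrow> 'u) \<Rightarrow> real ^ 'm \<Rightarrow> real \<Rightarrow> real ^ 'm" where
  "trajectory f u \<xi> = ode_solution (\<lambda>t y. f t y (u t)) \<xi>"

definition payoff ::
  "(real \<Rightarrow> real ^ 'm \<Rightarrow> 'u \<Rightarrow> real ^ 'm) \<Rightarrow> (real \<Rightarrow> real ^ 'm \<Rightarrow> 'u \<Rightarrow> real)
    \<Rightarrow> real \<Rightarrow> (real \<Rightarrow> 'u) \<Rightarrow> real" where
  "payoff f g T u = (LINT t:{0..T}|lebesgue. g t (trajectory f u 0 t) (u t))"

definition uniformly_overtaking_optimal ::
  "(real \<Rightarrow> 'u::euclidean_space set) \<Rightarrow> (real \<Rightarrow> real ^ 'm \<Rightarrow> 'u \<Rightarrow> real ^ 'm)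
    \<Rightarrow> (real \<Rightarrow> real ^ 'm \<Rightarrow> 'u \<Rightarrow> real) \<Rightarrow> (real \<Rightarrow> 'u) \<Rightarrow> bool" where
  "uniformly_overtaking_optimal U f g u0 \<longleftrightarrow>
     u0 \<in> selectors U \<and>
     (\<forall>e>0. \<exists>T>0. \<forall>u\<in>selectors U. \<forall>t\<ge>T. payoff f g t u0 \<ge> payoff f g t u - e)"

definition uniformly_overtaking_optimal_pair ::
  "(real \<Rightarrow> 'u::euclidean_space set) \<Rightarrow> (real \<Rightarrow> real ^ 'm \<Rightarrow> 'u \<Rightarrow> real ^ 'm)
    \<Rightarrow> (real \<Rightarrow> real ^ 'm \<Rightarrow> 'u \<Rightarrow> real) \<Rightarrow> (real \<Rightarrow> real ^ 'm) \<Rightarrow> (real \<Rightarrow> 'u) \<Rightarrow> bool" where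
  "uniformly_overtaking_optimal_pair U f g x0 u0 \<longleftrightarrow>
     uniformly_overtaking_optimal U f g u0 \<and> (\<forall>t\<ge>0. x0 t = trajectory f u0 0 t)"


subsection \<open>Maximum Principle\<close>

definition hamiltonian ::
  "(real \<Rightarrow> real ^ 'm \<Rightarrow> 'u \<Rightarrow> real ^ 'm) \<Rightarrow> (real \<Rightarrow> real ^ 'm \<Rightarrow> 'u \<Rightarrow> real)
    \<Rightarrow> real ^ 'm \<Rightarrow> real \<Rightarrow> 'u \<Rightarrow> real \<Rightarrow> real ^ 'm \<Rightarrow> real" where
  "hamiltonian f g x t p l \<psi> = \<psi> \<bullet> f t x p + l * g t x p"

definition pmp_solutions ::
  "(real \<Rightarrow> 'u::euclidean_space set) \<Rightarrow> (real \<Rightarrow> real ^ 'm \<Rightarrow> 'u \<Rightarrow> real ^ 'm)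
    \<Rightarrow> (real \<Rightarrow> real ^ 'm \<Rightarrow> 'u \<Rightarrow> real)
    \<Rightarrow> ((real \<Rightarrow> real ^ 'm) \<times> (real \<Rightarrow> 'u) \<times> real \<times> (real \<Rightarrow> real ^ 'm)) set" where
  "pmp_solutions U f g = {(x, u, l, \<psi>).
     continuous_on {0..} x \<and> locally_abs_continuous x \<and>
     u \<in> selectors U \<and> l \<in> {0..1} \<and>
     continuous_on {0..} \<psi> \<and> locally_abs_continuous \<psi> \<and>
     x 0 = 0 \<and> norm (\<psi> 0) + l = 1 \<and>
     (AE t in lebesgue_on {0..}. (x has_vector_derivative f t (x t) (u t)) (at t within {0..})) \<and>
     (AE t in lebesgue_on {0..}.
        \<exists>D. GDERIV (\<lambda>y. hamiltonian f g y t (u t) l (\<psi> t)) (x t) :> D \<and>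
            (\<psi> has_vector_derivative - D) (at t within {0..})) \<and>
     (AE t in lebesgue_on {0..}.
        (SUP p\<in>U t. ereal (hamiltonian f g (x t) t p l (\<psi> t))) =
          ereal (hamiltonian f g (x t) t (u t) l (\<psi> t)))}"


subsection \<open>Variational equation along the optimal control\<close>

definition fundamental_matrix ::
  "(real \<Rightarrow> real ^ 'm \<Rightarrow> 'u \<Rightarrow> real ^ 'm) \<Rightarrow> (real \<Rightarrow> real ^ 'm \<Rightarrow> 'u \<Rightarrow> real ^ 'm ^ 'm)
    \<Rightarrow> (real \<Rightarrow> 'u) \<Rightarrow> real ^ 'm \<Rightarrow> real \<Rightarrow> real ^ 'm ^ 'm" where
  "fundamental_matrix f fx u \<xi> =
     ode_solution (\<lambda>t A. fx t (trajectory f u \<xi> t) (u t) ** A) (mat 1)"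

definition payoff_gradient ::
  "(real \<Rightarrow> real ^ 'm \<Rightarrow> 'u \<Rightarrow> real ^ 'm) \<Rightarrow> (real \<Rightarrow> real ^ 'm \<Rightarrow> 'u \<Rightarrow> real ^ 'm ^ 'm)
    \<Rightarrow> (real \<Rightarrow> real ^ 'm \<Rightarrow> 'u \<Rightarrow> real ^ 'm)
    \<Rightarrow> (real \<Rightarrow> 'u) \<Rightarrow> real ^ 'm \<Rightarrow> real \<Rightarrow> real ^ 'm" where
  "payoff_gradient f fx gx u \<xi> T =
     (LINT t:{0..T}|lebesgue.
        gx t (trajectory f u \<xi> t) (u t) v* fundamental_matrix f fx u \<xi> t)"

text \<open>Extended-valued, since the supremum norm of an unbounded function is infinite.\<close>

definition sup_norm :: "(real \<Rightarrow> 'a::real_normed_vector) \<Rightarrow> ereal" where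
  "sup_norm F = (SUP t\<in>{0..}. ereal (norm (F t)))"

end

theory Submission
  imports Defs
begin

text \<open>
  The maximum condition comes from needle variations of the optimal control, compared on the
  infinite horizon through the gradient \<open>I\<^sub>\<xi>\<close> of the payoff of \<open>u0\<close> with respect to the initial state.

  Let a selector \<open>v\<close> replace \<open>u0\<close> on \<open>(s, s + h)\<close> only. After the needle the new trajectory again solves
  the equation with \<open>u0\<close>, so it equals \<open>x\<^sub>\<xi>\<close> for some initial point \<open>\<xi> = \<xi>(h)\<close>, and to first order
  \<open>\<xi> = h A\<^sub>*(s)\<^sup>-\<^sup>1 \<Delta>f(s)\<close>, where \<open>\<Delta>f\<close> and \<open>\<Delta>g\<close> are the jumps of velocity and running payoff caused by \<open>v\<close>. Write
  \<open>V\<^sub>\<xi>(t)\<close> for the payoff of \<open>x\<^sub>\<xi>\<close> under \<open>u0\<close> up to time \<open>t\<close>. The payoff up to \<open>t\<close> changes by the gain on the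
  needle, \<open>h \<Delta>g(s) + o(h)\<close>, plus \<open>(V\<^sub>\<xi> - V\<^sub>0)(t) - (V\<^sub>\<xi> - V\<^sub>0)(s + h)\<close>. Since \<open>I\<^sub>\<xi>\<close> is the gradient of \<open>V\<^sub>\<xi>\<close>
  and \<open>I\<^sub>\<xi> \<rightarrow> I\<^sub>0\<close> uniformly on the time axis, the mean value theorem gives \<open>(V\<^sub>\<xi> - V\<^sub>0)(t) = \<xi> \<bullet> I\<^sub>0(t) + o(\<xi>)\<close>
  uniformly in \<open>t\<close> (\<open>uniform_value_expansion\<close>). Uniform overtaking optimality bounds the change by any
  \<open>\<epsilon> > 0\<close> for all large \<open>t\<close>; so along \<open>t = \<tau>\<^sub>n\<close> first \<open>n \<rightarrow> \<infinity>\<close>, then division by \<open>h\<close> and \<open>h \<rightarrow> 0\<close> give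
  \<open>\<Delta>g(s) + (I\<^sub>* - I\<^sub>0(s)) A\<^sub>*(s)\<^sup>-\<^sup>1 \<Delta>f(s) \<le> 0\<close> (\<open>needle_inequality_at\<close>). This is the maximum condition for the
  costate \<open>\<lambda>\<^sup>0 (I\<^sub>* - I\<^sub>0) A\<^sub>*\<^sup>-\<^sup>1\<close>, for the one competitor \<open>v\<close> and almost every \<open>s\<close>. The order of the limits is
  what makes the approximate optimality on finite horizons sufficient.

  To pass from a single selector to all \<open>p \<in> U s\<close>, countably many Borel selectors are needed that are
  dense in \<open>U s\<close> for almost every \<open>s\<close> (\<open>dense_selectors\<close>); the Hamiltonian is continuous in the control,
  so the inequality extends from a dense set. The selectors exist because projections of Borel sets
  are Lebesgue measurable (\<open>lebesgue_measurable_projection\<close>). The adjoint equation follows from the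
  product rule, and \<open>\<psi>\<^sup>0 A\<^sub>* = \<lambda>\<^sup>0 (I\<^sub>* - I\<^sub>0)\<close> tends to zero along \<open>\<tau>\<^sub>n\<close>, which is transversality.

  All differential equations are handled as integral equations. This rests on two facts: a locally
  absolutely continuous function is the integral of its derivative
  (\<open>has_integral_derivative_of_abs_continuous\<close>), and an indefinite integral is differentiable almost
  everywhere (\<open>negligible_integral_not_differentiable\<close>).
\<close>

section \<open>Absolutely continuous functions and their derivatives\<close>

lemma AE_lebesgue_on_iff_negligible:
  assumes "S \<in> sets lebesgue"
  shows "(AE t in lebesgue_on S. P t) \<longleftrightarrow> negligible {t\<in>S. \<not> P t}"
proof -
  have "(AE t in lebesgue_on S. P t) \<longleftrightarrow> (AE t in lebesgue. t \<in> S \<longrightarrow> P t)"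
    using assms by (subst AE_restrict_space_iff) auto
  also have "\<dots> \<longleftrightarrow> (\<exists>N\<in>null_sets lebesgue. {t\<in>S. \<not> P t} \<subseteq> N)"
  proof -
    have "{t \<in> space lebesgue. \<not> (t \<in> S \<longrightarrow> P t)} = {t\<in>S. \<not> P t}" by auto
    then show ?thesis unfolding eventually_ae_filter by simp
  qed
  also have "\<dots> \<longleftrightarrow> negligible {t\<in>S. \<not> P t}"
  proof
    assume "\<exists>N\<in>null_sets lebesgue. {t\<in>S. \<not> P t} \<subseteq> N"
    then obtain N where "negligible N" "{t\<in>S. \<not> P t} \<subseteq> N"
      unfolding negligible_iff_null_sets by blast
    then show "negligible {t\<in>S. \<not> P t}" by (rule negligible_subset)
  next
    assume "negligible {t\<in>S. \<not> P t}"
    then show "\<exists>N\<in>null_sets lebesgue. {t\<in>S. \<not> P t} \<subseteq> N"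
      unfolding negligible_iff_null_sets by blast
  qed
  finally show ?thesis .
qed

lemma AE_half_line_iff_negligible:
  "(AE t in lebesgue_on {0::real..}. P t) \<longleftrightarrow> negligible {t. 0 \<le> t \<and> \<not> P t}"
  by (subst AE_lebesgue_on_iff_negligible) auto

text \<open>
  The proof of the fundamental theorem of calculus with a gauge, adapted to an exceptional null set
  \<open>N\<close>: near points of \<open>N\<close> the gauge stays inside an open set of small measure, so intervals with tag
  in \<open>N\<close> have small total length, and absolute continuity makes their increments small in sum. All
  other intervals are controlled by the derivative at the tag.
\<close>

lemma has_integral_derivative_of_abs_continuous:
  fixes x :: "real \<Rightarrow> 'a::banach"
  assumes ac: "locally_abs_continuous x" and "0 \<le> T"
    and ae: "AE t in lebesgue_on {0..}. (x has_vector_derivative p t) (at t within {0..})"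
  shows "(p has_integral x T - x 0) {0..T}"
proof -
  define N where "N = {t. 0 \<le> t \<and> \<not> (x has_vector_derivative p t) (at t within {0..})}"
  have N: "negligible N"
    using ae unfolding N_def AE_half_line_iff_negligible .
  \<comment> \<open>With value zero on \<open>N\<close>, tags in \<open>N\<close> contribute only increments of \<open>x\<close> to the error.\<close>
  define q where "q t = (if t \<in> N then 0 else p t)" for t
  have "(q has_integral x T - x 0) {0..T}"
    unfolding has_integral_real
  proof (intro allI impI)
    fix e :: real assume "e > 0"
    obtain d where "d > 0" and d: "\<And>D. D division_of \<Union>D \<Longrightarrow> \<Union>D \<subseteq> {0..T} \<Longrightarrow>
        (\<Sum>k\<in>D. Sup k - Inf k) < d \<Longrightarrow> (\<Sum>k\<in>D. norm (x (Sup k) - x (Inf k))) < e/2"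
      using ac \<open>0 \<le> T\<close> \<open>e > 0\<close> unfolding locally_abs_continuous_def by (meson half_gt_zero)
    obtain W where W: "open W" "N \<subseteq> W" "W \<in> lmeasurable" "measure lebesgue W < d"
    proof -
      obtain W where W: "open W" "N \<subseteq> W" "W - N \<in> lmeasurable" "emeasure lebesgue (W - N) < ennreal d"
        using sets_lebesgue_outer_open[OF negligible_imp_sets[OF N] \<open>d > 0\<close>] by blast
      have un: "W = (W - N) \<union> N" using W(2) by blast
      have Nm: "N \<in> lmeasurable" by (rule negligible_imp_measurable[OF N])
      have "(W - N) \<union> N \<in> lmeasurable" by (rule fmeasurable.Un[OF W(3) Nm])
      moreover have "measure lebesgue ((W - N) \<union> N) \<le> measure lebesgue (W - N) + measure lebesgue N"
        using W(3) Nm by (intro measure_Un_le) auto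
      moreover have "ennreal (measure lebesgue (W - N)) < ennreal d"
        using W(4) unfolding emeasure_eq_measure2[OF W(3)] .
      then have "measure lebesgue (W - N) < d"
        by (simp add: ennreal_less_iff)
      ultimately show ?thesis using that[OF W(1,2)] negligible_imp_measure0[OF N] un by simp
    qed
    \<comment> \<open>Half of \<open>e\<close>, spread over the interval in proportion to length; \<open>T + 1\<close> also covers \<open>T = 0\<close>.\<close>
    define e1 where "e1 = e / (2 * (T + 1))"
    have "e1 > 0" using \<open>e > 0\<close> \<open>0 \<le> T\<close> by (simp add: e1_def)
    have "\<exists>\<rho>>0. (t \<in> N \<longrightarrow> ball t \<rho> \<subseteq> W) \<and>
       (t \<in> {0..T} - N \<longrightarrow> (\<forall>y\<in>{0..}. norm (y - t) < \<rho> \<longrightarrow> norm (x y - x t - (y - t) *\<^sub>R p t) \<le> e1 * norm (y - t)))" for t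
    proof (cases "t \<in> N")
      case True
      then show ?thesis using W by (meson DiffE open_contains_ball subsetD)
    next
      case False
      show ?thesis
      proof (cases "t \<in> {0..T}")
        case True
        then have "(x has_vector_derivative p t) (at t within {0..})"
          using False by (auto simp: N_def)
        then show ?thesis
          using \<open>e1 > 0\<close> False unfolding has_vector_derivative_def has_derivative_within_alt by blast
      qed (use False zero_less_one in blast)
    qed
    then obtain \<rho> where \<rho>: "\<And>t. \<rho> t > 0" "\<And>t. t \<in> N \<Longrightarrow> ball t (\<rho> t) \<subseteq> W"
      "\<And>t y. t \<in> {0..T} - N \<Longrightarrow> 0 \<le> y \<Longrightarrow> norm (y - t) < \<rho> t \<Longrightarrow> norm (x y - x t - (y - t) *\<^sub>R p t) \<le> e1 * norm (y - t)"
      by (metis atLeast_iff)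
    show "\<exists>\<gamma>. gauge \<gamma> \<and> (\<forall>\<D>. \<D> tagged_division_of {0..T} \<and> \<gamma> fine \<D> \<longrightarrow>
             norm ((\<Sum>(t, K)\<in>\<D>. measure lborel K *\<^sub>R q t) - (x T - x 0)) < e)"
    proof (intro exI[of _ "\<lambda>t. ball t (\<rho> t)"] conjI allI impI; (elim conjE)?)
      show "gauge (\<lambda>t. ball t (\<rho> t))"
        using \<rho>(1) by (simp add: gauge_ball_dependent)
    next
      fix \<D> assume \<D>: "\<D> tagged_division_of {0..T}" and fine: "(\<lambda>t. ball t (\<rho> t)) fine \<D>"
      have fin: "finite \<D>" using \<D> by blast
      have K: "\<exists>u v. K = {u..v} \<and> u \<le> t \<and> t \<le> v \<and> 0 \<le> u \<and> v \<le> T \<and> {u..v} \<subseteq> ball t (\<rho> t)" if "(t, K) \<in> \<D>" for t K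
      proof -
        from tagged_division_ofD(2-4)[OF \<D> that] obtain u v where "K = {u..v}" "t \<in> K" "K \<subseteq> {0..T}"
          by auto
        moreover have "K \<subseteq> ball t (\<rho> t)" using fine that by (auto simp: fine_def)
        ultimately show ?thesis by auto
      qed
      have tot: "x T - x 0 = (\<Sum>(t,K)\<in>\<D>. x (Sup K) - x (Inf K))" "T - 0 = (\<Sum>(t,K)\<in>\<D>. Sup K - Inf K)"
        using additive_tagged_division_1[OF \<open>0 \<le> T\<close> \<D>, of x] additive_tagged_division_1[OF \<open>0 \<le> T\<close> \<D>, of "\<lambda>t. t"] by auto
      define B where "B = {tk\<in>\<D>. fst tk \<in> N}"
      have B: "B \<subseteq> \<D>" "finite B" using fin by (auto simp: B_def)
      define r where "r tk = (case tk of (t, K) \<Rightarrow> measure lborel K *\<^sub>R q t - (x (Sup K) - x (Inf K)))" for tk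
      have "(\<Sum>(t, K)\<in>\<D>. measure lborel K *\<^sub>R q t) - (x T - x 0) = sum r \<D>"
        unfolding tot r_def by (simp add: sum_subtractf split_def)
      also have "\<dots> = sum r (\<D> - B) + sum r B"
        using B fin by (simp add: sum.subset_diff)
      finally have eq: "(\<Sum>(t, K)\<in>\<D>. measure lborel K *\<^sub>R q t) - (x T - x 0) = sum r (\<D> - B) + sum r B" .
      have good: "norm (sum r (\<D> - B)) \<le> e1 * T"
      proof -
        have "norm (sum r (\<D> - B)) \<le> (\<Sum>tk\<in>\<D> - B. e1 * (case tk of (t, K) \<Rightarrow> Sup K - Inf K))"
        proof (rule sum_norm_le, clarify)
          fix t K assume tK: "(t, K) \<in> \<D>" "(t, K) \<notin> B"
          with K obtain u v where uv: "K = {u..v}" "u \<le> t" "t \<le> v" "0 \<le> u" "v \<le> T" "{u..v} \<subseteq> ball t (\<rho> t)"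
            by blast
          have "t \<notin> N" using tK by (auto simp: B_def)
          have "u \<in> {u..v}" "v \<in> {u..v}" using uv by auto
          then have "u \<in> ball t (\<rho> t)" "v \<in> ball t (\<rho> t)" using uv(6) by blast+
          then have "norm (u - t) < \<rho> t" "norm (v - t) < \<rho> t" by (auto simp: dist_norm norm_minus_commute)
          then have 1: "norm (x u - x t - (u - t) *\<^sub>R p t) \<le> e1 * norm (u - t)"
            "norm (x v - x t - (v - t) *\<^sub>R p t) \<le> e1 * norm (v - t)"
            using uv \<open>t \<notin> N\<close> by (intro \<rho>(3); simp)+
          have "norm (r (t, K)) = norm ((x u - x t - (u - t) *\<^sub>R p t) - (x v - x t - (v - t) *\<^sub>R p t))"
            using uv \<open>t \<notin> N\<close> by (simp add: r_def q_def algebra_simps)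
          also have "\<dots> \<le> norm (x u - x t - (u - t) *\<^sub>R p t) + norm (x v - x t - (v - t) *\<^sub>R p t)"
            by (rule norm_triangle_ineq4)
          also have "\<dots> \<le> e1 * norm (u - t) + e1 * norm (v - t)"
            using 1 by linarith
          also have "\<dots> = e1 * (v - u)"
            using uv by (simp add: algebra_simps)
          finally show "norm (r (t, K)) \<le> e1 * (Sup K - Inf K)"
            using uv by simp
        qed
        also have "\<dots> \<le> (\<Sum>tk\<in>\<D>. e1 * (case tk of (t, K) \<Rightarrow> Sup K - Inf K))"
        proof (rule sum_mono2)
          fix tk assume "tk \<in> \<D> - (\<D> - B)"
          then show "0 \<le> e1 * (case tk of (t, K) \<Rightarrow> Sup K - Inf K)"
            using K[of "fst tk" "snd tk"] \<open>e1 > 0\<close> by (auto simp: split_def)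
        qed (use fin in auto)
        also have "\<dots> = e1 * T"
          using tot(2) by (simp add: sum_distrib_left[symmetric])
        finally show ?thesis .
      qed
      have bad: "norm (sum r B) < e / 2"
      proof -
        have inj: "inj_on snd B"
        proof (rule inj_onI, clarsimp)
          fix s t K assume st: "(s, K) \<in> B" "(t, K) \<in> B"
          show "s = t"
          proof (rule ccontr)
            assume "s \<noteq> t"
            have "interior K = {}"
              using tagged_division_ofD(5)[OF \<D>, of s K t K] st B \<open>s \<noteq> t\<close> by auto
            moreover obtain u v where "K = {u..v}" "u \<le> s" "s \<le> v"
              using K[of s K] st B by blast
            moreover have "t \<in> K" using tagged_division_ofD(2)[OF \<D>] st B by blast
            ultimately show False
              using \<open>s \<noteq> t\<close> by (auto simp: interior_atLeastAtMost_real)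
          qed
        qed
        have div: "snd ` B division_of \<Union>(snd ` B)"
        proof (rule division_of_subset)
          show "snd ` \<D> division_of \<Union>(snd ` \<D>)"
            using division_of_tagged_division[OF \<D>] division_of_union_self by blast
        qed (use B in auto)
        have KW: "K \<subseteq> W" if "(t, K) \<in> B" for t K
          using K[of t K] that \<rho>(2)[of t] by (auto simp: B_def)
        have "norm (sum r B) \<le> (\<Sum>tk\<in>B. norm (x (Sup (snd tk)) - x (Inf (snd tk))))"
          by (rule sum_norm_le) (auto simp: r_def q_def B_def norm_minus_commute)
        also have "\<dots> = (\<Sum>k\<in>snd ` B. norm (x (Sup k) - x (Inf k)))"
          by (simp add: sum.reindex[OF inj])
        also have "\<dots> < e / 2"
        proof (rule d[OF div])
          show "\<Union>(snd ` B) \<subseteq> {0..T}"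
          proof (rule Union_least)
            fix k assume "k \<in> snd ` B"
            then obtain t where "(t, k) \<in> \<D>" using B by auto
            from tagged_division_ofD(3)[OF \<D> this] show "k \<subseteq> {0..T}" .
          qed
          have "(\<Sum>k\<in>snd ` B. Sup k - Inf k) = (\<Sum>k\<in>snd ` B. measure lebesgue k)"
          proof (rule sum.cong[OF refl])
            fix k assume "k \<in> snd ` B"
            then obtain t where "(t, k) \<in> \<D>" using B by auto
            from K[OF this] show "Sup k - Inf k = measure lebesgue k" by auto
          qed
          also have "\<dots> = measure lebesgue (\<Union>(snd ` B))"
            using content_division[OF div] by simp
          also have "\<dots> \<le> measure lebesgue W"
          proof (rule measure_mono_fmeasurable)
            show "\<Union>(snd ` B) \<subseteq> W" by (auto dest!: KW)
          qed (use W lmeasurable_division[OF div] in auto)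
          finally show "(\<Sum>k\<in>snd ` B. Sup k - Inf k) < d"
            using W by linarith
        qed
        finally show ?thesis .
      qed
      have "e1 * T \<le> e / 2"
        using \<open>0 \<le> T\<close> \<open>e > 0\<close> by (simp add: e1_def field_simps)
      then show "norm ((\<Sum>(t, K)\<in>\<D>. measure lborel K *\<^sub>R q t) - (x T - x 0)) < e"
        unfolding eq using good bad norm_triangle_ineq[of "sum r (\<D> - B)" "sum r B"] by linarith
    qed
  qed
  then show ?thesis
    by (rule has_integral_spike[OF N, rotated]) (auto simp: q_def)
qed

text \<open>
  If the difference quotients at \<open>t\<close> miss \<open>f t\<close> by a fixed amount for arbitrarily short intervals, then
  these intervals form a Vitali cover of the bad points. A disjoint subfamily that is fine for the
  gauge of Henstock's lemma has small total error, hence small total length, and its fivefold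
  enlargement still covers the bad points.
\<close>

lemma negligible_integral_not_differentiable:
  fixes f :: "real \<Rightarrow> 'a::euclidean_space"
  assumes f: "f integrable_on {a..b}"
  shows "negligible {t\<in>{a<..<b}. \<not> ((\<lambda>u. integral {a..u} f) has_vector_derivative f t) (at t)}"
proof -
  define F where "F u = integral {a..u} f" for u
  have F_diff: "integral {s..t} f = F t - F s" if "a \<le> s" "s \<le> t" "t \<le> b" for s t
  proof -
    have "f integrable_on {a..t}"
      by (rule integrable_subinterval_real[OF f]) (use that in auto)
    from Henstock_Kurzweil_Integration.integral_combine[OF that(1,2) this] show ?thesis
      by (simp add: F_def algebra_simps)
  qed
  define E where "E n = {t\<in>{a<..<b}. \<forall>\<delta>>0. \<exists>y\<in>{a..b}. y \<noteq> t \<and> \<bar>y - t\<bar> < \<delta> \<and>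
       norm (F y - F t - (y - t) *\<^sub>R f t) > \<bar>y - t\<bar> / real (Suc n)}" for n
  have "negligible (E n)" for n
    unfolding negligible_outer_le
  proof (intro allI impI)
    fix e :: real assume "e > 0"
    \<comment> \<open>The factor 5 pays for the enlargement, \<open>Suc n\<close> for the relative error defining \<open>E n\<close>.\<close>
    define e1 where "e1 = e / (5 * real (Suc n))"
    have "e1 > 0" using \<open>e > 0\<close> by (simp add: e1_def)
    have "f integrable_on cbox a b" using f by simp
    from Henstock_lemma[OF this \<open>e1 > 0\<close>] obtain \<gamma> where "gauge \<gamma>" and
      \<gamma>: "\<And>p. \<lbrakk>p tagged_partial_division_of (cbox a b); \<gamma> fine p\<rbrakk> \<Longrightarrow>
             sum (\<lambda>(x,k). norm(measure lborel k *\<^sub>R f x - integral k f)) p < e1"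
      by blast
    define I where "I z = {min (fst z) (snd z)..max (fst z) (snd z::real)}" for z
    define K where "K = {z. fst z \<in> E n \<and> snd z \<in> {a..b} \<and> snd z \<noteq> fst z \<and> \<bar>snd z - fst z\<bar> \<le> 2 \<and> I z \<subseteq> \<gamma> (fst z)
       \<and> norm (F (snd z) - F (fst z) - (snd z - fst z) *\<^sub>R f (fst z)) > \<bar>snd z - fst z\<bar> / real (Suc n)}"
    define m where "m z = (fst z + snd z) / 2" for z :: "real \<times> real"
    define r where "r z = \<bar>snd z - fst z\<bar> / 2" for z :: "real \<times> real"
    have I_cball: "cball (m z) (r z) = I z" for z
      by (auto simp: m_def r_def I_def dist_real_def abs_if field_simps min_def max_def split: if_splits)
    have cover: "E n \<subseteq> (\<Union>z\<in>K. cball (m z) (r z))"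
    proof
      fix t assume t: "t \<in> E n"
      have "open (\<gamma> t)" "t \<in> \<gamma> t" using \<open>gauge \<gamma>\<close> by (auto simp: gauge_def)
      then obtain \<delta> where "\<delta> > 0" "ball t \<delta> \<subseteq> \<gamma> t" by (meson open_contains_ball)
      then obtain y where y: "y \<in> {a..b}" "y \<noteq> t" "\<bar>y - t\<bar> < min \<delta> 2" "norm (F y - F t - (y - t) *\<^sub>R f t) > \<bar>y - t\<bar> / real (Suc n)"
      proof -
        have "min \<delta> 2 > 0" using \<open>\<delta> > 0\<close> by simp
        then show ?thesis using t that unfolding E_def mem_Collect_eq by blast
      qed
      have "I (t, y) \<subseteq> ball t \<delta>"
        using y by (auto simp: I_def dist_real_def)
      then have "(t, y) \<in> K"
        using t y \<open>ball t \<delta> \<subseteq> \<gamma> t\<close> by (auto simp: K_def)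
      moreover have "t \<in> cball (m (t, y)) (r (t, y))"
        unfolding I_cball by (auto simp: I_def)
      ultimately show "t \<in> (\<Union>z\<in>K. cball (m z) (r z))" by blast
    qed
    obtain C where C: "countable C" "C \<subseteq> K"
      "pairwise (\<lambda>i j. disjnt (cball (m i) (r i)) (cball (m j) (r j))) C"
      "E n \<subseteq> (\<Union>i\<in>C. cball (m i) (5 * r i))"
      by (rule Vitali_covering_lemma_cballs[OF cover, of 1]) (auto simp: K_def r_def)
    have bound: "(\<Sum>z\<in>J. measure lborel (cball (m z) (5 * r z))) \<le> e" if J: "J \<subseteq> C" "finite J" for J
    proof -
      have JK: "z \<in> K" if "z \<in> J" for z using that J C by auto
      have disj: "disjnt (I z) (I w)" if "z \<in> J" "w \<in> J" "z \<noteq> w" for z w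
        using pairwiseD[OF C(3), of z w] that J(1) unfolding I_cball by blast
      have inj: "inj_on (\<lambda>z. (fst z, I z)) J"
      proof (rule inj_onI)
        fix z w assume zw: "z \<in> J" "w \<in> J" "(fst z, I z) = (fst w, I w)"
        show "z = w"
        proof (rule ccontr)
          assume "z \<noteq> w"
          then have "disjnt (I z) (I w)"
            using disj zw by blast
          moreover have "fst z \<in> I z" by (auto simp: I_def)
          ultimately show False using zw by (auto simp: disjnt_def)
        qed
      qed
      define p where "p = (\<lambda>z. (fst z, I z)) ` J"
      have part: "p tagged_partial_division_of (cbox a b)"
        unfolding tagged_partial_division_of_def
      proof (intro conjI allI impI)
        show "finite p" using J by (simp add: p_def)
      next
        fix t k assume "(t, k) \<in> p"
        then obtain z where z: "z \<in> J" "t = fst z" "k = I z" by (auto simp: p_def)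
        then show "t \<in> k" "k \<subseteq> cbox a b" "\<exists>a b. k = cbox a b"
          using JK[OF z(1)] by (auto simp: I_def K_def E_def)
      next
        fix t k t' k' assume "(t, k) \<in> p \<and> (t', k') \<in> p \<and> (t, k) \<noteq> (t', k')"
        then obtain z w where z: "z \<in> J" "t = fst z" "k = I z"
          and w: "w \<in> J" "t' = fst w" "k' = I w" "w \<noteq> z" by (auto simp: p_def)
        then have "disjnt (I z) (I w)"
          using disj z by blast
        then show "interior k \<inter> interior k' = {}"
          using w z interior_subset by (metis disjnt_def disjnt_subset1 disjnt_subset2)
      qed
      have fine: "\<gamma> fine p"
        using JK by (auto simp: fine_def p_def K_def)
      have "(\<Sum>z\<in>J. measure lborel (cball (m z) (5 * r z))) = (\<Sum>z\<in>J. 5 * \<bar>snd z - fst z\<bar>)"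
        by (rule sum.cong) (auto simp: cball_eq_atLeastAtMost r_def)
      also have "\<dots> \<le> (\<Sum>z\<in>J. (5 * real (Suc n)) * norm (measure lborel (I z) *\<^sub>R f (fst z) - integral (I z) f))"
      proof (rule sum_mono)
        fix z assume "z \<in> J"
        then have z: "fst z \<in> {a<..<b}" "snd z \<in> {a..b}" "norm (F (snd z) - F (fst z) - (snd z - fst z) *\<^sub>R f (fst z)) > \<bar>snd z - fst z\<bar> / real (Suc n)"
          using JK by (auto simp: K_def E_def)
        have "norm (measure lborel (I z) *\<^sub>R f (fst z) - integral (I z) f) = norm (F (snd z) - F (fst z) - (snd z - fst z) *\<^sub>R f (fst z))"
        proof (cases "fst z \<le> snd z")
          case True
          have "integral (I z) f = F (snd z) - F (fst z)" "measure lborel (I z) = snd z - fst z"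
            using z True by (auto simp: I_def intro!: F_diff)
          then show ?thesis by (simp only: norm_minus_commute)
        next
          case False
          have i: "integral (I z) f = F (fst z) - F (snd z)" "measure lborel (I z) = fst z - snd z"
            using z False by (auto simp: I_def intro!: F_diff)
          have "(fst z - snd z) *\<^sub>R f (fst z) - (F (fst z) - F (snd z)) = F (snd z) - F (fst z) - (snd z - fst z) *\<^sub>R f (fst z)"
            by (simp add: algebra_simps)
          then show ?thesis unfolding i by (rule arg_cong)
        qed
        with z(3) show "5 * \<bar>snd z - fst z\<bar> \<le> (5 * real (Suc n)) * norm (measure lborel (I z) *\<^sub>R f (fst z) - integral (I z) f)"
          by (simp add: field_simps del: of_nat_Suc)
      qed
      also have "\<dots> = (5 * real (Suc n)) * (\<Sum>(t,k)\<in>p. norm (measure lborel k *\<^sub>R f t - integral k f))"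
        by (simp add: p_def sum.reindex[OF inj] sum_distrib_left)
      also have "\<dots> \<le> (5 * real (Suc n)) * e1"
        using \<gamma>[OF part fine] by (intro mult_left_mono) auto
      also have "\<dots> = e" by (simp add: e1_def)
      finally show ?thesis .
    qed
    show "\<exists>T. E n \<subseteq> T \<and> T \<in> lmeasurable \<and> measure lebesgue T \<le> e"
    proof (intro exI conjI)
      have fin: "measure lebesgue (\<Union>D) \<le> e" if "D \<subseteq> (\<lambda>z. cball (m z) (5 * r z)) ` C" "finite D" for D
      proof -
        note D = that
        obtain J where J: "J \<subseteq> C" "finite J" "D = (\<lambda>z. cball (m z) (5 * r z)) ` J"
          using finite_subset_image[OF D(2,1)] by blast
        have "measure lebesgue (\<Union>D) \<le> (\<Sum>z\<in>J. measure lebesgue (cball (m z) (5 * r z)))"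
          unfolding J(3) using J by (intro measure_UNION_le) auto
        then show ?thesis using bound[OF J(1,2)] by simp
      qed
      show "E n \<subseteq> \<Union>((\<lambda>z. cball (m z) (5 * r z)) ` C)" using C by auto
      show "\<Union>((\<lambda>z. cball (m z) (5 * r z)) ` C) \<in> lmeasurable"
        by (rule fmeasurable_Union_bound[where B=e]) (use C fin in auto)
      show "measure lebesgue (\<Union>((\<lambda>z. cball (m z) (5 * r z)) ` C)) \<le> e"
        by (rule measure_Union_bound[where B=e]) (use C fin in auto)
    qed
  qed
  then have "negligible (\<Union>n. E n)" by (rule negligible_Union_nat)
  then show ?thesis
  proof (rule negligible_subset, clarify)
    fix t assume t: "t \<in> {a<..<b}" "\<not> ((\<lambda>u. integral {a..u} f) has_vector_derivative f t) (at t)"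
    show "t \<in> (\<Union>n. E n)"
    proof (rule ccontr)
      assume "t \<notin> (\<Union>n. E n)"
      then have *: "\<exists>\<delta>>0. \<forall>y\<in>{a..b}. y \<noteq> t \<longrightarrow> \<bar>y - t\<bar> < \<delta> \<longrightarrow> norm (F y - F t - (y - t) *\<^sub>R f t) \<le> \<bar>y - t\<bar> / real (Suc n)" for n
      proof -
        have "t \<notin> E n" using \<open>t \<notin> (\<Union>n. E n)\<close> by blast
        then show ?thesis using t(1) unfolding E_def mem_Collect_eq not_less[symmetric] by blast
      qed
      have "(F has_vector_derivative f t) (at t within {a..b})"
        unfolding has_vector_derivative_def has_derivative_within_alt
      proof (intro conjI allI impI)
        fix e :: real assume "e > 0"
        then obtain n where n: "1 / real (Suc n) < e" using nat_approx_posE by blast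
        obtain \<delta> where "\<delta>>0" and \<delta>: "\<And>y. y\<in>{a..b} \<Longrightarrow> y \<noteq> t \<Longrightarrow> \<bar>y - t\<bar> < \<delta> \<Longrightarrow> norm (F y - F t - (y - t) *\<^sub>R f t) \<le> \<bar>y - t\<bar> / real (Suc n)"
          using *[of n] by blast
        show "\<exists>d>0. \<forall>y\<in>{a..b}. norm (y - t) < d \<longrightarrow> norm (F y - F t - (y - t) *\<^sub>R f t) \<le> e * norm (y - t)"
        proof (intro exI conjI ballI impI)
          fix y assume y: "y \<in> {a..b}" "norm (y - t) < \<delta>"
          show "norm (F y - F t - (y - t) *\<^sub>R f t) \<le> e * norm (y - t)"
          proof (cases "y = t")
            case False
            then have "norm (F y - F t - (y - t) *\<^sub>R f t) \<le> (1 / real (Suc n)) * \<bar>y - t\<bar>"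
              using \<delta> y by simp
            also have "\<dots> \<le> e * norm (y - t)"
              using n mult_right_mono[of "1 / real (Suc n)" e "\<bar>y - t\<bar>"] by (simp del: of_nat_Suc)
            finally show ?thesis .
          qed simp
        qed (use \<open>\<delta>>0\<close> in auto)
      qed (rule bounded_linear_scaleR_left)
      then have "(F has_vector_derivative f t) (at t)"
        using t(1) at_within_Icc_at[of a t b] by simp
      then show False using t(2) by (simp add: F_def[abs_def])
    qed
  qed
qed

section \<open>Primitives of locally integrable functions\<close>

definition loc_integrable :: "(real \<Rightarrow> 'a::euclidean_space) \<Rightarrow> bool" where
  "loc_integrable p \<longleftrightarrow> (\<forall>T\<ge>0. p absolutely_integrable_on {0..T})"

lemma L1_loc_iff: "L \<in> L1_loc \<longleftrightarrow> (\<forall>t\<ge>0. 0 \<le> L t) \<and> loc_integrable L"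
  by (simp add: L1_loc_def loc_integrable_def)

lemma loc_integrableD:
  assumes "loc_integrable p" "0 \<le> a"
  shows "p absolutely_integrable_on {a..b}"
  by (rule absolutely_integrable_on_subinterval[where S="{0..max 0 b}"])
     (use assms in \<open>auto simp: loc_integrable_def\<close>)

lemma loc_integrable_integrable:
  "loc_integrable p \<Longrightarrow> 0 \<le> a \<Longrightarrow> p integrable_on {a..b}"
  using loc_integrableD absolutely_integrable_on_def by blast

lemma loc_integrable_add:
  "loc_integrable p \<Longrightarrow> loc_integrable q \<Longrightarrow> loc_integrable (\<lambda>t. p t + q t)"
  by (simp add: loc_integrable_def set_integral_add(1))

lemma loc_integrable_linear:
  assumes "loc_integrable p" "bounded_linear h"
  shows "loc_integrable (\<lambda>t. h (p t))"
  using assms absolutely_integrable_linear[where f=p and h=h] by (simp add: loc_integrable_def o_def)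

lemma loc_integrable_cmult:
  fixes p :: "real \<Rightarrow> real"
  shows "loc_integrable p \<Longrightarrow> loc_integrable (\<lambda>t. c * p t)"
  by (rule loc_integrable_linear) (auto intro: bounded_linear_mult_right)

lemma loc_integrable_minus:
  "loc_integrable p \<Longrightarrow> loc_integrable (\<lambda>t. - p t)"
  by (rule loc_integrable_linear) (auto intro: bounded_linear_minus bounded_linear_ident)

lemma loc_integrable_diff:
  "loc_integrable p \<Longrightarrow> loc_integrable q \<Longrightarrow> loc_integrable (\<lambda>t. p t - q t)"
  using loc_integrable_add[of p "\<lambda>t. - q t"] loc_integrable_minus[of q] by simp

lemma loc_integrable_norm:
  "loc_integrable p \<Longrightarrow> loc_integrable (\<lambda>t. norm (p t))"
  by (simp add: loc_integrable_def absolutely_integrable_norm[unfolded o_def])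

lemma loc_integrable_bounded_by:
  assumes "p \<in> borel_measurable (lebesgue_on {0..})" "loc_integrable q"
    and "\<And>t. 0 \<le> t \<Longrightarrow> norm (p t) \<le> q t"
  shows "loc_integrable p"
  unfolding loc_integrable_def
proof (intro allI impI)
  fix T :: real assume "0 \<le> T"
  have "p \<in> borel_measurable (lebesgue_on {0..T})"
    using measurable_restrict_mono[OF assms(1), of "{0..T}"] by auto
  then show "p absolutely_integrable_on {0..T}"
    by (rule measurable_bounded_by_integrable_imp_absolutely_integrable[where g=q])
       (use assms loc_integrable_integrable in auto)
qed

lemma loc_integrable_mult_continuous:
  fixes L u :: "real \<Rightarrow> real"
  assumes "loc_integrable L" "continuous_on {0..} u"
  shows "loc_integrable (\<lambda>t. L t * u t)"
  unfolding loc_integrable_def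
proof (intro allI impI)
  fix T :: real assume T: "0 \<le> T"
  have u: "continuous_on {0..T} u"
    by (rule continuous_on_subset[OF assms(2)]) auto
  have "(\<lambda>t. u t * L t) absolutely_integrable_on {0..T}"
  proof (rule absolutely_integrable_bounded_measurable_product_real)
    show "u \<in> borel_measurable (lebesgue_on {0..T})"
      by (rule continuous_imp_measurable_on_sets_lebesgue[OF u]) auto
    show "bounded (u ` {0..T})"
      by (rule compact_imp_bounded[OF compact_continuous_image[OF u]]) auto
  qed (use assms(1) T in \<open>auto simp: loc_integrable_def\<close>)
  then show "(\<lambda>t. L t * u t) absolutely_integrable_on {0..T}"
    by (simp add: mult.commute)
qed

text \<open>
  The integral form of ``\<open>x\<close> is locally absolutely continuous on the half-line with derivative \<open>p\<close>
  almost everywhere''; the two are linked by \<open>primitiveI\<close>, \<open>primitive_abs_continuous\<close> and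
  \<open>primitive_has_vector_derivative_AE\<close>.
\<close>

definition primitive :: "(real \<Rightarrow> 'a::euclidean_space) \<Rightarrow> (real \<Rightarrow> 'a) \<Rightarrow> bool" where
  "primitive p x \<longleftrightarrow> loc_integrable p \<and> (\<forall>t\<ge>0. x t - x 0 = integral {0..t} p)"

lemma primitive_loc_integrable: "primitive p x \<Longrightarrow> loc_integrable p"
  by (simp add: primitive_def)

lemma primitive_at: "primitive p x \<Longrightarrow> 0 \<le> t \<Longrightarrow> x t - x 0 = integral {0..t} p"
  by (simp add: primitive_def)

lemma primitive_integral: "loc_integrable p \<Longrightarrow> primitive p (\<lambda>t. integral {0..t} p)"
  by (simp add: primitive_def)

lemma primitive_diff_eq:
  assumes "primitive p x" "0 \<le> s" "s \<le> t"
  shows "x t - x s = integral {s..t} p"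
proof -
  have "p integrable_on {0..t}"
    using assms loc_integrable_integrable primitive_loc_integrable by blast
  from Henstock_Kurzweil_Integration.integral_combine[OF assms(2,3) this]
  have "integral {0..s} p + integral {s..t} p = integral {0..t} p" .
  then have "integral {s..t} p = integral {0..t} p - integral {0..s} p"
    by (simp add: eq_diff_eq add.commute)
  also have "\<dots> = (x t - x 0) - (x s - x 0)"
    using primitive_at[OF assms(1)] assms(2,3) by simp
  finally show ?thesis by simp
qed

lemma primitive_cong:
  assumes "primitive p x" "\<And>t. 0 \<le> t \<Longrightarrow> p t = q t" "\<And>t. 0 \<le> t \<Longrightarrow> x t = y t"
  shows "primitive q y"
proof -
  have "integral {0..t} p = integral {0..t} q" for t
    by (rule Henstock_Kurzweil_Integration.integral_cong) (use assms in auto)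
  moreover have "loc_integrable q"
    unfolding loc_integrable_def
  proof (intro allI impI)
    fix T :: real assume "0 \<le> T"
    have "p absolutely_integrable_on {0..T}"
      using assms(1) \<open>0 \<le> T\<close> by (simp add: primitive_def loc_integrable_def)
    then show "q absolutely_integrable_on {0..T}"
      by (rule absolutely_integrable_spike[where S="{}"]) (use assms in auto)
  qed
  moreover have "y t - y 0 = integral {0..t} p" if "0 \<le> t" for t
    using primitive_at[OF assms(1) that] assms(3)[OF that] assms(3)[OF order_refl] by simp
  ultimately show ?thesis by (simp add: primitive_def)
qed

lemma primitive_linear:
  assumes "primitive p x" "bounded_linear h"
  shows "primitive (\<lambda>t. h (p t)) (\<lambda>t. h (x t))"
proof -
  interpret bounded_linear h by fact
  have "h (integral {0..t} p) = integral {0..t} (\<lambda>t. h (p t))" if "0 \<le> t" for t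
    using integral_linear[OF loc_integrable_integrable[OF primitive_loc_integrable[OF assms(1)]] assms(2), of 0 t]
    by (simp add: o_def)
  moreover have "h (x t) - h (x 0) = h (integral {0..t} p)" if "0 \<le> t" for t
    using primitive_at[OF assms(1) that] diff by metis
  ultimately show ?thesis
    using loc_integrable_linear[OF primitive_loc_integrable[OF assms(1)] assms(2)] by (simp add: primitive_def)
qed

lemma primitive_add:
  assumes "primitive p x" "primitive q y"
  shows "primitive (\<lambda>t. p t + q t) (\<lambda>t. x t + y t)"
proof -
  have "integral {0..t} (\<lambda>t. p t + q t) = integral {0..t} p + integral {0..t} q" if "0 \<le> t" for t
    by (intro Henstock_Kurzweil_Integration.integral_add loc_integrable_integrable primitive_loc_integrable[OF assms(1)] primitive_loc_integrable[OF assms(2)]) auto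
  then have "x t + y t - (x 0 + y 0) = integral {0..t} (\<lambda>t. p t + q t)" if "0 \<le> t" for t
    using primitive_at[OF assms(1) that] primitive_at[OF assms(2) that] that by (simp add: algebra_simps)
  moreover have "loc_integrable (\<lambda>t. p t + q t)"
    using assms by (intro loc_integrable_add primitive_loc_integrable)
  ultimately show ?thesis by (simp add: primitive_def)
qed

lemma primitive_minus: "primitive p x \<Longrightarrow> primitive (\<lambda>t. - p t) (\<lambda>t. - x t)"
  by (rule primitive_linear) (auto intro: bounded_linear_minus bounded_linear_ident)

lemma primitive_diff:
  "primitive p x \<Longrightarrow> primitive q y \<Longrightarrow> primitive (\<lambda>t. p t - q t) (\<lambda>t. x t - y t)"
  using primitive_add[of p x "\<lambda>t. - q t" "\<lambda>t. - y t"] primitive_minus[of q y] by simp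

lemma primitive_shift: "primitive p x \<Longrightarrow> primitive p (\<lambda>t. c + x t)"
  by (simp add: primitive_def)

lemma primitive_Pair:
  assumes "primitive p x" "primitive q y"
  shows "primitive (\<lambda>t. (p t, q t)) (\<lambda>t. (x t, y t))"
proof -
  have 1: "bounded_linear (\<lambda>a. (a::'a, 0::'b))" "bounded_linear (\<lambda>b. (0::'a, b::'b))"
    by (intro bounded_linear_Pair bounded_linear_ident bounded_linear_zero)+
  have "primitive (\<lambda>t. (p t, 0) + (0, q t)) (\<lambda>t. (x t, 0) + (0, y t))"
    by (intro primitive_add primitive_linear[OF assms(1) 1(1)] primitive_linear[OF assms(2) 1(2)])
  then show ?thesis by simp
qed

lemma primitive_continuous_on:
  assumes "primitive p x"
  shows "continuous_on {0..} x"
proof -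
  have cont_T: "continuous_on {0..T} x" for T
  proof -
    have "continuous_on {0..T} (\<lambda>t. x 0 + integral {0..t} p)"
      by (intro continuous_intros indefinite_integral_continuous_1 loc_integrable_integrable primitive_loc_integrable[OF assms]) auto
    then show ?thesis
    proof (rule continuous_on_eq)
      fix t assume "t \<in> {0..T}"
      then show "x 0 + integral {0..t} p = x t"
        using primitive_at[OF assms, of t] by (simp add: diff_eq_eq add.commute)
    qed
  qed
  show ?thesis
    unfolding continuous_on_eq_continuous_within
  proof
    fix t :: real assume t: "t \<in> {0..}"
    have "continuous (at t within {0..t+1}) x"
      using cont_T[of "t+1"] t by (auto simp: continuous_on_eq_continuous_within)
    moreover have "at t within {0..t+1} = at t within {0..}"
      by (rule at_within_nhd[of _ "{..<t+1}"]) (use t in auto)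
    ultimately show "continuous (at t within {0..}) x" by (simp add: continuous_within)
  qed
qed

lemma division_interval:
  fixes k :: "real set"
  assumes "D division_of \<Union>D" "\<Union>D \<subseteq> {0..T}" "k \<in> D"
  obtains u v where "k = {u..v}" "0 \<le> u" "u \<le> v" "v \<le> T" "Inf k = u" "Sup k = v"
proof -
  obtain u v where uv: "k = {u..v}" "k \<noteq> {}"
    using division_ofD(3,4)[OF assms(1,3)] by auto
  then have "u \<le> v" by auto
  moreover have "{u..v} \<subseteq> {0..T}" using assms uv by blast
  ultimately show ?thesis using that uv by auto
qed

text \<open>
  Split \<open>norm p\<close> into its truncation at \<open>n\<close> and the rest. The rest has small integral for large \<open>n\<close> by
  dominated convergence, and the truncation contributes at most \<open>n\<close> times the total length.
\<close>

lemma primitive_abs_continuous: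
  assumes x: "primitive p x"
  shows "locally_abs_continuous x"
  unfolding locally_abs_continuous_def
proof (intro allI impI)
  fix T e :: real assume "0 \<le> T" "0 < e"
  define q where "q t = norm (p t)" for t
  have "loc_integrable q"
    unfolding q_def by (intro loc_integrable_norm primitive_loc_integrable[OF x])
  then have q: "q absolutely_integrable_on {a..b}" "q integrable_on {a..b}" if "0 \<le> a" for a b
    using loc_integrableD loc_integrable_integrable that by blast+
  have m: "(\<lambda>t. min (q t) (real n)) integrable_on {a..b}" if "0 \<le> a" for a b n
    using absolutely_integrable_min_1[OF q(1)[OF that] absolutely_integrable_on_const]
    by (auto simp: absolutely_integrable_on_def)
  have "(\<lambda>n. integral {0..T} (\<lambda>t. min (q t) (real n))) \<longlonglongrightarrow> integral {0..T} q"
  proof (rule dominated_convergence(2)[where h=q])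
    fix t :: real
    show "(\<lambda>n. min (q t) (real n)) \<longlonglongrightarrow> q t"
    proof (rule tendsto_eventually)
      show "\<forall>\<^sub>F n in sequentially. min (q t) (real n) = q t"
        using eventually_ge_at_top[of "nat \<lceil>q t\<rceil>"] by eventually_elim linarith
    qed
  qed (use q m in \<open>auto simp: q_def\<close>)
  then have "\<forall>\<^sub>F n in sequentially. integral {0..T} (\<lambda>t. min (q t) (real n)) > integral {0..T} q - e/2"
    by (rule order_tendstoD) (use \<open>0 < e\<close> in auto)
  then obtain n where n: "integral {0..T} (\<lambda>t. min (q t) (real n)) > integral {0..T} q - e/2"
    by (auto simp: eventually_sequentially)
  define h where "h t = q t - min (q t) (real n)" for t
  have h: "h integrable_on {a..b}" if "0 \<le> a" for a b
    unfolding h_def using q(2) m that by (intro integrable_diff) auto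
  have hT: "integral {0..T} h < e/2"
    using n unfolding h_def by (simp add: Henstock_Kurzweil_Integration.integral_diff q m)
  show "\<exists>d>0. \<forall>D. D division_of \<Union>D \<and> \<Union>D \<subseteq> {0..T} \<and> (\<Sum>k\<in>D. Sup k - Inf k) < d \<longrightarrow>
        (\<Sum>k\<in>D. norm (x (Sup k) - x (Inf k))) < e"
  proof (intro exI[of _ "e / (2 * (real n + 1))"] conjI allI impI)
    show "0 < e / (2 * (real n + 1))" using \<open>0 < e\<close> by simp
    fix D assume "D division_of \<Union>D \<and> \<Union>D \<subseteq> {0..T} \<and> (\<Sum>k\<in>D. Sup k - Inf k) < e / (2 * (real n + 1))"
    then have D: "D division_of \<Union>D" "\<Union>D \<subseteq> {0..T}" "(\<Sum>k\<in>D. Sup k - Inf k) < e / (2 * (real n + 1))"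
      by auto
    have "(\<Sum>k\<in>D. norm (x (Sup k) - x (Inf k))) \<le> (\<Sum>k\<in>D. integral k h + real n * (Sup k - Inf k))"
    proof (rule sum_mono)
      fix k assume "k \<in> D"
      with D obtain u v where k: "k = {u..v}" "0 \<le> u" "u \<le> v" "v \<le> T" "Inf k = u" "Sup k = v"
        by (meson division_interval)
      have "norm (x v - x u) = norm (integral {u..v} p)"
        using primitive_diff_eq[OF x] k by simp
      also have "\<dots> \<le> integral {u..v} q"
        by (rule integral_norm_bound_integral)
           (use q k loc_integrable_integrable[OF primitive_loc_integrable[OF x]] in \<open>auto simp: q_def\<close>)
      also have "\<dots> \<le> integral {u..v} (\<lambda>t. h t + real n)"
      proof (rule integral_le)
        show "(\<lambda>t. h t + real n) integrable_on {u..v}"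
          using h[OF k(2)] by (intro integrable_add) auto
      qed (use q k in \<open>auto simp: h_def\<close>)
      also have "\<dots> = integral {u..v} h + real n * (v - u)"
        using k h[OF k(2)] by (subst Henstock_Kurzweil_Integration.integral_add) (auto simp: mult.commute)
      finally show "norm (x (Sup k) - x (Inf k)) \<le> integral k h + real n * (Sup k - Inf k)"
        using k by simp
    qed
    also have "\<dots> = (\<Sum>k\<in>D. integral k h) + real n * (\<Sum>k\<in>D. Sup k - Inf k)"
      by (simp add: sum.distrib sum_distrib_left)
    also have "(\<Sum>k\<in>D. integral k h) \<le> integral {0..T} h"
    proof -
      have hD: "h integrable_on \<Union>D"
      proof (rule integrable_combine_division[OF D(1)])
        fix k assume "k \<in> D"
        with D obtain u v where "k = {u..v}" "0 \<le> u" by (meson division_interval)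
        then show "h integrable_on k" using h by simp
      qed
      have "(\<Sum>k\<in>D. integral k h) = integral (\<Union>D) h"
        by (rule integral_combine_division_topdown[OF hD D(1), symmetric])
      also have "\<dots> \<le> integral {0..T} h"
        by (rule integral_subset_le) (use D hD h in \<open>auto simp: h_def\<close>)
      finally show ?thesis .
    qed
    also have "real n * (\<Sum>k\<in>D. Sup k - Inf k) \<le> real n * (e / (2 * (real n + 1)))"
      using D(3) by (intro mult_left_mono) auto
    also have "\<dots> \<le> e / 2"
      using \<open>0 < e\<close> by (simp add: field_simps)
    finally show "(\<Sum>k\<in>D. norm (x (Sup k) - x (Inf k))) < e"
      using hT by simp
  qed
qed

lemma primitive_has_vector_derivative_AE:
  assumes x: "primitive p x"
  shows "AE t in lebesgue_on {0..}. 0 < t \<and> (x has_vector_derivative p t) (at t)"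
  unfolding AE_half_line_iff_negligible
proof -
  define F where "F = (\<lambda>u. integral {0..u} p)"
  define E where "E n = {t\<in>{0<..<real n}. \<not> (F has_vector_derivative p t) (at t)}" for n
  have "negligible (E n)" for n
    unfolding E_def F_def
    by (rule negligible_integral_not_differentiable) (simp add: loc_integrable_integrable primitive_loc_integrable[OF x])
  then have "negligible ((\<Union>n. E n) \<union> {0})"
    by (intro negligible_Un negligible_Union_nat) auto
  then show "negligible {t. 0 \<le> t \<and> \<not> (0 < t \<and> (x has_vector_derivative p t) (at t))}"
  proof (rule negligible_subset, clarify)
    fix t :: real assume t: "0 \<le> t" "t \<notin> {}" "t \<notin> (\<Union>n. E n)" "\<not> (0 < t \<and> (x has_vector_derivative p t) (at t))"
    show "t = 0"
    proof (rule ccontr)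
      assume "t \<noteq> 0"
      then have "t > 0" using t by simp
      obtain n where "t < real n" using reals_Archimedean2 by blast
      with t \<open>t > 0\<close> have "(F has_vector_derivative p t) (at t)"
        unfolding E_def by auto
      then have "((\<lambda>u. x 0 + F u) has_vector_derivative p t) (at t)"
        by (auto intro!: derivative_eq_intros)
      then have "(x has_vector_derivative p t) (at t)"
      proof (rule has_vector_derivative_transform_within_open[where S="{0<..}"])
        fix u :: real assume "u \<in> {0<..}"
        then show "x 0 + F u = x u"
          using primitive_at[OF x, of u] by (simp add: F_def diff_eq_eq add.commute)
      qed (use \<open>t > 0\<close> in auto)
      with t \<open>t > 0\<close> show False by blast
    qed
  qed
qed

lemma primitive_has_vector_derivative_within_AE:
  assumes "primitive p x"
  shows "AE t in lebesgue_on {0..}. (x has_vector_derivative p t) (at t within {0..})"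
  using primitive_has_vector_derivative_AE[OF assms]
  by eventually_elim (auto intro: has_vector_derivative_at_within)

lemma primitiveI:
  assumes "locally_abs_continuous x" "loc_integrable p"
    and "AE t in lebesgue_on {0..}. (x has_vector_derivative p t) (at t within {0..})"
  shows "primitive p x"
  unfolding primitive_def
proof (intro conjI allI impI)
  fix t :: real assume "0 \<le> t"
  from has_integral_derivative_of_abs_continuous[OF assms(1) this assms(3)]
  show "x t - x 0 = integral {0..t} p" by (simp add: integral_unique)
qed fact

text \<open>
  The chain rule. Both sides are compared through \<open>primitiveI\<close>: composition with a map whose derivative
  is bounded on bounded sets preserves absolute continuity, and the derivative exists wherever that of
  \<open>x\<close> does. The product rule and the rule for exponentials are instances.
\<close>

lemma primitive_compose:
  fixes \<Phi> :: "'a::euclidean_space \<Rightarrow> 'b::euclidean_space"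
  assumes x: "primitive p x"
    and der: "\<And>y. (\<Phi> has_derivative \<Phi>' y) (at y)"
    and bnd: "\<And>R. \<exists>C. \<forall>y h. norm y \<le> R \<longrightarrow> norm (\<Phi>' y h) \<le> C * norm h"
  shows "primitive (\<lambda>t. \<Phi>' (x t) (p t)) (\<lambda>t. \<Phi> (x t))"
proof (rule primitiveI)
  have bound: "\<exists>C\<ge>0. (\<forall>t\<in>{0..T}. \<forall>h. norm (\<Phi>' (x t) h) \<le> C * norm h) \<and>
     (\<forall>s\<in>{0..T}. \<forall>t\<in>{0..T}. norm (\<Phi> (x s) - \<Phi> (x t)) \<le> C * norm (x s - x t))" for T
  proof -
    have "bounded (x ` {0..T})"
      by (intro compact_imp_bounded compact_continuous_image continuous_on_subset[OF primitive_continuous_on[OF x]]) auto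
    then obtain R where R: "\<And>t. t \<in> {0..T} \<Longrightarrow> norm (x t) \<le> R"
      unfolding bounded_iff by blast
    obtain C where C: "\<And>y h. norm y \<le> R \<Longrightarrow> norm (\<Phi>' y h) \<le> C * norm h"
      using bnd by blast
    define C' where "C' = max C 0"
    have C': "norm (\<Phi>' y h) \<le> C' * norm h" if "norm y \<le> R" for y h
      using C[OF that, of h] by (smt (verit) C'_def mult_right_mono norm_ge_zero)
    have "norm (\<Phi> y - \<Phi> z) \<le> C' * norm (y - z)" if "y \<in> cball 0 R" "z \<in> cball 0 R" for y z
    proof (rule differentiable_bound[where S="cball 0 R" and f'=\<Phi>'])
      fix w :: 'a assume "w \<in> cball 0 R"
      then show "onorm (\<Phi>' w) \<le> C'"
        by (intro onorm_le C') simp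
      show "(\<Phi> has_derivative \<Phi>' w) (at w within cball 0 R)"
        using der by (rule has_derivative_at_withinI)
    qed (use that in auto)
    moreover have "C' \<ge> 0" by (simp add: C'_def)
    ultimately show ?thesis using C' R by (intro exI[of _ C']) auto
  qed
  show "locally_abs_continuous (\<lambda>t. \<Phi> (x t))"
    unfolding locally_abs_continuous_def
  proof (intro allI impI)
    fix T e :: real assume "0 \<le> T" "0 < e"
    obtain C where "C \<ge> 0" and C: "\<And>s t. s\<in>{0..T} \<Longrightarrow> t\<in>{0..T} \<Longrightarrow> norm (\<Phi> (x s) - \<Phi> (x t)) \<le> C * norm (x s - x t)"
      using bound by metis
    have "e / (C + 1) > 0" using \<open>0 < e\<close> \<open>C \<ge> 0\<close> by simp
    then obtain d where "d > 0" and d: "\<And>D. D division_of \<Union>D \<Longrightarrow> \<Union>D \<subseteq> {0..T} \<Longrightarrow> (\<Sum>k\<in>D. Sup k - Inf k) < d \<Longrightarrow>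
        (\<Sum>k\<in>D. norm (x (Sup k) - x (Inf k))) < e / (C + 1)"
      using primitive_abs_continuous[OF x] \<open>0 \<le> T\<close> unfolding locally_abs_continuous_def by meson
    show "\<exists>d>0. \<forall>D. D division_of \<Union>D \<and> \<Union>D \<subseteq> {0..T} \<and> (\<Sum>k\<in>D. Sup k - Inf k) < d \<longrightarrow>
        (\<Sum>k\<in>D. norm (\<Phi> (x (Sup k)) - \<Phi> (x (Inf k)))) < e"
    proof (intro exI[of _ d] conjI allI impI \<open>d > 0\<close>)
      fix D assume D: "D division_of \<Union>D \<and> \<Union>D \<subseteq> {0..T} \<and> (\<Sum>k\<in>D. Sup k - Inf k) < d"
      have "(\<Sum>k\<in>D. norm (\<Phi> (x (Sup k)) - \<Phi> (x (Inf k)))) \<le> (\<Sum>k\<in>D. C * norm (x (Sup k) - x (Inf k)))"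
      proof (rule sum_mono)
        fix k assume "k \<in> D"
        with D obtain u v where k: "k = {u..v}" "0 \<le> u" "u \<le> v" "v \<le> T" "Inf k = u" "Sup k = v"
          by (meson division_interval)
        then show "norm (\<Phi> (x (Sup k)) - \<Phi> (x (Inf k))) \<le> C * norm (x (Sup k) - x (Inf k))"
          by (simp only:) (intro C, auto)
      qed
      also have "\<dots> = C * (\<Sum>k\<in>D. norm (x (Sup k) - x (Inf k)))"
        by (simp add: sum_distrib_left)
      also have "\<dots> \<le> C * (e / (C + 1))"
        using D d \<open>C \<ge> 0\<close> by (intro mult_left_mono) (auto intro: less_imp_le)
      also have "\<dots> < e"
        using \<open>C \<ge> 0\<close> \<open>0 < e\<close> by (simp add: field_simps)
      finally show "(\<Sum>k\<in>D. norm (\<Phi> (x (Sup k)) - \<Phi> (x (Inf k)))) < e" .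
    qed
  qed
  show ae: "AE t in lebesgue_on {0..}. ((\<lambda>t. \<Phi> (x t)) has_vector_derivative \<Phi>' (x t) (p t)) (at t within {0..})"
    using primitive_has_vector_derivative_within_AE[OF x]
  proof eventually_elim
    case (elim t)
    interpret bounded_linear "\<Phi>' (x t)" using der by (rule has_derivative_bounded_linear)
    show ?case
      using has_derivative_compose[OF elim[unfolded has_vector_derivative_def] der]
      unfolding has_vector_derivative_def by (simp add: scaleR)
  qed
  show "loc_integrable (\<lambda>t. \<Phi>' (x t) (p t))"
    unfolding loc_integrable_def
  proof (intro allI impI)
    fix T :: real assume "0 \<le> T"
    obtain C where C: "\<And>t h. t\<in>{0..T} \<Longrightarrow> norm (\<Phi>' (x t) h) \<le> C * norm h"
      using bound by metis
    show "(\<lambda>t. \<Phi>' (x t) (p t)) absolutely_integrable_on {0..T}"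
    proof (rule absolutely_integrable_integrable_bound)
      show "norm (\<Phi>' (x t) (p t)) \<le> C * norm (p t)" if "t \<in> {0..T}" for t
        by (rule C[OF that])
      show "(\<lambda>t. \<Phi>' (x t) (p t)) integrable_on {0..T}"
        using has_integral_derivative_of_abs_continuous[OF \<open>locally_abs_continuous (\<lambda>t. \<Phi> (x t))\<close> \<open>0 \<le> T\<close> ae]
        by (rule has_integral_integrable)
      show "(\<lambda>t. C * norm (p t)) integrable_on {0..T}"
        by (intro loc_integrable_integrable loc_integrable_cmult loc_integrable_norm primitive_loc_integrable[OF x]) simp
    qed
  qed
qed

lemma primitive_bilinear:
  fixes prod :: "'a::euclidean_space \<Rightarrow> 'b::euclidean_space \<Rightarrow> 'c::euclidean_space"
  assumes bl: "bounded_bilinear prod" and x: "primitive p x" and y: "primitive q y"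
  shows "primitive (\<lambda>t. prod (x t) (q t) + prod (p t) (y t)) (\<lambda>t. prod (x t) (y t))"
proof -
  interpret bounded_bilinear prod by fact
  obtain K where K: "K > 0" "\<And>a b. norm (prod a b) \<le> norm a * norm b * K"
    using pos_bounded by blast
  have "primitive (\<lambda>t. (\<lambda>z h. prod (fst z) (snd h) + prod (fst h) (snd z)) (x t, y t) (p t, q t))
     (\<lambda>t. (\<lambda>z. prod (fst z) (snd z)) (x t, y t))"
  proof (rule primitive_compose[OF primitive_Pair[OF x y]])
    show "((\<lambda>z. prod (fst z) (snd z)) has_derivative (\<lambda>h. prod (fst z) (snd h) + prod (fst h) (snd z))) (at z)" for z
      by (intro FDERIV has_derivative_fst has_derivative_snd has_derivative_ident)
    show "\<exists>C. \<forall>z h. norm z \<le> R \<longrightarrow> norm (prod (fst z) (snd h) + prod (fst h) (snd z)) \<le> C * norm h" for R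
    proof (intro exI[of _ "2 * R * K"] allI impI)
      fix z :: "'a \<times> 'b" and h :: "'a \<times> 'b" assume z: "norm z \<le> R"
      have *: "norm (fst h) \<le> norm h" "norm (snd h) \<le> norm h" "norm (fst z) \<le> R" "norm (snd z) \<le> R"
        using norm_fst_le[of "fst h" "snd h"] norm_snd_le[of "snd h" "fst h"]
          norm_fst_le[of "fst z" "snd z"] norm_snd_le[of "snd z" "fst z"] z by auto
      have "norm (prod (fst z) (snd h) + prod (fst h) (snd z)) \<le> norm (fst z) * norm (snd h) * K + norm (fst h) * norm (snd z) * K"
        using K(2) by (meson add_mono norm_triangle_le)
      also have "\<dots> \<le> R * norm h * K + norm h * R * K"
        using * K(1) norm_ge_zero[of z] z by (intro add_mono mult_mono mult_nonneg_nonneg order_trans[OF norm_ge_zero z]) auto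
      finally show "norm (prod (fst z) (snd h) + prod (fst h) (snd z)) \<le> 2 * R * K * norm h"
        by (simp add: algebra_simps)
    qed
  qed
  then show ?thesis by simp
qed

section \<open>Inequalities of Gronwall type\<close>

lemma primitive_mono:
  fixes v :: "real \<Rightarrow> real"
  assumes "primitive q v" "0 \<le> s" "s \<le> t" "\<And>r. r \<in> {s..t} \<Longrightarrow> 0 \<le> q r"
  shows "v s \<le> v t"
proof -
  have "q integrable_on {s..t}"
    by (rule loc_integrable_integrable[OF primitive_loc_integrable[OF assms(1)] assms(2)])
  then have "0 \<le> integral {s..t} q"
    by (rule integral_nonneg) (use assms in auto)
  then show ?thesis
    using primitive_diff_eq[OF assms(1-3)] by simp
qed

lemma primitive_exp:
  fixes l :: "real \<Rightarrow> real"
  assumes "primitive L l"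
  shows "primitive (\<lambda>t. a * L t * exp (a * l t + b)) (\<lambda>t. exp (a * l t + b))"
proof -
  have "primitive (\<lambda>t. (\<lambda>y h. a * h * exp (a * y + b)) (l t) (L t)) (\<lambda>t. (\<lambda>y. exp (a * y + b)) (l t))"
  proof (rule primitive_compose[OF assms])
    show "((\<lambda>y. exp (a * y + b)) has_derivative (\<lambda>h. a * h * exp (a * y + b))) (at y)" for y
      by (auto intro!: derivative_eq_intros)
    show "\<exists>C. \<forall>y h. norm y \<le> R \<longrightarrow> norm (a * h * exp (a * y + b)) \<le> C * norm h" for R
    proof (intro exI[of _ "\<bar>a\<bar> * exp (\<bar>a\<bar> * R + b)"] allI impI)
      fix y h :: real assume "norm y \<le> R"
      then have "\<bar>a\<bar> * \<bar>y\<bar> \<le> \<bar>a\<bar> * R" by (intro mult_left_mono) auto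
      moreover have "a * y \<le> \<bar>a\<bar> * \<bar>y\<bar>" by (metis abs_ge_self abs_mult)
      ultimately have "exp (a * y + b) \<le> exp (\<bar>a\<bar> * R + b)" by simp
      then have "\<bar>a\<bar> * \<bar>h\<bar> * exp (a * y + b) \<le> \<bar>a\<bar> * \<bar>h\<bar> * exp (\<bar>a\<bar> * R + b)"
        by (intro mult_left_mono) auto
      then show "norm (a * h * exp (a * y + b)) \<le> \<bar>a\<bar> * exp (\<bar>a\<bar> * R + b) * norm h"
        by (simp add: abs_mult mult_ac)
    qed
  qed
  then show ?thesis .
qed

text \<open>
  The factor \<open>exp (- l)\<close> turns the differential inequality into monotonicity of \<open>exp (- l) * v\<close>.
\<close>

lemma gronwall_differential:
  fixes v l :: "real \<Rightarrow> real"
  assumes v: "primitive q v" and l: "primitive L l" and "0 \<le> s" "s \<le> t"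
    and q: "\<And>r. r \<in> {s..t} \<Longrightarrow> q r \<le> L r * v r"
  shows "v t \<le> v s * exp (l t - l s)"
proof -
  have "primitive (\<lambda>r. exp ((-1) * l r + 0) * q r + ((-1) * L r * exp ((-1) * l r + 0)) * v r) (\<lambda>r. exp ((-1) * l r + 0) * v r)"
    by (rule primitive_bilinear[OF bounded_bilinear_mult primitive_exp[OF l] v])
  from primitive_minus[OF this]
  have p: "primitive (\<lambda>r. exp (- l r) * (L r * v r - q r)) (\<lambda>r. - (exp (- l r) * v r))"
    by (rule primitive_cong) (auto simp: algebra_simps)
  have "- (exp (- l s) * v s) \<le> - (exp (- l t) * v t)"
    by (rule primitive_mono[OF p assms(3,4)]) (use q in auto)
  then have "exp (l t) * (exp (- l t) * v t) \<le> exp (l t) * (exp (- l s) * v s)"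
    by (intro mult_left_mono) auto
  then show ?thesis
    by (simp add: exp_minus exp_diff field_simps)
qed

lemma gronwall_differential_backward:
  fixes v l :: "real \<Rightarrow> real"
  assumes v: "primitive q v" and l: "primitive L l" and "0 \<le> s" "s \<le> t"
    and q: "\<And>r. r \<in> {s..t} \<Longrightarrow> - (L r * v r) \<le> q r"
  shows "v s \<le> v t * exp (l t - l s)"
proof -
  have "primitive (\<lambda>r. exp (1 * l r + 0) * q r + (1 * L r * exp (1 * l r + 0)) * v r) (\<lambda>r. exp (1 * l r + 0) * v r)"
    by (rule primitive_bilinear[OF bounded_bilinear_mult primitive_exp[OF l] v])
  then have p: "primitive (\<lambda>r. exp (l r) * (L r * v r + q r)) (\<lambda>r. exp (l r) * v r)"
    by (rule primitive_cong) (auto simp: algebra_simps)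
  have "exp (l s) * v s \<le> exp (l t) * v t"
  proof (rule primitive_mono[OF p assms(3,4)])
    fix r assume "r \<in> {s..t}"
    from q[OF this] show "0 \<le> exp (l r) * (L r * v r + q r)" by (intro mult_nonneg_nonneg) auto
  qed
  then have "exp (- l s) * (exp (l s) * v s) \<le> exp (- l s) * (exp (l t) * v t)"
    by (intro mult_left_mono) auto
  then show ?thesis
    by (simp add: exp_minus exp_diff field_simps)
qed

lemma primitive_norm_diff_le:
  assumes x: "primitive p x" and "0 \<le> s" "s \<le> t" and g: "g integrable_on {s..t}"
    and le: "\<And>r. r \<in> {s..t} \<Longrightarrow> norm (p r) \<le> g r"
  shows "norm (x t - x s) \<le> integral {s..t} g"
  unfolding primitive_diff_eq[OF assms(1-3)]
  by (rule integral_norm_bound_integral)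
     (use g le loc_integrable_integrable[OF primitive_loc_integrable[OF x] \<open>0 \<le> s\<close>] in auto)

text \<open>
  Apply the differential version to the right-hand side of the integral inequality for \<open>norm (x t)\<close>,
  which is itself a primitive. Integrating from the left end of the interval gives the forward
  estimate, integrating from its right end the backward one. The latter bounds the initial states of
  trajectories by their states at a later time.
\<close>

lemma
  fixes x :: "real \<Rightarrow> 'a::euclidean_space"
  assumes x: "primitive p x" and l: "primitive L l" and L: "\<And>r. 0 \<le> r \<Longrightarrow> 0 \<le> L r"
    and m: "m integrable_on {s..T}" "\<And>r. r \<in> {s..T} \<Longrightarrow> 0 \<le> m r"
    and "0 \<le> s" "t \<in> {s..T}"
    and le: "\<And>r. r \<in> {s..T} \<Longrightarrow> norm (p r) \<le> L r * norm (x r) + m r"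
  shows gronwall_forward: "norm (x t) \<le> (norm (x s) + integral {s..T} m) * exp (l T - l s)"
    and gronwall_backward: "norm (x t) \<le> (norm (x T) + integral {s..T} m) * exp (l T - l s)"
proof -
  have k: "loc_integrable (\<lambda>r. L r * norm (x r))"
    using primitive_loc_integrable[OF l] primitive_continuous_on[OF x]
    by (intro loc_integrable_mult_continuous continuous_intros)
  define V where "V r = integral {0..r} (\<lambda>r. L r * norm (x r))" for r
  have V: "primitive (\<lambda>r. L r * norm (x r)) V"
    unfolding V_def by (rule primitive_integral[OF k])
  have t: "s \<le> t" "t \<le> T" "0 \<le> t" using assms by auto
  have l_mono: "l s \<le> l t" "l t \<le> l T"
    using primitive_mono[OF l \<open>0 \<le> s\<close> t(1)] primitive_mono[OF l t(3,2)] L assms by auto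
  have m_int: "m integrable_on {a..b}" if "s \<le> a" "b \<le> T" for a b
    by (rule integrable_subinterval_real[OF m(1)]) (use that in auto)
  have m_le: "integral {a..b} m \<le> integral {s..T} m" if "s \<le> a" "b \<le> T" for a b
    by (rule integral_subset_le) (use that m m_int in auto)
  have m_nonneg: "0 \<le> integral {s..T} m"
    using m by (intro integral_nonneg) auto
  have step: "norm (x b - x a) \<le> V b - V a + integral {s..T} m" if ab: "s \<le> a" "a \<le> b" "b \<le> T" for a b
  proof -
    have ki: "(\<lambda>r. L r * norm (x r)) integrable_on {a..b}"
      by (rule loc_integrable_integrable[OF k]) (use ab assms in auto)
    have "norm (x b - x a) \<le> integral {a..b} (\<lambda>r. L r * norm (x r) + m r)"
    proof (rule primitive_norm_diff_le[OF x])
      show "(\<lambda>r. L r * norm (x r) + m r) integrable_on {a..b}"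
        by (intro integrable_add ki m_int ab)
    qed (use assms ab le in auto)
    also have "\<dots> = integral {a..b} (\<lambda>r. L r * norm (x r)) + integral {a..b} m"
      by (rule Henstock_Kurzweil_Integration.integral_add[OF ki m_int]) (use ab in auto)
    also have "integral {a..b} (\<lambda>r. L r * norm (x r)) = V b - V a"
      using primitive_diff_eq[OF V, of a b] ab assms by simp
    finally show ?thesis using m_le[of a b] ab by simp
  qed
  show "norm (x t) \<le> (norm (x s) + integral {s..T} m) * exp (l T - l s)"
  proof -
    define a where "a = norm (x s) + integral {s..T} m"
    have xv: "norm (x r) \<le> (a - V s) + V r" if "r \<in> {s..T}" for r
      using norm_triangle_sub[of "x r" "x s"] step[of s r] that by (simp add: a_def)
    have "(a - V s) + V t \<le> ((a - V s) + V s) * exp (l t - l s)"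
      by (rule gronwall_differential[OF primitive_shift[OF V] l \<open>0 \<le> s\<close> t(1)])
         (use xv L t \<open>0 \<le> s\<close> in \<open>auto intro: mult_left_mono\<close>)
    also have "\<dots> \<le> a * exp (l T - l s)"
      using m_nonneg l_mono by (simp add: a_def mult_left_mono)
    finally show ?thesis using xv[of t] assms by (simp add: a_def)
  qed
  show "norm (x t) \<le> (norm (x T) + integral {s..T} m) * exp (l T - l s)"
  proof -
    define a where "a = norm (x T) + integral {s..T} m"
    have xv: "norm (x r) \<le> (a + V T) + - V r" if "r \<in> {s..T}" for r
      using norm_triangle_sub[of "x r" "x T"] step[of r T] that by (simp add: a_def norm_minus_commute)
    have "(a + V T) + - V t \<le> ((a + V T) + - V T) * exp (l T - l t)"
    proof (rule gronwall_differential_backward[OF primitive_shift[OF primitive_minus[OF V]] l t(3,2)])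
      fix r assume "r \<in> {t..T}"
      then have "norm (x r) \<le> (a + V T) + - V r" "0 \<le> L r" using xv[of r] L[of r] t by auto
      then show "- (L r * ((a + V T) + - V r)) \<le> - (L r * norm (x r))"
        unfolding neg_le_iff_le by (rule mult_left_mono)
    qed
    also have "\<dots> \<le> a * exp (l T - l s)"
      using m_nonneg l_mono by (simp add: a_def mult_left_mono)
    finally show ?thesis using xv[of t] assms by (simp add: a_def)
  qed
qed

section \<open>Differential equations with right-hand side measurable in time\<close>

text \<open>
  For a simple function \<open>x\<close> the superposition is a countable case distinction between measurable
  functions; the general case is a pointwise limit, by continuity in the state.
\<close>

lemma caratheodory_superposition_measurable:
  fixes F :: "real \<Rightarrow> 'a::euclidean_space \<Rightarrow> 'b::euclidean_space"
  assumes meas: "\<And>y. (\<lambda>t. F t y) \<in> borel_measurable (lebesgue_on {0..})"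
    and cont: "\<And>t. 0 \<le> t \<Longrightarrow> continuous_on UNIV (F t)"
    and x: "continuous_on {0..} x"
  shows "(\<lambda>t. F t (x t)) \<in> borel_measurable (lebesgue_on {0..})"
proof -
  let ?M = "lebesgue_on {0::real..}"
  have "x \<in> borel_measurable ?M"
    by (rule continuous_imp_measurable_on_sets_lebesgue[OF x]) auto
  then obtain s where s: "\<And>i. simple_function ?M (s i)" "\<And>t. t \<in> space ?M \<Longrightarrow> (\<lambda>i. s i t) \<longlonglongrightarrow> x t"
    using borel_measurable_implies_sequence_metric[of x ?M 0] by blast
  have "(\<lambda>t. F t (s i t)) \<in> borel_measurable ?M" for i
  proof (rule measurable_compose_countable'[where I="s i ` space ?M" and g="s i" and f="\<lambda>y t. F t y"])
    show "countable (s i ` space ?M)"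
      using simple_functionD(1)[OF s(1)] by (rule countable_finite)
    then show "s i \<in> measurable ?M (count_space (s i ` space ?M))"
      by (subst measurable_count_space_eq_countable) (use simple_functionD(2)[OF s(1)] in auto)
  qed (rule meas)
  moreover have "(\<lambda>i. F t (s i t)) \<longlonglongrightarrow> F t (x t)" if "t \<in> space ?M" for t
  proof -
    have "0 \<le> t" using that by simp
    from cont[OF this] have "isCont (F t) (x t)" by (simp add: continuous_on_eq_continuous_at)
    then show ?thesis using s(2)[OF that] by (rule isCont_tendsto_compose)
  qed
  ultimately show ?thesis by (rule borel_measurable_LIMSEQ_metric)
qed

text \<open>
  One rate \<open>L\<close> serves both as Lipschitz constant and as bound at the origin, so that the right-hand
  side grows at most like \<open>L t * (1 + norm y)\<close>; \<open>l\<close> is its integral, the natural clock of the equation.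
\<close>

locale lipschitz_ode =
  fixes F :: "real \<Rightarrow> 'a::euclidean_space \<Rightarrow> 'a" and L l :: "real \<Rightarrow> real"
  assumes measurable_rhs: "\<And>y. (\<lambda>t. F t y) \<in> borel_measurable (lebesgue_on {0..})"
    and lipschitz_rhs: "\<And>t y z. 0 \<le> t \<Longrightarrow> norm (F t y - F t z) \<le> L t * norm (y - z)"
    and bounded_rhs_0: "\<And>t. 0 \<le> t \<Longrightarrow> norm (F t 0) \<le> L t"
    and primitive_lipschitz: "primitive L l"
begin

lemma L_nonneg: "0 \<le> t \<Longrightarrow> 0 \<le> L t"
  using bounded_rhs_0[of t] norm_ge_zero order_trans by blast

lemma growth_rhs: "0 \<le> t \<Longrightarrow> norm (F t y) \<le> L t * (1 + norm y)"
  using bounded_rhs_0[of t] lipschitz_rhs[of t y 0] norm_triangle_sub[of "F t y" "F t 0"]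
  by (simp add: algebra_simps)

lemma continuous_rhs:
  assumes "0 \<le> t"
  shows "continuous_on UNIV (F t)"
proof (rule lipschitz_on_continuous_on)
  show "(L t)-lipschitz_on UNIV (F t)"
    using lipschitz_rhs[OF assms] L_nonneg[OF assms] by (intro lipschitz_onI) (auto simp: dist_norm)
qed

lemma loc_integrable_rhs:
  assumes x: "continuous_on {0..} x"
  shows "loc_integrable (\<lambda>t. F t (x t))"
proof (rule loc_integrable_bounded_by)
  show "(\<lambda>t. F t (x t)) \<in> borel_measurable (lebesgue_on {0..})"
    by (rule caratheodory_superposition_measurable[OF measurable_rhs continuous_rhs x])
  show "loc_integrable (\<lambda>t. L t * (1 + norm (x t)))"
    using primitive_loc_integrable[OF primitive_lipschitz] x
    by (intro loc_integrable_mult_continuous continuous_intros)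
qed (rule growth_rhs)

lemma solution_unique:
  assumes x: "primitive (\<lambda>t. F t (x t)) x" and z: "primitive (\<lambda>t. F t (z t)) z"
    and "0 \<le> c" "x c = z c" "0 \<le> t"
  shows "x t = z t"
proof -
  have d: "primitive (\<lambda>t. F t (x t) - F t (z t)) (\<lambda>t. x t - z t)"
    by (rule primitive_diff[OF x z])
  have le: "norm (F t (x t) - F t (z t)) \<le> L t * norm (x t - z t) + 0" if "0 \<le> t" for t
    using lipschitz_rhs[OF that] by simp
  have "norm (x t - z t) \<le> 0"
  proof (cases "c \<le> t")
    case True
    have "norm (x t - z t) \<le> (norm (x c - z c) + integral {c..t} (\<lambda>r. 0)) * exp (l t - l c)"
      by (rule gronwall_forward[OF d primitive_lipschitz]) (use L_nonneg le True \<open>0 \<le> c\<close> in auto)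
    then show ?thesis using assms by simp
  next
    case False
    have "norm (x t - z t) \<le> (norm (x c - z c) + integral {t..c} (\<lambda>r. 0)) * exp (l c - l t)"
      by (rule gronwall_backward[OF d primitive_lipschitz]) (use L_nonneg le False \<open>0 \<le> t\<close> in auto)
    then show ?thesis using assms by simp
  qed
  then show ?thesis by simp
qed

text \<open>
  Up to sign, \<open>L * exp (2 * \<bar>l - l c\<bar>)\<close> is half the derivative of the exponential. This inequality is the
  contraction estimate of \<open>solution_exists\<close>, and it makes the constant there equal to one half.
\<close>

lemma weighted_integral_le:
  assumes "0 \<le> c" "0 \<le> t" "a = min c t" "b = max c t"
  shows "(\<lambda>r. L r * exp (2 * \<bar>l r - l c\<bar>)) integrable_on {a..b}" (is ?int)
    and "integral {a..b} (\<lambda>r. L r * exp (2 * \<bar>l r - l c\<bar>)) \<le> exp (2 * \<bar>l t - l c\<bar>) / 2" (is ?le)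
proof -
  have l_mono: "l r \<le> l r'" if "0 \<le> r" "r \<le> r'" for r r'
    by (rule primitive_mono[OF primitive_lipschitz that]) (use that L_nonneg in auto)
  define \<sigma> :: real where "\<sigma> = (if c \<le> t then 1 else - 1)"
  have ab: "0 \<le> a" "a \<le> b" using assms by auto
  have P: "primitive (\<lambda>r. 2 * \<sigma> * L r * exp (2 * \<sigma> * l r + (- 2 * \<sigma> * l c))) (\<lambda>r. exp (2 * \<sigma> * l r + (- 2 * \<sigma> * l c)))"
    (is "primitive ?p ?x")
    by (rule primitive_exp[OF primitive_lipschitz])
  have x_eq: "?x r = exp (2 * \<bar>l r - l c\<bar>)" if "r \<in> {a..b}" for r
    using l_mono[of c r] l_mono[of r c] that assms by (auto simp: \<sigma>_def algebra_simps split: if_splits)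
  have eq: "\<sigma> / 2 * ?p r = L r * exp (2 * \<bar>l r - l c\<bar>)" if "r \<in> {a..b}" for r
    unfolding x_eq[OF that] by (simp add: \<sigma>_def)
  have "(\<lambda>r. \<sigma> / 2 * ?p r) integrable_on {a..b}"
    by (rule loc_integrable_integrable[OF loc_integrable_cmult[OF primitive_loc_integrable[OF P]] ab(1)])
  then show ?int by (rule integrable_eq) (rule eq)
  have "integral {a..b} (\<lambda>r. L r * exp (2 * \<bar>l r - l c\<bar>)) = integral {a..b} (\<lambda>r. \<sigma> / 2 * ?p r)"
    by (rule Henstock_Kurzweil_Integration.integral_cong) (simp only: eq)
  also have "\<dots> = \<sigma> / 2 * integral {a..b} ?p"
    by (rule integral_mult_right)
  also have "integral {a..b} ?p = ?x b - ?x a"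
    using primitive_diff_eq[OF P ab] by simp
  also have "\<sigma> / 2 * (?x b - ?x a) = \<sigma> / 2 * (exp (2 * \<bar>l b - l c\<bar>) - exp (2 * \<bar>l a - l c\<bar>))"
    using x_eq[of a] x_eq[of b] ab by simp
  also have "\<dots> \<le> exp (2 * \<bar>l t - l c\<bar>) / 2"
    using assms by (auto simp: \<sigma>_def min_def max_def)
  finally show ?le .
qed

text \<open>
  Picard's operator is a contraction on the space of functions bounded after division by the weight
  \<open>w t = exp (2 * \<bar>l t - l c\<bar>)\<close>, so Banach's theorem gives a solution on the whole half-line at once. The
  initial time \<open>c\<close> is arbitrary, since solutions must also be continued backwards in time.
\<close>

lemma solution_exists:
  assumes "0 \<le> c"
  shows "\<exists>x. primitive (\<lambda>t. F t (x t)) x \<and> x c = y"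
proof -
  \<comment> \<open>Bounded continuous functions live on the whole real line; negative times are mapped to \<open>0\<close>.\<close>
  define pos where "pos t = max 0 t" for t :: real
  have pos: "0 \<le> pos t" "0 \<le> t \<Longrightarrow> pos t = t" for t by (auto simp: pos_def)
  have pos_cont: "continuous_on UNIV pos" unfolding pos_def by (intro continuous_intros)
  define w where "w t = exp (2 * \<bar>l (pos t) - l c\<bar>)" for t
  have w_pos: "w t > 0" and w1: "w t \<ge> 1" for t by (auto simp: w_def)
  have cont_pos: "continuous_on UNIV (\<lambda>t. h (pos t))" if "continuous_on {0..} h" for h :: "real \<Rightarrow> 'b::topological_space"
    by (rule continuous_on_compose2[OF that pos_cont]) (use pos in auto)
  have w_cont: "continuous_on UNIV w"
    unfolding w_def by (intro continuous_intros cont_pos primitive_continuous_on[OF primitive_lipschitz])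
  define state where "state z t = w t *\<^sub>R apply_bcontfun z t" for z :: "real \<Rightarrow>\<^sub>C 'a" and t
  have state_cont: "continuous_on S (state z)" for z S
    unfolding state_def by (intro continuous_intros continuous_on_subset[OF w_cont]) auto
  define \<Phi> where "\<Phi> z t = integral {0..t} (\<lambda>s. F s (state z s))" for z t
  have \<Phi>: "primitive (\<lambda>s. F s (state z s)) (\<Phi> z)" for z
    unfolding \<Phi>_def by (intro primitive_integral loc_integrable_rhs state_cont)
  \<comment> \<open>An increment of a primitive from \<open>c\<close> is controlled by the weight on either side of \<open>c\<close>.\<close>
  have incr: "norm (X (pos t) - X c) \<le> B * (w t / 2)"
    if X: "primitive p X" and p: "\<And>r. 0 \<le> r \<Longrightarrow> norm (p r) \<le> B * (L r * w r)" and "0 \<le> B" for X :: "real \<Rightarrow> 'a" and p B t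
  proof -
    define a b where "a = min c (pos t)" and "b = max c (pos t)"
    have ab: "0 \<le> a" "a \<le> b" using assms pos by (auto simp: a_def b_def)
    note W = weighted_integral_le[OF assms pos(1)[of t] a_def b_def]
    have wab: "exp (2 * \<bar>l r - l c\<bar>) = w r" if "r \<in> {a..b}" for r
      using that ab pos(2)[of r] by (simp add: w_def)
    have i: "(\<lambda>r. B * (L r * w r)) integrable_on {a..b}"
      by (rule integrable_eq[OF integrable_on_cmult_left[OF W(1), of B]]) (simp add: wab)
    have "norm (X b - X a) \<le> integral {a..b} (\<lambda>r. B * (L r * w r))"
      by (rule primitive_norm_diff_le[OF X ab i]) (use p ab in auto)
    also have "\<dots> = integral {a..b} (\<lambda>r. B * (L r * exp (2 * \<bar>l r - l c\<bar>)))"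
      by (rule Henstock_Kurzweil_Integration.integral_cong) (simp add: wab)
    also have "\<dots> = B * integral {a..b} (\<lambda>r. L r * exp (2 * \<bar>l r - l c\<bar>))"
      by (rule integral_mult_right)
    also have "\<dots> \<le> B * (w t / 2)"
      using W(2) \<open>0 \<le> B\<close> by (intro mult_left_mono) (auto simp: w_def)
    finally show ?thesis
      by (auto simp: a_def b_def min_def max_def norm_minus_commute split: if_splits)
  qed
  define G where "G z t = (1 / w t) *\<^sub>R (y + (\<Phi> z (pos t) - \<Phi> z c))" for z t
  have G_bcont: "G z \<in> bcontfun" for z
  proof (rule bcontfun_normI)
    show "continuous_on UNIV (G z)"
      unfolding G_def using w_pos
      by (intro continuous_intros w_cont cont_pos primitive_continuous_on[OF \<Phi>]) (metis less_irrefl)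
    fix t
    have "norm (\<Phi> z (pos t) - \<Phi> z c) \<le> (1 + norm z) * (w t / 2)"
    proof (rule incr[OF \<Phi>])
      fix r :: real assume r: "0 \<le> r"
      have "norm (state z r) \<le> w r * norm z"
        using w_pos[of r] norm_bounded[of z r] by (simp add: state_def)
      then have "1 + norm (state z r) \<le> (1 + norm z) * w r"
        using w1[of r] by (simp add: algebra_simps)
      from mult_left_mono[OF this L_nonneg[OF r]] growth_rhs[OF r, of "state z r"]
      show "norm (F r (state z r)) \<le> (1 + norm z) * (L r * w r)"
        by (simp add: mult_ac)
    qed simp
    then have "norm (y + (\<Phi> z (pos t) - \<Phi> z c)) \<le> norm y + (1 + norm z) * (w t / 2)"
      by (meson add_left_mono norm_triangle_le)
    also have "\<dots> \<le> w t * (norm y + (1 + norm z))"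
    proof -
      have "1 * norm y \<le> w t * norm y" using w1 by (intro mult_right_mono) auto
      moreover have "(1 + norm z) * (w t / 2) \<le> (1 + norm z) * w t"
        using w_pos[of t] by (intro mult_left_mono) auto
      moreover have "w t * (norm y + (1 + norm z)) = w t * norm y + (1 + norm z) * w t"
        by (simp add: algebra_simps)
      ultimately show ?thesis by linarith
    qed
    finally have "norm (y + (\<Phi> z (pos t) - \<Phi> z c)) / w t \<le> norm y + (1 + norm z)"
      using w_pos[of t] by (simp add: pos_divide_le_eq mult.commute)
    then show "norm (G z t) \<le> norm y + (1 + norm z)"
      unfolding G_def norm_scaleR using w_pos[of t] by simp
  qed
  have "\<exists>!z. Bcontfun (G z) = z"
  proof (rule banach_fix_type[of "1/2"])
    show "\<forall>z z'. dist (Bcontfun (G z)) (Bcontfun (G z')) \<le> 1/2 * dist z z'"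
    proof (intro allI, rule dist_bound)
      fix z z' t
      have "norm ((\<Phi> z (pos t) - \<Phi> z' (pos t)) - (\<Phi> z c - \<Phi> z' c)) \<le> dist z z' * (w t / 2)"
      proof (rule incr[OF primitive_diff[OF \<Phi> \<Phi>]])
        fix r :: real assume r: "0 \<le> r"
        have "norm (state z r - state z' r) = w r * dist (apply_bcontfun z r) (apply_bcontfun z' r)"
          using w_pos[of r] by (simp add: state_def dist_norm scaleR_diff_right[symmetric] del: scaleR_diff_right)
        also have "\<dots> \<le> w r * dist z z'"
          using w_pos[of r] dist_bounded[of z r z'] by simp
        finally have "norm (state z r - state z' r) \<le> w r * dist z z'" .
        from mult_left_mono[OF this L_nonneg[OF r]] lipschitz_rhs[OF r, of "state z r" "state z' r"]
        show "norm (F r (state z r) - F r (state z' r)) \<le> dist z z' * (L r * w r)"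
          by (simp add: mult_ac)
      qed simp
      moreover have "G z t - G z' t = (1 / w t) *\<^sub>R ((\<Phi> z (pos t) - \<Phi> z' (pos t)) - (\<Phi> z c - \<Phi> z' c))"
        by (simp add: G_def algebra_simps)
      ultimately have "norm (G z t - G z' t) \<le> \<bar>1 / w t\<bar> * (dist z z' * (w t / 2))"
        by (simp only: norm_scaleR mult_left_mono abs_ge_zero)
      then have "norm (G z t - G z' t) \<le> 1/2 * dist z z'"
        using w_pos[of t] by simp
      then show "dist (apply_bcontfun (Bcontfun (G z)) t) (apply_bcontfun (Bcontfun (G z')) t) \<le> 1/2 * dist z z'"
        by (simp add: Bcontfun_inverse[OF G_bcont] dist_norm)
    qed
  qed auto
  then obtain z where z: "Bcontfun (G z) = z" by blast
  have "apply_bcontfun z t = G z t" for t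
    using Bcontfun_inverse[OF G_bcont, of z] unfolding z by simp
  then have st: "state z t = y + (\<Phi> z (pos t) - \<Phi> z c)" for t
    using w_pos[of t] by (simp add: state_def G_def)
  have "primitive (\<lambda>s. F s (state z s)) (\<lambda>t. (y - \<Phi> z c) + \<Phi> z t)"
    by (rule primitive_shift[OF \<Phi>])
  then have "primitive (\<lambda>s. F s (state z s)) (state z)"
    by (rule primitive_cong) (auto simp: st pos)
  moreover have "state z c = y"
    using assms by (simp add: st pos)
  ultimately show ?thesis by blast
qed

lemma solves_ode_iff_primitive:
  "solves_ode F x0 x \<longleftrightarrow> primitive (\<lambda>t. F t (x t)) x \<and> x 0 = x0"
proof
  assume s: "solves_ode F x0 x"
  \<comment> \<open>Local absolute continuity applied to a single interval gives continuity.\<close>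
  have "continuous_on {0..} x"
    unfolding continuous_on_iff
  proof (intro ballI allI impI)
    fix t e :: real assume t: "t \<in> {0..}" and "0 < e"
    obtain d where "d > 0" and d: "\<And>D. D division_of \<Union>D \<Longrightarrow> \<Union>D \<subseteq> {0..t + 1} \<Longrightarrow> (\<Sum>k\<in>D. Sup k - Inf k) < d \<Longrightarrow>
        (\<Sum>k\<in>D. norm (x (Sup k) - x (Inf k))) < e"
    proof -
      have "locally_abs_continuous x" "0 \<le> t + 1" using s t by (auto simp: solves_ode_def)
      then show ?thesis using that \<open>0 < e\<close> unfolding locally_abs_continuous_def by meson
    qed
    have close: "norm (x b - x a) < e" if "0 \<le> a" "a \<le> b" "b \<le> t + 1" "b - a < d" for a b
    proof -
      have "{{a..b}} division_of \<Union>{{a..b}}"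
        using division_of_self[of a b] that by simp
      from d[OF this] that show ?thesis by simp
    qed
    show "\<exists>d>0. \<forall>t'\<in>{0..}. dist t' t < d \<longrightarrow> dist (x t') (x t) < e"
    proof (intro exI[of _ "min d 1"] conjI ballI impI)
      fix t' :: real assume t': "t' \<in> {0..}" "dist t' t < min d 1"
      then show "dist (x t') (x t) < e"
        using close[of t t'] close[of t' t] t
        by (cases "t \<le> t'") (auto simp: dist_real_def dist_norm norm_minus_commute)
    qed (use \<open>d > 0\<close> in auto)
  qed
  then have "loc_integrable (\<lambda>t. F t (x t))" by (rule loc_integrable_rhs)
  then show "primitive (\<lambda>t. F t (x t)) x \<and> x 0 = x0"
    using s primitiveI unfolding solves_ode_def by blast
next
  assume "primitive (\<lambda>t. F t (x t)) x \<and> x 0 = x0"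
  then show "solves_ode F x0 x"
    unfolding solves_ode_def
    using primitive_abs_continuous primitive_has_vector_derivative_within_AE by blast
qed

lemma ode_solution_solves:
  "primitive (\<lambda>t. F t (ode_solution F x0 t)) (ode_solution F x0)" "ode_solution F x0 0 = x0"
proof -
  obtain x where "primitive (\<lambda>t. F t (x t)) x" "x 0 = x0"
    using solution_exists[of 0 x0] by auto
  then have "solves_ode F x0 x" by (simp add: solves_ode_iff_primitive)
  then have "solves_ode F x0 (ode_solution F x0)"
    unfolding ode_solution_def using someI[of "solves_ode F x0" x] by simp
  then show "primitive (\<lambda>t. F t (ode_solution F x0 t)) (ode_solution F x0)" "ode_solution F x0 0 = x0"
    by (simp_all add: solves_ode_iff_primitive)
qed

end

section \<open>Projections of Borel sets and measurable selections\<close>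

text \<open>
  Suslin's analytic sets, in the form of projections of closed sets along the Baire space of sequences
  of natural numbers.
\<close>

definition analytic :: "'a::topological_space set \<Rightarrow> bool" where
  "analytic A \<longleftrightarrow> (\<exists>C :: ('a \<times> (nat \<Rightarrow> nat)) set. closed C \<and> A = fst ` C)"

lemma analytic_closed: "closed A \<Longrightarrow> analytic A"
  unfolding analytic_def by (intro exI[of _ "A \<times> UNIV"]) (auto intro: closed_Times)

lemma continuous_on_snd_coordinate: "continuous_on UNIV (\<lambda>z. snd z i)"
  for i and z :: "'a::topological_space \<times> ('i \<Rightarrow> 'c::topological_space)"
  using continuous_on_compose2[OF continuous_on_product_coordinates[of i], of UNIV snd]
  by (simp add: continuous_on_snd continuous_on_id)

text \<open>
  The first entry of the sequence selects a member of the union, the remaining entries are a witness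
  for it.
\<close>

lemma analytic_UN:
  assumes "\<And>n::nat. analytic (A n)"
  shows "analytic (\<Union>n. A n)"
proof -
  obtain C where C: "\<And>n. closed (C n)" "\<And>n. A n = fst ` (C n :: ('a \<times> (nat \<Rightarrow> nat)) set)"
    using assms unfolding analytic_def by metis
  define E where "E = (\<Inter>n. (\<lambda>z. snd z 0) -` (- {n}) \<union> (\<lambda>z. (fst z, \<lambda>i. snd z (Suc i))) -` C n)"
  have 1: "closed ((\<lambda>z :: 'a \<times> (nat \<Rightarrow> nat). snd z 0) -` (- {n}))" for n
    by (rule closed_vimage[OF _ continuous_on_snd_coordinate]) (simp add: closed_def open_discrete)
  have 2: "closed ((\<lambda>z :: 'a \<times> (nat \<Rightarrow> nat). (fst z, \<lambda>i. snd z (Suc i))) -` C n)" for n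
    by (rule closed_vimage[OF C(1)])
       (intro continuous_on_Pair continuous_on_coordinatewise_then_product continuous_on_snd_coordinate continuous_on_fst continuous_on_id)
  have "closed E"
    unfolding E_def by (intro closed_INT ballI closed_Un 1 2)
  moreover have "(\<Union>n. A n) = fst ` E"
  proof (intro set_eqI iffI)
    fix a assume "a \<in> (\<Union>n. A n)"
    then obtain n \<sigma> where "(a, \<sigma>) \<in> C n" using C(2) by fastforce
    then have "(a, case_nat n \<sigma>) \<in> E" by (auto simp: E_def)
    then show "a \<in> fst ` E" by (rule rev_image_eqI) simp
  next
    fix a assume "a \<in> fst ` E"
    then obtain \<sigma> where "(a, \<sigma>) \<in> E" by auto
    then have "(a, \<lambda>i. \<sigma> (Suc i)) \<in> C (\<sigma> 0)" by (auto simp: E_def)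
    then show "a \<in> (\<Union>n. A n)" using C(2) by force
  qed
  ultimately show ?thesis unfolding analytic_def by blast
qed

text \<open>
  A single sequence codes one witness for every member, by means of a pairing of the natural numbers.
\<close>

lemma analytic_INT:
  assumes "\<And>n::nat. analytic (A n)"
  shows "analytic (\<Inter>n. A n)"
proof -
  obtain C where C: "\<And>n. closed (C n)" "\<And>n. A n = fst ` (C n :: ('a \<times> (nat \<Rightarrow> nat)) set)"
    using assms unfolding analytic_def by metis
  define E where "E = (\<Inter>n. (\<lambda>z. (fst z, \<lambda>i. snd z (prod_encode (n, i)))) -` C n)"
  have 2: "closed ((\<lambda>z :: 'a \<times> (nat \<Rightarrow> nat). (fst z, \<lambda>i. snd z (prod_encode (n, i)))) -` C n)" for n
    by (rule closed_vimage[OF C(1)])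
       (intro continuous_on_Pair continuous_on_coordinatewise_then_product continuous_on_snd_coordinate continuous_on_fst continuous_on_id)
  have "closed E"
    unfolding E_def by (intro closed_INT ballI 2)
  moreover have "(\<Inter>n. A n) = fst ` E"
  proof (intro set_eqI iffI)
    fix a assume "a \<in> (\<Inter>n. A n)"
    then have "\<exists>\<sigma>. (a, \<sigma>) \<in> C n" for n using C(2) by fastforce
    then obtain \<sigma> where "\<And>n. (a, \<sigma> n) \<in> C n" by metis
    then have "(a, \<lambda>k. \<sigma> (fst (prod_decode k)) (snd (prod_decode k))) \<in> E" by (auto simp: E_def)
    then show "a \<in> fst ` E" by (rule rev_image_eqI) simp
  next
    fix a assume "a \<in> fst ` E"
    then obtain \<sigma> where "(a, \<sigma>) \<in> E" by auto
    then have "(a, \<lambda>i. \<sigma> (prod_encode (n, i))) \<in> C n" for n by (auto simp: E_def)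
    then show "a \<in> (\<Inter>n. A n)" using C(2) by force
  qed
  ultimately show ?thesis unfolding analytic_def by blast
qed

text \<open>
  The sets that are analytic together with their complement form a sigma-algebra containing the open
  sets.
\<close>

lemma borel_imp_analytic:
  fixes A :: "'a::euclidean_space set"
  assumes "A \<in> sets borel"
  shows "analytic A"
proof -
  have "A \<in> sigma_sets UNIV (Collect open)"
    using assms by (simp add: sets_borel)
  then have "analytic A \<and> analytic (- A)"
  proof induction
    case (Basic U)
    then have "open U" by simp
    obtain \<D> where D: "countable \<D>" "\<And>X. X \<in> \<D> \<Longrightarrow> \<exists>a b. X = cbox a b" "\<Union>\<D> = U"
      by (rule open_countable_Union_open_cbox[OF \<open>open U\<close>]) blast
    have "analytic U"
    proof (cases "\<D> = {}")
      case True
      then show ?thesis using D by (auto intro: analytic_closed)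
    next
      case False
      have "analytic (\<Union>n. from_nat_into \<D> n)"
      proof (rule analytic_UN)
        fix n
        obtain a b where "from_nat_into \<D> n = cbox a b"
          using D(2) from_nat_into[OF False] by blast
        then show "analytic (from_nat_into \<D> n)"
          by (simp add: analytic_closed closed_cbox)
      qed
      then show ?thesis
        using range_from_nat_into[OF False D(1)] D(3) by simp
    qed
    then show ?case using \<open>open U\<close> by (simp add: analytic_closed closed_Compl)
  next
    case Empty
    show ?case by (simp add: analytic_closed)
  next
    case (Compl A)
    then show ?case by (simp add: Compl_eq_Diff_UNIV[symmetric])
  next
    case (Union A)
    then have "analytic (\<Union>n. A n)" "analytic (\<Inter>n. - A n)"
      by (auto intro: analytic_UN analytic_INT)
    then show ?case by simp
  qed
  then show ?thesis by simp
qed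

lemma compact_bounded_sequences: "compact {\<sigma> :: nat \<Rightarrow> nat. \<forall>i. \<sigma> i \<le> j i}"
proof -
  have "compactin (product_topology (\<lambda>_. euclidean) UNIV) (PiE UNIV (\<lambda>i. {..j i}))"
    unfolding compactin_PiE by (auto intro: finite_imp_compact)
  moreover have "PiE UNIV (\<lambda>i. {..j i}) = {\<sigma>. \<forall>i. \<sigma> i \<le> j i}"
    by (auto simp: PiE_def)
  ultimately show ?thesis by (simp add: euclidean_product_topology)
qed

text \<open>
  Choquet's capacity argument. Outer measure is continuous along increasing unions, so the entries of
  the witnessing sequences can be bounded one after the other with the outer measure of the projection
  staying above \<open>\<alpha>\<close>. In the limit all entries are bounded, the witnesses range over a compact set, and
  its projection \<open>P\<close> is compact. \<open>P\<close> contains the intersection of the closures of the approximating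
  projections, to which continuity of measure from above applies.
\<close>

lemma inner_compact_of_projection:
  fixes C :: "(('a::euclidean_space \<times> 'b::euclidean_space) \<times> (nat \<Rightarrow> nat)) set"
  assumes "closed C" and bounded: "fst ` C \<subseteq> cball 0 R"
    and \<alpha>: "\<alpha> < outer_measure_of lebesgue (fst ` fst ` C)"
  shows "\<exists>P. compact P \<and> P \<subseteq> fst ` fst ` C \<and> \<alpha> \<le> emeasure lebesgue P"
proof -
  define proj where "proj D = fst ` fst ` D" for D :: "(('a \<times> 'b) \<times> (nat \<Rightarrow> nat)) set"
  have "\<exists>D. \<forall>k. (\<alpha> < outer_measure_of lebesgue (proj (D k)) \<and> (k = 0 \<longrightarrow> D k = C)) \<and> (\<exists>j. D (Suc k) = {z \<in> D k. snd z k \<le> j})"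
  proof (rule dependent_nat_choice)
    show "\<exists>D. \<alpha> < outer_measure_of lebesgue (proj D) \<and> (0 = 0 \<longrightarrow> D = C)"
      using \<alpha> by (auto simp: proj_def)
  next
    fix D and k :: nat assume D: "\<alpha> < outer_measure_of lebesgue (proj D) \<and> (k = 0 \<longrightarrow> D = C)"
    define Dj where "Dj j = {z \<in> D. snd z k \<le> j}" for j
    have "incseq (\<lambda>j. proj (Dj j))"
      unfolding proj_def Dj_def by (intro incseq_SucI image_mono) auto
    then have "(SUP j. outer_measure_of lebesgue (proj (Dj j))) = outer_measure_of lebesgue (\<Union>j. proj (Dj j))"
      by (intro SUP_outer_measure_of_incseq) auto
    also have "(\<Union>j. proj (Dj j)) = proj D"
      by (auto simp: proj_def Dj_def)
    finally obtain j where "\<alpha> < outer_measure_of lebesgue (proj (Dj j))"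
      using D by (metis less_SUP_iff)
    then show "\<exists>D'. (\<alpha> < outer_measure_of lebesgue (proj D') \<and> (Suc k = 0 \<longrightarrow> D' = C)) \<and> (\<exists>j. D' = {z \<in> D. snd z k \<le> j})"
      unfolding Dj_def by blast
  qed
  then obtain D where D: "\<And>k. \<alpha> < outer_measure_of lebesgue (proj (D k))" "D 0 = C"
    "\<And>k. \<exists>j. D (Suc k) = {z \<in> D k. snd z k \<le> j}"
    by blast
  have "\<forall>k. \<exists>j. D (Suc k) = {z \<in> D k. snd z k \<le> j}" using D(3) by blast
  from choice[OF this] obtain j where j: "\<And>k. D (Suc k) = {z \<in> D k. snd z k \<le> j k}" by blast
  have D_eq: "D k = {z \<in> C. \<forall>i<k. snd z i \<le> j i}" for k
  proof (induction k)
    case 0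
    show ?case by (simp add: D(2))
  next
    case (Suc k)
    show ?case unfolding j Suc by (simp only: All_less_Suc mem_Collect_eq) blast
  qed
  have compact_slice: "compact (C \<inter> (cball 0 R \<times> {\<sigma>. \<forall>i. \<sigma> i \<le> b i}))" for b
    by (intro closed_Int_compact \<open>closed C\<close> compact_Times compact_cball compact_bounded_sequences)
  define P where "P = proj (C \<inter> (cball 0 R \<times> {\<sigma>. \<forall>i. \<sigma> i \<le> j i}))"
  have "compact P"
    unfolding P_def proj_def by (intro compact_continuous_image compact_slice continuous_on_fst continuous_on_id)
  define E where "E k = closure (proj (D k))" for k
  have E_P: "(\<Inter>k. E k) \<subseteq> P"
  proof
    fix t assume t: "t \<in> (\<Inter>k. E k)"
    have "\<exists>z. z \<in> D k \<and> dist (fst (fst z)) t < inverse (real (Suc k))" for k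
    proof -
      have "t \<in> closure (proj (D k))" using t by (auto simp: E_def)
      moreover have "inverse (real (Suc k)) > 0" by simp
      ultimately obtain y where "y \<in> proj (D k)" "dist y t < inverse (real (Suc k))"
        unfolding closure_approachable by blast
      then show ?thesis unfolding proj_def by blast
    qed
    then obtain z where z: "\<And>k. z k \<in> D k" "\<And>k. dist (fst (fst (z k))) t < inverse (real (Suc k))"
      by metis
    \<comment> \<open>Entry \<open>i\<close> of \<open>z k\<close> is only known to be at most \<open>j i\<close> for \<open>k > i\<close>; the finitely many others are added.\<close>
    define b where "b i = max (j i) (Max ((\<lambda>k. snd (z k) i) ` {..i}))" for i
    have "snd (z k) i \<le> b i" for k i
    proof (cases "k \<le> i")
      case True
      then have "snd (z k) i \<le> Max ((\<lambda>k. snd (z k) i) ` {..i})" by (intro Max_ge) auto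
      then show ?thesis by (simp add: b_def)
    next
      case False
      then have "snd (z k) i \<le> j i" using z(1)[of k] by (simp add: D_eq)
      then show ?thesis by (simp add: b_def)
    qed
    moreover have zC: "z k \<in> C" "fst (z k) \<in> cball 0 R" for k
      using z(1)[of k] bounded by (auto simp: D_eq)
    ultimately have "\<forall>k. z k \<in> C \<inter> (cball 0 R \<times> {\<sigma>. \<forall>i. \<sigma> i \<le> b i})"
      by (auto simp: mem_Times_iff)
    then obtain w r where w: "w \<in> C \<inter> (cball 0 R \<times> {\<sigma>. \<forall>i. \<sigma> i \<le> b i})" and r: "strict_mono (r :: nat \<Rightarrow> nat)"
      and lim: "(z \<circ> r) \<longlonglongrightarrow> w"
      by (rule seq_compactE[OF compact_imp_seq_compact[OF compact_slice[of b]]]) (rule that)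
    have "fst (fst w) = t"
    proof -
      have "(\<lambda>n. fst (fst ((z \<circ> r) n))) \<longlonglongrightarrow> fst (fst w)"
        by (intro tendsto_fst lim)
      moreover have "(\<lambda>k. fst (fst (z k))) \<longlonglongrightarrow> t"
      proof (rule metric_LIMSEQ_I)
        fix e :: real assume "e > 0"
        then obtain N where N: "inverse (real (Suc N)) < e" using reals_Archimedean by blast
        show "\<exists>N. \<forall>n\<ge>N. dist (fst (fst (z n))) t < e"
        proof (intro exI allI impI)
          fix n assume "N \<le> n"
          then have "inverse (real (Suc n)) \<le> inverse (real (Suc N))" by (simp add: le_imp_inverse_le)
          then show "dist (fst (fst (z n))) t < e" using z(2)[of n] N by linarith
        qed
      qed
      then have "((\<lambda>k. fst (fst (z k))) \<circ> r) \<longlonglongrightarrow> t" using r by (rule LIMSEQ_subseq_LIMSEQ)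
      ultimately show ?thesis by (intro LIMSEQ_unique) (auto simp: o_def)
    qed
    moreover have "snd w i \<le> j i" for i
    proof -
      have "(\<lambda>n. snd ((z \<circ> r) n) i) \<longlonglongrightarrow> snd w i"
        by (rule continuous_on_tendsto_compose[OF continuous_on_snd_coordinate lim]) auto
      moreover have "eventually (\<lambda>n. snd ((z \<circ> r) n) i \<in> {..j i}) sequentially"
        using eventually_gt_at_top[of i]
      proof eventually_elim
        case (elim n)
        then have "i < r n" using seq_suble[OF r, of n] by linarith
        then show ?case using z(1)[of "r n"] by (simp add: D_eq)
      qed
      ultimately have "snd w i \<in> {..j i}"
        by (intro Lim_in_closed_set[of "{..j i}" "\<lambda>n. snd ((z \<circ> r) n) i" sequentially]) auto
      then show ?thesis by simp
    qed
    ultimately show "t \<in> P"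
      using w unfolding P_def proj_def by (force simp: mem_Times_iff)
  qed
  have "\<alpha> \<le> emeasure lebesgue P"
  proof -
    have meas: "E k \<in> sets lebesgue" for k by (simp add: E_def)
    have sub: "proj (D k) \<subseteq> cball 0 R" for k
    proof
      fix a assume "a \<in> proj (D k)"
      then obtain z where "z \<in> C" "a = fst (fst z)" by (auto simp: proj_def D_eq)
      then show "a \<in> cball 0 R" using bounded norm_fst_le[of "fst (fst z)" "snd (fst z)"] by fastforce
    qed
    have "E k \<subseteq> cball 0 R" for k
      unfolding E_def by (rule closure_minimal[OF sub closed_cball])
    then have "emeasure lebesgue (E k) \<le> emeasure lebesgue (cball (0::'a) R)" for k
      by (intro emeasure_mono) auto
    also have "emeasure lebesgue (cball (0::'a) R) < \<infinity>"
      using emeasure_bounded_finite[OF bounded_cball] by simp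
    finally have fin: "emeasure lebesgue (E k) \<noteq> \<infinity>" for k by (simp add: less_top[symmetric])
    have "decseq E"
      by (rule decseq_SucI) (auto simp: E_def proj_def j intro!: closure_mono image_mono)
    then have "(INF k. emeasure lebesgue (E k)) = emeasure lebesgue (\<Inter>k. E k)"
      using meas fin by (intro INF_emeasure_decseq) auto
    moreover have "\<alpha> \<le> (INF k. emeasure lebesgue (E k))"
    proof (rule INF_greatest)
      fix k
      have "\<alpha> \<le> outer_measure_of lebesgue (proj (D k))" using D(1)[of k] by simp
      also have "\<dots> \<le> outer_measure_of lebesgue (E k)"
        by (intro outer_measure_of_mono) (simp add: E_def closure_subset)
      also have "\<dots> = emeasure lebesgue (E k)" by (rule outer_measure_of_eq[OF meas])
      finally show "\<alpha> \<le> emeasure lebesgue (E k)" .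
    qed
    moreover have "emeasure lebesgue (\<Inter>k. E k) \<le> emeasure lebesgue P"
      using E_P fmeasurableD[OF lmeasurable_compact[OF \<open>compact P\<close>]] by (rule emeasure_mono)
    ultimately show ?thesis by simp
  qed
  moreover have "P \<subseteq> fst ` fst ` C" by (auto simp: P_def proj_def)
  ultimately show ?thesis using \<open>compact P\<close> by blast
qed

lemma lebesgue_measurable_if_inner_compact:
  fixes A :: "'a::euclidean_space set"
  assumes fin: "outer_measure_of lebesgue A < \<infinity>"
    and inner: "\<And>\<alpha>. \<alpha> < outer_measure_of lebesgue A \<Longrightarrow> \<exists>P. compact P \<and> P \<subseteq> A \<and> \<alpha> \<le> emeasure lebesgue P"
  shows "A \<in> sets lebesgue"
proof -
  obtain E where E: "E \<in> sets lebesgue" "A \<subseteq> E" "outer_measure_of lebesgue A = emeasure lebesgue E"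
    using outer_measure_of_attain[of A lebesgue] by auto
  have "\<exists>B\<in>sets lebesgue. B \<subseteq> A \<and> emeasure lebesgue E \<le> emeasure lebesgue B"
  proof (cases "emeasure lebesgue E = 0")
    case True
    then show ?thesis by (intro bexI[of _ "{}"]) auto
  next
    case False
    define m where "m = enn2real (emeasure lebesgue E)"
    have m: "emeasure lebesgue E = ennreal m" "m > 0"
      using fin False E by (auto simp: m_def enn2real_positive_iff zero_less_iff_neq_zero)
    have "\<exists>P. compact P \<and> P \<subseteq> A \<and> ennreal (m - 1 / real (Suc n)) \<le> emeasure lebesgue P" for n
    proof (rule inner)
      have "ennreal (m - 1 / real (Suc n)) < ennreal m"
        using m(2) by (intro ennreal_lessI) auto
      then show "ennreal (m - 1 / real (Suc n)) < outer_measure_of lebesgue A" using E m by simp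
    qed
    then obtain P where P: "\<And>n. compact (P n)" "\<And>n. P n \<subseteq> A" "\<And>n. ennreal (m - 1 / real (Suc n)) \<le> emeasure lebesgue (P n)"
      by metis
    show ?thesis
    proof (intro bexI[of _ "\<Union>n. P n"] conjI)
      show PB: "(\<Union>n. P n) \<in> sets lebesgue"
        using fmeasurableD[OF lmeasurable_compact[OF P(1)]] by blast
      show "(\<Union>n. P n) \<subseteq> A" using P by auto
      show "emeasure lebesgue E \<le> emeasure lebesgue (\<Union>n. P n)"
        unfolding m(1)
      proof (rule LIMSEQ_le_const2)
        have "(\<lambda>n. m - 1 / real (Suc n)) \<longlonglongrightarrow> m - 0"
          by (intro tendsto_intros LIMSEQ_Suc lim_1_over_n)
        then show "(\<lambda>n. ennreal (m - 1 / real (Suc n))) \<longlonglongrightarrow> ennreal m"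
          by (intro tendsto_ennrealI) simp
        show "\<exists>N. \<forall>n\<ge>N. ennreal (m - 1 / real (Suc n)) \<le> emeasure lebesgue (\<Union>n. P n)"
        proof (intro exI allI impI)
          fix n
          have "emeasure lebesgue (P n) \<le> emeasure lebesgue (\<Union>n. P n)"
            by (rule emeasure_mono[OF _ PB]) auto
          with P(3)[of n] show "ennreal (m - 1 / real (Suc n)) \<le> emeasure lebesgue (\<Union>n. P n)"
            by (rule order_trans)
        qed
      qed
    qed
  qed
  then obtain B where B: "B \<in> sets lebesgue" "B \<subseteq> A" "emeasure lebesgue E \<le> emeasure lebesgue B" by blast
  have Bfin: "emeasure lebesgue B \<noteq> \<infinity>"
  proof -
    have "emeasure lebesgue B \<le> emeasure lebesgue E" using B E by (intro emeasure_mono) auto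
    then show ?thesis using fin E by (metis infinity_ennreal_def leD)
  qed
  have "emeasure lebesgue (E - B) = emeasure lebesgue E - emeasure lebesgue B"
    using B E Bfin by (intro emeasure_Diff) auto
  also have "\<dots> = 0"
  proof -
    have "emeasure lebesgue B \<le> emeasure lebesgue E" using B E by (intro emeasure_mono) auto
    then have "emeasure lebesgue E = emeasure lebesgue B" using B(3) by (rule antisym[rotated])
    then show ?thesis using ennreal_diff_self Bfin by simp
  qed
  finally have "E - B \<in> null_sets lebesgue" using B E by auto
  then have "negligible (E - B)" by (simp add: negligible_iff_null_sets)
  then have "negligible (A - B)" by (rule negligible_subset) (use E in auto)
  then have "B \<union> (A - B) \<in> sets lebesgue" using B negligible_imp_sets by blast
  moreover have "B \<union> (A - B) = A" using B by auto
  ultimately show ?thesis by simp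
qed

text \<open>
  Measurability of projections is obtained for bounded pieces, where outer measures are finite and the
  set is exhausted by compact subsets up to a null set.
\<close>

lemma lebesgue_measurable_projection:
  fixes G :: "('a::euclidean_space \<times> 'b::euclidean_space) set"
  assumes "G \<in> sets borel"
  shows "fst ` G \<in> sets lebesgue"
proof -
  have "fst ` (G \<inter> cball 0 (real n)) \<in> sets lebesgue" for n
  proof -
    have "G \<inter> cball 0 (real n) \<in> sets borel" using assms by auto
    then obtain C :: "(('a \<times> 'b) \<times> (nat \<Rightarrow> nat)) set" where C: "closed C" "G \<inter> cball 0 (real n) = fst ` C"
      using borel_imp_analytic unfolding analytic_def by blast
    have sub: "fst ` C \<subseteq> cball 0 (real n)" using C by auto
    have "fst ` fst ` C \<subseteq> cball 0 (real n)"
    proof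
      fix a assume "a \<in> fst ` fst ` C"
      then obtain z where "z \<in> fst ` C" "a = fst z" by auto
      then show "a \<in> cball 0 (real n)" using sub norm_fst_le[of "fst z" "snd z"] by fastforce
    qed
    then have "outer_measure_of lebesgue (fst ` fst ` C) \<le> outer_measure_of lebesgue (cball (0::'a) (real n))"
      by (rule outer_measure_of_mono)
    also have "\<dots> = emeasure lebesgue (cball (0::'a) (real n))" by (rule outer_measure_of_eq) simp
    also have "\<dots> < \<infinity>" using emeasure_bounded_finite[OF bounded_cball] by simp
    finally have "fst ` fst ` C \<in> sets lebesgue"
      by (rule lebesgue_measurable_if_inner_compact) (rule inner_compact_of_projection[OF C(1) sub])
    then show ?thesis by (simp add: C(2))
  qed
  then have "(\<Union>n. fst ` (G \<inter> cball 0 (real n))) \<in> sets lebesgue" by blast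
  moreover have "(\<Union>n. fst ` (G \<inter> cball 0 (real n))) = fst ` G"
  proof -
    have "\<exists>n. z \<in> cball 0 (real n)" for z :: "'a \<times> 'b"
      using real_arch_simple[of "norm z"] by auto
    then show ?thesis by blast
  qed
  ultimately show ?thesis by simp
qed

text \<open>
  The construction of Kuratowski and Ryll-Nardzewski. The points \<open>q (idx k t)\<close> of a countable dense set
  come within \<open>(1/2) ^ k\<close> of the section over \<open>t\<close> and form a Cauchy sequence, so their limit lies in the
  closed section. Taking the least admissible index keeps each step measurable, because the set of
  \<open>t\<close> whose section meets a given open set is a projection.
\<close>

lemma measurable_selector:
  fixes G :: "('a::euclidean_space \<times> 'b::euclidean_space) set"
  assumes G: "G \<in> sets borel" and closed: "\<And>t. closed {p. (t, p) \<in> G}"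
  obtains s where "s \<in> borel_measurable lebesgue" "\<And>t. t \<in> fst ` G \<Longrightarrow> (t, s t) \<in> G"
proof -
  obtain D :: "'b set" where D: "countable D" "\<And>X. open X \<Longrightarrow> X \<noteq> {} \<Longrightarrow> \<exists>d \<in> D. d \<in> X"
    by (rule countable_dense_setE) (rule that)
  have "D \<noteq> {}" using D(2)[of UNIV] by auto
  define q where "q = from_nat_into D"
  have dense: "\<exists>i. dist (q i) p < e" if "e > 0" for p e
  proof -
    have "ball p e \<noteq> {}" using that by simp
    then obtain d where "d \<in> D" "dist p d < e" using D(2)[of "ball p e"] by auto
    then show ?thesis using from_nat_into_surj[OF D(1)] by (metis q_def dist_commute)
  qed
  define hit where "hit W = fst ` (G \<inter> UNIV \<times> W)" for W
  have hit_iff: "t \<in> hit W \<longleftrightarrow> (\<exists>p\<in>W. (t, p) \<in> G)" for t W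
    by (force simp: hit_def)
  have hit_meas: "hit W \<in> sets lebesgue" if "open W" for W
    unfolding hit_def by (rule lebesgue_measurable_projection[OF sets.Int[OF G borel_open[OF open_Times[OF open_UNIV that]]]])
  have hit_pred: "(\<lambda>t. t \<in> hit W) \<in> measurable lebesgue (count_space UNIV)" if "open W" for W
    using hit_meas[OF that] by (simp add: pred_def[symmetric] Measurable.pred_def)
  define T where "T = fst ` G"
  have T_meas: "T \<in> sets lebesgue" unfolding T_def by (rule lebesgue_measurable_projection[OF G])
  define idx :: "nat \<Rightarrow> 'a \<Rightarrow> nat" where
    "idx = rec_nat (\<lambda>t. LEAST i. t \<in> hit (ball (q i) 1))
       (\<lambda>k prev t. LEAST i. t \<in> hit (ball (q i) ((1/2) ^ Suc k) \<inter> ball (q (prev t)) ((1/2) ^ k)))"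
  have idx_0: "idx 0 t = (LEAST i. t \<in> hit (ball (q i) 1))" for t by (simp add: idx_def)
  have idx_Suc: "idx (Suc k) t = (LEAST i. t \<in> hit (ball (q i) ((1/2) ^ Suc k) \<inter> ball (q (idx k t)) ((1/2) ^ k)))" for k t
    by (simp add: idx_def)
  have idx_meas: "idx k \<in> measurable lebesgue (count_space UNIV)" for k
  proof (induction k)
    case 0
    show ?case unfolding idx_0[abs_def] by (intro measurable_Least hit_pred) simp
  next
    case (Suc k)
    have "(\<lambda>t. t \<in> hit (ball (q i) ((1/2) ^ Suc k) \<inter> ball (q (idx k t)) ((1/2) ^ k))) \<in> measurable lebesgue (count_space UNIV)" for i
      by (rule measurable_compose_countable[where f="\<lambda>j t. t \<in> hit (ball (q i) ((1/2) ^ Suc k) \<inter> ball (q j) ((1/2) ^ k))", OF _ Suc])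
         (intro hit_pred open_Int open_ball)
    then show ?case unfolding idx_Suc[abs_def] by (rule measurable_Least)
  qed
    have step: "t \<in> hit (ball (q (idx (Suc k) t)) ((1/2) ^ Suc k) \<inter> ball (q (idx k t)) ((1/2) ^ k))"
      if "t \<in> hit (ball (q (idx k t)) ((1/2) ^ k))" for t k
    proof -
      note hyp = that
      obtain p where p: "p \<in> ball (q (idx k t)) ((1/2) ^ k)" "(t, p) \<in> G" using hyp by (auto simp: hit_iff)
      obtain i where "dist (q i) p < (1/2) ^ Suc k" using dense[of "(1/2) ^ Suc k" p] by auto
      then have "t \<in> hit (ball (q i) ((1/2) ^ Suc k) \<inter> ball (q (idx k t)) ((1/2) ^ k))"
        unfolding hit_iff using p by (intro bexI[of _ p]) auto
      then show ?thesis unfolding idx_Suc by (rule LeastI)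
    qed
    have idx_hit: "t \<in> hit (ball (q (idx k t)) ((1/2) ^ k))" if "t \<in> T" for t k
    proof (induction k)
      case 0
      have "t \<in> fst ` G" using that by (simp add: T_def)
      then obtain p where p: "(t, p) \<in> G" by (auto simp: T_def)
      obtain i where "dist (q i) p < 1" using dense[of 1 p] by auto
      then have "t \<in> hit (ball (q i) 1)" unfolding hit_iff using p by (intro bexI[of _ p]) auto
      then have "t \<in> hit (ball (q (idx 0 t)) 1)" unfolding idx_0 by (rule LeastI)
      then show ?case by simp
    next
      case (Suc k)
      from step[OF this] show ?case by (auto simp: hit_iff)
    qed
  note idx_hit_Suc = step[OF idx_hit]
  define s where "s t = lim (\<lambda>k. if t \<in> T then q (idx k t) else 0)" for t
  have "s \<in> borel_measurable lebesgue"
    unfolding s_def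
  proof (rule borel_measurable_lim_metric)
    fix k
    have "(\<lambda>t. q (idx k t)) \<in> borel_measurable lebesgue"
      by (rule measurable_compose[OF idx_meas]) simp
    then show "(\<lambda>t. if t \<in> T then q (idx k t) else 0) \<in> borel_measurable lebesgue"
      using T_meas by (intro measurable_If_set) auto
  qed
  moreover have "(t, s t) \<in> G" if "t \<in> fst ` G" for t
  proof -
    have t: "t \<in> T" using that by (simp add: T_def)
    define u where "u k = q (idx k t)" for k
    have du: "norm (u (Suc k) - u k) \<le> 2 * (1/2) ^ k" for k
    proof -
      obtain p where "dist (u (Suc k)) p < (1/2) ^ Suc k" "dist (u k) p < (1/2) ^ k"
        using idx_hit_Suc[OF t, of k] by (auto simp: hit_iff u_def)
      then have "dist (u (Suc k)) (u k) < (1/2) ^ Suc k + (1/2) ^ k"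
        using dist_triangle2[of "u (Suc k)" "u k" p] by linarith
      moreover have "(0::real) \<le> (1/2) ^ k" by simp
      ultimately show ?thesis unfolding dist_norm power_Suc by linarith
    qed
    have "summable (\<lambda>k. u (Suc k) - u k)"
      by (rule summable_comparison_test'[OF summable_mult[OF summable_geometric[of "1/2::real"]] du]) simp
    then obtain L where "(\<lambda>n. \<Sum>k<n. u (Suc k) - u k) \<longlonglongrightarrow> L"
      using summable_LIMSEQ by blast
    then have "(\<lambda>n. u n - u 0) \<longlonglongrightarrow> L" by (simp add: sum_lessThan_telescope)
    then have "(\<lambda>n. (u n - u 0) + u 0) \<longlonglongrightarrow> L + u 0" by (intro tendsto_intros)
    then have lim: "u \<longlonglongrightarrow> L + u 0" by simp
    have "s t = lim u"
      using t by (simp add: s_def u_def[abs_def])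
    then have "s t = L + u 0" using limI[OF lim] by simp
    with lim have lim: "u \<longlonglongrightarrow> s t" by simp
    have "\<exists>p. (t, p) \<in> G \<and> dist (u k) p < (1/2) ^ k" for k
      using idx_hit[OF t, of k] by (auto simp: hit_iff u_def)
    then obtain p where p: "\<And>k. (t, p k) \<in> G" "\<And>k. dist (u k) (p k) < (1/2) ^ k" by metis
    have "(\<lambda>k. dist (u k) (p k)) \<longlonglongrightarrow> 0"
    proof (rule tendsto_sandwich[OF _ _ tendsto_const])
      show "(\<lambda>k. (1/2) ^ k) \<longlonglongrightarrow> (0::real)" by (rule LIMSEQ_realpow_zero) auto
    qed (use p(2) in \<open>auto intro!: always_eventually less_imp_le\<close>)
    then have "(\<lambda>k. u k - p k) \<longlonglongrightarrow> 0"
      by (simp add: dist_norm tendsto_norm_zero_iff)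
    from tendsto_diff[OF lim this] have "p \<longlonglongrightarrow> s t" by simp
    moreover have "\<forall>k. p k \<in> {p. (t, p) \<in> G}" using p(1) by simp
    ultimately have "s t \<in> {p. (t, p) \<in> G}"
      using closed[of t] unfolding closed_sequential_limits by blast
    then show ?thesis by simp
  qed
  ultimately show ?thesis using that by blast
qed

lemma lebesgue_measurable_eq_borel_off_null:
  fixes W :: "real \<Rightarrow> 'b::euclidean_space"
  assumes "W \<in> borel_measurable lebesgue"
  obtains V N where "V \<in> borel_measurable borel" "N \<in> sets borel" "negligible N" "\<And>t. t \<notin> N \<Longrightarrow> V t = W t"
proof -
  have "\<exists>V N. V \<in> borel_measurable borel \<and> N \<in> sets borel \<and> negligible N \<and> (\<forall>t. t \<notin> N \<longrightarrow> V t = W t \<bullet> b)" for b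
  proof -
    have "(\<lambda>t. W t \<bullet> b) \<in> borel_measurable lebesgue" using assms by simp
    then obtain V where V: "V \<in> borel_measurable lborel" "AE t in lborel. W t \<bullet> b = V t"
      using completion_ex_borel_measurable_real by blast
    obtain N where N: "{t\<in>space lborel. W t \<bullet> b \<noteq> V t} \<subseteq> N" "emeasure lborel N = 0" "N \<in> sets lborel"
      using AE_E[OF V(2)] by blast
    have "N \<in> null_sets lebesgue"
      using N by (intro null_sets_completionI) auto
    then have "negligible N" by (simp add: negligible_iff_null_sets)
    moreover have "\<forall>t. t \<notin> N \<longrightarrow> V t = W t \<bullet> b"
    proof (intro allI impI)
      fix t assume "t \<notin> N"
      then have "\<not> (W t \<bullet> b \<noteq> V t)" using N(1) by auto
      then show "V t = W t \<bullet> b" by simp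
    qed
    moreover have "V \<in> borel_measurable borel" "N \<in> sets borel" using V(1) N(3) by auto
    ultimately show ?thesis by blast
  qed
  then obtain V N where VN: "\<And>b. V b \<in> borel_measurable borel" "\<And>b. N b \<in> sets borel" "\<And>b. negligible (N b)"
    "\<And>b t. t \<notin> N b \<Longrightarrow> V b t = W t \<bullet> b" by metis
  show ?thesis
  proof
    show "(\<lambda>t. \<Sum>b\<in>Basis. V b t *\<^sub>R b) \<in> borel_measurable borel"
      using VN(1) by (intro borel_measurable_sum borel_measurable_scaleR) auto
    show "(\<Union>b\<in>Basis. N b) \<in> sets borel" using VN(2) by (intro sets.finite_UN) auto
    show "negligible (\<Union>b\<in>Basis. N b)" using VN(3) by (intro negligible_Union) auto
    fix t assume "t \<notin> (\<Union>b\<in>Basis. N b)"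
    then have "(\<Sum>b\<in>Basis. V b t *\<^sub>R b) = (\<Sum>b\<in>Basis. (W t \<bullet> b) *\<^sub>R b)"
      using VN(4) by (intro sum.cong) auto
    then show "(\<Sum>b\<in>Basis. V b t *\<^sub>R b) = W t" by (simp add: euclidean_representation)
  qed
qed

text \<open>
  The measurable selector of \<open>U t \<inter> K\<close> is extended by \<open>u0\<close> where this set is empty. It agrees with a Borel
  function off a Borel null set, and on that null set \<open>u0\<close> is used once more.
\<close>

lemma selector_through_closed_set:
  fixes U :: "real \<Rightarrow> 'u::euclidean_space set"
  assumes U: "condition_u U" and u0: "u0 \<in> selectors U" and K: "closed K"
  obtains v N where "v \<in> selectors U" "negligible N"
    "\<And>t. 0 \<le> t \<Longrightarrow> t \<notin> N \<Longrightarrow> U t \<inter> K \<noteq> {} \<Longrightarrow> v t \<in> K"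
proof -
  define G where "G = graph U \<inter> UNIV \<times> K"
  have G: "G \<in> sets borel"
    unfolding G_def using U K by (intro sets.Int) (auto simp: condition_u_def intro!: borel_closed closed_Times)
  have G_iff: "(t, p) \<in> G \<longleftrightarrow> 0 \<le> t \<and> p \<in> U t \<and> p \<in> K" for t p
    by (auto simp: G_def graph_def)
  have cl: "closed {p. (t, p) \<in> G}" for t
  proof (cases "0 \<le> t")
    case True
    then have "{p. (t, p) \<in> G} = U t \<inter> K" by (auto simp: G_iff)
    moreover have "closed (U t)" using U True by (auto simp: condition_u_def intro: compact_imp_closed)
    ultimately show ?thesis using K by auto
  qed (simp add: G_iff)
  obtain s where s: "s \<in> borel_measurable lebesgue" "\<And>t. t \<in> fst ` G \<Longrightarrow> (t, s t) \<in> G"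
    using measurable_selector[OF G cl] by blast
  define W where "W t = (if t \<in> fst ` G then s t else if t \<in> {0..} then u0 t else 0)" for t
  have u0_meas: "u0 \<in> borel_measurable (restrict_space borel {0..})" using u0 by (simp add: selectors_def)
  then have "(\<lambda>t. if t \<in> {0..} then u0 t else 0) \<in> borel_measurable borel"
    by (subst (asm) measurable_restrict_space_iff[where c=0]) auto
  then have "(\<lambda>t. if t \<in> {0..} then u0 t else 0) \<in> borel_measurable lebesgue"
    by (intro measurable_completion) simp
  then have "W \<in> borel_measurable lebesgue"
    unfolding W_def using s(1) lebesgue_measurable_projection[OF G] by - (rule measurable_If_set, auto)
  then obtain V N where VN: "V \<in> borel_measurable borel" "N \<in> sets borel" "negligible N" "\<And>t. t \<notin> N \<Longrightarrow> V t = W t"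
    by (rule lebesgue_measurable_eq_borel_off_null) (rule that)
  have W_U: "W t \<in> U t" if "0 \<le> t" for t
    using s(2)[of t] selectors_def[of U] u0 that by (auto simp: W_def G_iff)
  show ?thesis
  proof
    have "V \<in> borel_measurable (restrict_space borel {0..})"
      using VN(1) by (rule measurable_restrict_space1)
    moreover have "N \<inter> space (restrict_space borel {0..}) \<in> sets (restrict_space borel {0..})"
      using VN(2) unfolding sets_restrict_space by (intro image_eqI[where x=N]) (auto simp: space_restrict_space)
    ultimately have "(\<lambda>t. if t \<in> N then u0 t else V t) \<in> borel_measurable (restrict_space borel {0..})"
      using u0_meas by (intro measurable_If_set) auto
    moreover have "(if t \<in> N then u0 t else V t) \<in> U t" if "0 \<le> t" for t
      using VN(4)[of t] W_U[OF that] u0 that by (auto simp: selectors_def)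
    ultimately show "(\<lambda>t. if t \<in> N then u0 t else V t) \<in> selectors U" by (simp add: selectors_def)
    show "negligible N" by (rule VN(3))
    fix t assume t: "0 \<le> t" "t \<notin> N" "U t \<inter> K \<noteq> {}"
    then obtain p where "(t, p) \<in> G" by (auto simp: G_iff)
    then have tG: "t \<in> fst ` G" by force
    with s(2)[OF tG] VN(4)[OF t(2)] t(2) show "(if t \<in> N then u0 t else V t) \<in> K"
      by (simp add: W_def G_iff)
  qed
qed

text \<open>
  One selector through every ball with centre in a countable dense set and radius \<open>1 / (k + 1)\<close>.
\<close>

lemma dense_selectors:
  fixes U :: "real \<Rightarrow> 'u::euclidean_space set"
  assumes U: "condition_u U" and u0: "u0 \<in> selectors U"
  obtains v :: "nat \<Rightarrow> real \<Rightarrow> 'u" and N where "\<And>i. v i \<in> selectors U" "negligible N"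
    "\<And>t p e. 0 \<le> t \<Longrightarrow> t \<notin> N \<Longrightarrow> p \<in> U t \<Longrightarrow> 0 < e \<Longrightarrow> \<exists>i. dist (v i t) p < e"
proof -
  obtain D :: "'u set" where D: "countable D" "\<And>X. open X \<Longrightarrow> X \<noteq> {} \<Longrightarrow> \<exists>d \<in> D. d \<in> X"
    by (rule countable_dense_setE) (rule that)
  define q where "q = from_nat_into D"
  define K where "K i = cball (q (fst (prod_decode i))) (1 / real (Suc (snd (prod_decode i))))" for i
  have "\<exists>v N. v \<in> selectors U \<and> negligible N \<and> (\<forall>t. 0 \<le> t \<longrightarrow> t \<notin> N \<longrightarrow> U t \<inter> K i \<noteq> {} \<longrightarrow> v t \<in> K i)" for i
    by (rule selector_through_closed_set[OF U u0, of "K i"]) (auto simp: K_def)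
  then obtain v N where v: "\<And>i. v i \<in> selectors U" "\<And>i. negligible (N i)"
    "\<And>i t. 0 \<le> t \<Longrightarrow> t \<notin> N i \<Longrightarrow> U t \<inter> K i \<noteq> {} \<Longrightarrow> v i t \<in> K i" by metis
  show ?thesis
  proof
    show "v i \<in> selectors U" for i by (rule v(1))
    show "negligible (\<Union>i. N i)" using v(2) by (rule negligible_Union_nat)
    fix t p and e :: real assume t: "0 \<le> t" "t \<notin> (\<Union>i. N i)" "p \<in> U t" "0 < e"
    obtain k where k: "1 / real (Suc k) < e / 2" using t(4) nat_approx_posE[of "e/2"] by auto
    have "ball p (1 / real (Suc k)) \<noteq> {}" by simp
    then obtain d where "d \<in> D" "dist p d < 1 / real (Suc k)" using D(2)[of "ball p (1 / real (Suc k))"] by auto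
    then obtain j where j: "dist p (q j) < 1 / real (Suc k)" using from_nat_into_surj[OF D(1)] by (metis q_def)
    define i where "i = prod_encode (j, k)"
    have Ki: "K i = cball (q j) (1 / real (Suc k))" by (simp add: K_def i_def)
    then have "p \<in> U t \<inter> K i" using t(3) j by (auto simp: dist_commute)
    then have "v i t \<in> K i" using v(3)[of t i] t by blast
    then have "dist (v i t) (q j) \<le> 1 / real (Suc k)" by (simp add: Ki dist_commute)
    then have "dist (v i t) p < e" using dist_triangle2[of "v i t" p "q j"] j k by linarith
    then show "\<exists>i. dist (v i t) p < e" by blast
  qed
qed

section \<open>Trajectories of the controlled system\<close>

lemma bounded_bilinear_matrix_matrix: "bounded_bilinear ((**) :: real^'n^'m \<Rightarrow> real^'k^'n \<Rightarrow> real^'k^'m)"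
  unfolding bilinear_conv_bounded_bilinear[symmetric] bilinear_def
  by (auto intro!: linearI simp: matrix_matrix_mult_def vec_eq_iff sum.distrib sum_distrib_left algebra_simps)

lemma bounded_bilinear_matrix_vector: "bounded_bilinear ((*v) :: real^'n^'m \<Rightarrow> real^'n \<Rightarrow> real^'m)"
  unfolding bilinear_conv_bounded_bilinear[symmetric] bilinear_def
  by (auto intro!: linearI simp: matrix_vector_mult_def vec_eq_iff sum.distrib sum_distrib_left algebra_simps)

lemma bounded_bilinear_vector_matrix: "bounded_bilinear ((v*) :: real^'m \<Rightarrow> real^'n^'m \<Rightarrow> real^'n)"
  unfolding bilinear_conv_bounded_bilinear[symmetric] bilinear_def
  by (auto intro!: linearI simp: vector_matrix_mult_def vec_eq_iff sum.distrib sum_distrib_left algebra_simps)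

lemma quadratic_remainder:
  fixes \<Phi> :: "'a::euclidean_space \<Rightarrow> 'b::euclidean_space"
  assumes "convex S" and der: "\<And>y. y \<in> S \<Longrightarrow> (\<Phi> has_derivative \<Phi>' y) (at y)"
    and lip: "\<And>y z h. y \<in> S \<Longrightarrow> z \<in> S \<Longrightarrow> norm (\<Phi>' y h - \<Phi>' z h) \<le> c * norm (y - z) * norm h"
    and "0 \<le> c" "x \<in> S" "z \<in> S"
  shows "norm (\<Phi> z - \<Phi> x - \<Phi>' x (z - x)) \<le> c * (norm (z - x))\<^sup>2"
proof -
  have seg: "closed_segment x z \<subseteq> S"
    using assms by (simp add: closed_segment_subset)
  have "norm (\<Phi> z - \<Phi> x - \<Phi>' x (z - x)) \<le> norm (z - x) * (c * norm (z - x))"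
  proof (rule differentiable_bound_linearization[where S="closed_segment x z"])
    show "x + t *\<^sub>R (z - x) \<in> closed_segment x z" if "t \<in> {0..1}" for t
      using that by (auto simp: in_segment algebra_simps intro!: exI[of _ t])
    show "(\<Phi> has_derivative \<Phi>' w) (at w within closed_segment x z)" if "w \<in> closed_segment x z" for w
      using der[of w] seg that by (blast intro: has_derivative_at_withinI)
    show "onorm (\<Phi>' w - \<Phi>' x) \<le> c * norm (z - x)" if w: "w \<in> closed_segment x z" for w
    proof (rule onorm_le)
      fix h
      have "norm ((\<Phi>' w - \<Phi>' x) h) \<le> c * norm (w - x) * norm h"
        using lip[of w x h] w seg assms by auto
      also have "\<dots> \<le> c * norm (z - x) * norm h"
        using segment_bound(1)[OF w] \<open>0 \<le> c\<close> by (intro mult_right_mono mult_left_mono) auto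
      finally show "norm ((\<Phi>' w - \<Phi>' x) h) \<le> c * norm (z - x) * norm h" .
    qed
  qed auto
  then show ?thesis by (simp add: power2_eq_square mult_ac)
qed

text \<open>
  A directional derivative is a limit of difference quotients along a fixed sequence. In this way the
  derivatives of \<open>f\<close> and \<open>g\<close> along a control inherit measurability from \<open>f\<close> and \<open>g\<close>.
\<close>

lemma measurable_directional_derivative:
  fixes \<phi> :: "'t \<Rightarrow> 'a::euclidean_space \<Rightarrow> real"
  assumes meas: "\<And>y. (\<lambda>t. \<phi> t y) \<in> borel_measurable M"
    and der: "\<And>t. t \<in> space M \<Longrightarrow> (\<phi> t has_derivative D t) (at y)"
  shows "(\<lambda>t. D t h) \<in> borel_measurable M"
proof (rule borel_measurable_LIMSEQ_real)
  fix t assume t: "t \<in> space M"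
  interpret bounded_linear "D t" using der[OF t] by (rule has_derivative_bounded_linear)
  have "((\<lambda>r. y + r *\<^sub>R h) has_derivative (\<lambda>r. r *\<^sub>R h)) (at 0)"
    by (auto intro!: derivative_eq_intros)
  then have "((\<lambda>r. \<phi> t (y + r *\<^sub>R h)) has_derivative (\<lambda>r. D t (r *\<^sub>R h))) (at 0)"
    by (rule has_derivative_compose) (use der[OF t] in simp)
  then have "((\<lambda>r. \<phi> t (y + r *\<^sub>R h)) has_field_derivative D t h) (at 0)"
    unfolding has_field_derivative_def by (simp add: scaleR mult_commute_abs)
  then have "((\<lambda>r. (\<phi> t (y + r *\<^sub>R h) - \<phi> t y) / r) \<longlongrightarrow> D t h) (at 0)"
    by (simp add: DERIV_def)
  moreover have "filterlim (\<lambda>n. inverse (real (Suc n))) (at 0) sequentially"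
    unfolding filterlim_at using LIMSEQ_inverse_real_of_nat by auto
  ultimately show "(\<lambda>n. (\<phi> t (y + inverse (real (Suc n)) *\<^sub>R h) - \<phi> t y) / inverse (real (Suc n))) \<longlonglongrightarrow> D t h"
    by (rule filterlim_compose)
next
  fix n
  show "(\<lambda>t. (\<phi> t (y + inverse (real (Suc n)) *\<^sub>R h) - \<phi> t y) / inverse (real (Suc n))) \<in> borel_measurable M"
    by (intro borel_measurable_divide borel_measurable_diff meas borel_measurable_const)
qed

lemma selectorsD: "u \<in> selectors U \<Longrightarrow> 0 \<le> t \<Longrightarrow> u t \<in> U t"
  by (simp add: selectors_def)

lemma caratheodory_continuous_state:
  assumes "caratheodory U a" "0 \<le> t" "p \<in> U t"
  shows "continuous_on UNIV (\<lambda>y. a t y p)"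
proof -
  have "continuous_on (UNIV \<times> U t) (\<lambda>(y, p). a t y p)"
    using assms by (simp add: caratheodory_def)
  then have "continuous_on UNIV (\<lambda>y. (\<lambda>(y, p). a t y p) (y, p))"
    by (rule continuous_on_compose2) (use assms in \<open>auto intro!: continuous_intros\<close>)
  then show ?thesis by simp
qed

lemma superposition_borel_measurable:
  assumes "caratheodory U a" "superposition_measurable U a" "u \<in> selectors U" "continuous_on {0..} x"
  shows "(\<lambda>t. a t (x t) (u t)) \<in> borel_measurable (lebesgue_on {0..})"
proof (rule caratheodory_superposition_measurable[OF _ _ assms(4)])
  show "(\<lambda>t. a t y (u t)) \<in> borel_measurable (lebesgue_on {0..})" for y
    using assms by (simp add: superposition_measurable_def)
  show "continuous_on UNIV (\<lambda>y. a t y (u t))" if "0 \<le> t" for t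
    by (rule caratheodory_continuous_state[OF assms(1) that selectorsD[OF assms(3) that]])
qed

text \<open>
  Integral boundedness is applied to the graph of \<open>x\<close> over \<open>[0, T]\<close>, which is compact.
\<close>

lemma superposition_loc_integrable:
  fixes x :: "real \<Rightarrow> 'x::euclidean_space" and a :: "real \<Rightarrow> 'x \<Rightarrow> 'u::euclidean_space \<Rightarrow> 'y::euclidean_space"
  assumes "caratheodory U a" "superposition_measurable U a" "integrally_bounded U a"
    and u: "u \<in> selectors U" and x: "continuous_on {0..} x"
  shows "loc_integrable (\<lambda>t. a t (x t) (u t))"
  unfolding loc_integrable_def
proof (intro allI impI)
  fix T :: real assume "0 \<le> T"
  define K where "K = (\<lambda>t. (t, x t)) ` {0..T}"
  have "continuous_on {0..T} x" by (rule continuous_on_subset[OF x]) auto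
  then have "compact K" unfolding K_def by (intro compact_continuous_image continuous_intros) auto
  moreover have "K \<subseteq> {0..} \<times> UNIV" by (auto simp: K_def)
  ultimately obtain M where M: "M \<in> L1_loc" "\<forall>(t, y)\<in>K. \<forall>p\<in>U t. norm (a t y p) \<le> M t"
    using assms(3) unfolding integrally_bounded_def by blast
  have "(\<lambda>t. a t (x t) (u t)) \<in> borel_measurable (lebesgue_on {0..T})"
    using measurable_restrict_mono[OF superposition_borel_measurable[OF assms(1,2) u x], of "{0..T}"] by auto
  then show "(\<lambda>t. a t (x t) (u t)) absolutely_integrable_on {0..T}"
  proof (rule measurable_bounded_by_integrable_imp_absolutely_integrable)
    show "M integrable_on {0..T}"
      using M(1) loc_integrable_integrable[of M 0 T] by (simp add: L1_loc_iff)
    fix t assume t: "t \<in> {0..T}"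
    then have "(t, x t) \<in> K" "u t \<in> U t" using selectorsD[OF u] by (auto simp: K_def)
    then show "norm (a t (x t) (u t)) \<le> M t" using M(2) by auto
  qed auto
qed

lemma set_lebesgue_integral_loc_integrable:
  assumes "loc_integrable p" "0 \<le> T"
  shows "(LINT t:{0..T}|lebesgue. p t) = integral {0..T} p"
  using assms set_lebesgue_integral_eq_integral(2)[of "{0..T}" p] by (simp add: loc_integrable_def)

locale controlled_system =
  fixes U :: "real \<Rightarrow> 'u::euclidean_space set"
    and f :: "real \<Rightarrow> real ^ 'm \<Rightarrow> 'u \<Rightarrow> real ^ 'm"
    and g :: "real \<Rightarrow> real ^ 'm \<Rightarrow> 'u \<Rightarrow> real"
    and fx :: "real \<Rightarrow> real ^ 'm \<Rightarrow> 'u \<Rightarrow> real ^ 'm ^ 'm"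
    and gx :: "real \<Rightarrow> real ^ 'm \<Rightarrow> 'u \<Rightarrow> real ^ 'm"
  assumes condition_fg: "condition_fg U f g"
    and superposition_f: "superposition_measurable U f" and superposition_g: "superposition_measurable U g"
    and condition_d: "condition_d U f g fx gx"
begin

lemma f_derivative: "0 \<le> t \<Longrightarrow> ((\<lambda>y. f t y p) has_derivative (\<lambda>h. fx t x p *v h)) (at x)"
  using condition_d by (simp add: condition_d_def)

lemma g_derivative: "0 \<le> t \<Longrightarrow> ((\<lambda>y. g t y p) has_derivative (\<lambda>h. h \<bullet> gx t x p)) (at x)"
  using condition_d by (simp add: condition_d_def gderiv_def)

lemma superposition_fx: "superposition_measurable U fx"
  unfolding superposition_measurable_def
proof (intro ballI allI)
  fix u y assume u: "u \<in> selectors U"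
  have "(\<lambda>t. fx t y (u t) \<bullet> b) \<in> borel_measurable (lebesgue_on {0..})" if "b \<in> Basis" for b
  proof -
    from that obtain i j where b: "b = axis i (axis j 1)" by (auto simp: Basis_vec_def)
    have "(\<lambda>t. (fx t y (u t) *v axis j 1) $ i) \<in> borel_measurable (lebesgue_on {0..})"
    proof (rule measurable_directional_derivative[where \<phi>="\<lambda>t y. f t y (u t) $ i" and y=y and D="\<lambda>t h. (fx t y (u t) *v h) $ i"])
      fix z
      have "(\<lambda>t. f t z (u t)) \<in> borel_measurable (lebesgue_on {0..})"
        using superposition_f u by (simp add: superposition_measurable_def)
      then have "(\<lambda>t. f t z (u t) \<bullet> axis i 1) \<in> borel_measurable (lebesgue_on {0..})" by simp
      then show "(\<lambda>t. f t z (u t) $ i) \<in> borel_measurable (lebesgue_on {0..})" by (simp add: inner_axis)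
    next
      fix t :: real assume "t \<in> space (lebesgue_on {0..})"
      then have "0 \<le> t" by simp
      from f_derivative[OF this] show "((\<lambda>y. f t y (u t) $ i) has_derivative (\<lambda>h. (fx t y (u t) *v h) $ i)) (at y)"
        by (rule bounded_linear.has_derivative[OF bounded_linear_vec_nth])
    qed
    moreover have "(A *v axis j 1) $ i = A \<bullet> b" for A :: "real ^ 'm ^ 'm"
      by (simp add: b inner_axis matrix_vector_mult_basis column_def)
    ultimately show ?thesis by simp
  qed
  then show "(\<lambda>t. fx t y (u t)) \<in> borel_measurable (lebesgue_on {0..})"
    by (subst borel_measurable_euclidean_space) blast
qed

lemma superposition_gx: "superposition_measurable U gx"
  unfolding superposition_measurable_def
proof (intro ballI allI)
  fix u y assume u: "u \<in> selectors U"
  have "(\<lambda>t. gx t y (u t) \<bullet> b) \<in> borel_measurable (lebesgue_on {0..})" for b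
  proof -
    have "(\<lambda>t. b \<bullet> gx t y (u t)) \<in> borel_measurable (lebesgue_on {0..})"
    proof (rule measurable_directional_derivative[where \<phi>="\<lambda>t y. g t y (u t)" and y=y and D="\<lambda>t h. h \<bullet> gx t y (u t)"])
      show "(\<lambda>t. g t z (u t)) \<in> borel_measurable (lebesgue_on {0..})" for z
        using superposition_g u by (simp add: superposition_measurable_def)
    qed (auto intro: g_derivative)
    then show ?thesis by (simp add: inner_commute)
  qed
  then show "(\<lambda>t. gx t y (u t)) \<in> borel_measurable (lebesgue_on {0..})"
    by (subst borel_measurable_euclidean_space) blast
qed

lemma
  assumes "u \<in> selectors U" "continuous_on {0..} x"
  shows f_loc_integrable: "loc_integrable (\<lambda>t. f t (x t) (u t))"
    and g_loc_integrable: "loc_integrable (\<lambda>t. g t (x t) (u t))"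
    and fx_loc_integrable: "loc_integrable (\<lambda>t. fx t (x t) (u t))"
    and gx_loc_integrable: "loc_integrable (\<lambda>t. gx t (x t) (u t))"
  by (rule superposition_loc_integrable[where U=U];
      use assms condition_fg condition_d superposition_f superposition_g superposition_fx superposition_gx
        in \<open>simp add: condition_fg_def condition_d_def\<close>)+

text \<open>
  The rate in the continuability condition does not depend on the compact set, so two-point sets give
  the estimate for all states.
\<close>

lemma global_lipschitz_exists:
  "\<exists>L. loc_integrable L \<and> (\<forall>t\<ge>0. 0 \<le> L t) \<and>
     (\<forall>t\<ge>0. \<forall>p\<in>U t. \<forall>y z. norm (f t y p - f t z p) \<le> L t * norm (y - z))"
proof -
  have "continuability U f" using condition_fg by (simp add: condition_fg_def)
  then obtain L where L: "L \<in> L1_loc" "\<forall>K. compact K \<and> K \<subseteq> {0..} \<times> UNIV \<longrightarrow>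
        (\<forall>t x' x''. (t, x') \<in> K \<and> (t, x'') \<in> K \<longrightarrow>
           (\<forall>p\<in>U t. norm (f t x' p - f t x'' p) \<le> L t * norm (x' - x'')))"
    unfolding continuability_def by (elim conjE bexE) (rule that)
  have "norm (f t y p - f t z p) \<le> L t * norm (y - z)" if "0 \<le> t" "p \<in> U t" for t p y z
  proof -
    have "compact {(t, y), (t, z)} \<and> {(t, y), (t, z)} \<subseteq> {0..} \<times> UNIV"
      using that(1) by (simp add: finite_imp_compact)
    from L(2)[rule_format, OF this, of t y z p] show ?thesis using that(2) by simp
  qed
  then show ?thesis using L(1) by (auto simp: L1_loc_iff)
qed

text \<open>
  A Lipschitz rate of \<open>f\<close> common to all controls; it allows trajectories of different controls to be
  compared.
\<close>

definition lip :: "real \<Rightarrow> real" where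
  "lip = (SOME L. loc_integrable L \<and> (\<forall>t\<ge>0. 0 \<le> L t) \<and>
     (\<forall>t\<ge>0. \<forall>p\<in>U t. \<forall>y z. norm (f t y p - f t z p) \<le> L t * norm (y - z)))"

definition cumulative_lip :: "real \<Rightarrow> real" where
  "cumulative_lip t = integral {0..t} lip"

lemma lip_loc_integrable: "loc_integrable lip"
  and lip_nonneg: "0 \<le> t \<Longrightarrow> 0 \<le> lip t"
  and f_lipschitz: "0 \<le> t \<Longrightarrow> p \<in> U t \<Longrightarrow> norm (f t y p - f t z p) \<le> lip t * norm (y - z)"
  using someI_ex[OF global_lipschitz_exists] unfolding lip_def[symmetric] by auto

lemma primitive_cumulative_lip: "primitive lip cumulative_lip"
  unfolding cumulative_lip_def using lip_loc_integrable by (rule primitive_integral)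

lemma cumulative_lip_0: "cumulative_lip 0 = 0"
  by (simp add: cumulative_lip_def)

text \<open>
  Integral boundedness of \<open>f\<close> gives one bound for each compact set; along a fixed control
  \<open>norm (f t 0 (u t))\<close> is itself locally integrable and bounds the right-hand side at the origin for all
  times.
\<close>

lemma trajectory_ode:
  assumes u: "u \<in> selectors U"
  shows "lipschitz_ode (\<lambda>t y. f t y (u t)) (\<lambda>t. lip t + norm (f t 0 (u t)))
    (\<lambda>t. integral {0..t} (\<lambda>t. lip t + norm (f t 0 (u t))))"
proof
  show "(\<lambda>t. f t y (u t)) \<in> borel_measurable (lebesgue_on {0..})" for y
    using superposition_f u by (simp add: superposition_measurable_def)
  have "loc_integrable (\<lambda>t. f t 0 (u t))"
    by (rule f_loc_integrable[OF u]) simp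
  then show "primitive (\<lambda>t. lip t + norm (f t 0 (u t))) (\<lambda>t. integral {0..t} (\<lambda>t. lip t + norm (f t 0 (u t))))"
    by (intro primitive_integral loc_integrable_add lip_loc_integrable loc_integrable_norm)
  fix t :: real assume t: "0 \<le> t"
  show "norm (f t 0 (u t)) \<le> lip t + norm (f t 0 (u t))" using lip_nonneg[OF t] by simp
  fix y z
  have "norm (f t y (u t) - f t z (u t)) \<le> lip t * norm (y - z)"
    by (rule f_lipschitz[OF t selectorsD[OF u t]])
  also have "\<dots> \<le> (lip t + norm (f t 0 (u t))) * norm (y - z)"
    by (intro mult_right_mono) auto
  finally show "norm (f t y (u t) - f t z (u t)) \<le> (lip t + norm (f t 0 (u t))) * norm (y - z)" .
qed

lemma
  assumes "u \<in> selectors U"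
  shows trajectory_primitive: "primitive (\<lambda>t. f t (trajectory f u \<xi> t) (u t)) (trajectory f u \<xi>)"
    and trajectory_0: "trajectory f u \<xi> 0 = \<xi>"
  unfolding trajectory_def using lipschitz_ode.ode_solution_solves[OF trajectory_ode[OF assms]] by auto

lemma trajectory_continuous: "u \<in> selectors U \<Longrightarrow> continuous_on {0..} (trajectory f u \<xi>)"
  by (rule primitive_continuous_on[OF trajectory_primitive])

lemma payoff_eq_integral:
  assumes "u \<in> selectors U" "0 \<le> T"
  shows "payoff f g T u = integral {0..T} (\<lambda>t. g t (trajectory f u 0 t) (u t))"
  unfolding payoff_def
  by (rule set_lebesgue_integral_loc_integrable[OF g_loc_integrable[OF assms(1) trajectory_continuous[OF assms(1)]] assms(2)])

end

section \<open>The flow of the reference control\<close>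

locale reference_control = controlled_system U f g fx gx
  for U :: "real \<Rightarrow> 'u::euclidean_space set"
    and f :: "real \<Rightarrow> real ^ 'm \<Rightarrow> 'u \<Rightarrow> real ^ 'm"
    and g :: "real \<Rightarrow> real ^ 'm \<Rightarrow> 'u \<Rightarrow> real"
    and fx :: "real \<Rightarrow> real ^ 'm \<Rightarrow> 'u \<Rightarrow> real ^ 'm ^ 'm"
    and gx :: "real \<Rightarrow> real ^ 'm \<Rightarrow> 'u \<Rightarrow> real ^ 'm" +
  fixes u0 :: "real \<Rightarrow> 'u"
  assumes u0: "u0 \<in> selectors U"
begin

abbreviation flow :: "real ^ 'm \<Rightarrow> real \<Rightarrow> real ^ 'm" where
  "flow \<xi> \<equiv> trajectory f u0 \<xi>"

abbreviation jac :: "real ^ 'm \<Rightarrow> real \<Rightarrow> real ^ 'm ^ 'm" where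
  "jac \<xi> t \<equiv> fx t (flow \<xi> t) (u0 t)"

abbreviation fund :: "real ^ 'm \<Rightarrow> real \<Rightarrow> real ^ 'm ^ 'm" where
  "fund \<xi> \<equiv> fundamental_matrix f fx u0 \<xi>"

abbreviation grad :: "real ^ 'm \<Rightarrow> real \<Rightarrow> real ^ 'm" where
  "grad \<xi> \<equiv> payoff_gradient f fx gx u0 \<xi>"

text \<open>
  The payoff up to time \<open>T\<close> of the reference control started at \<open>\<xi>\<close>.
\<close>

definition val :: "real ^ 'm \<Rightarrow> real \<Rightarrow> real" where
  "val \<xi> T = integral {0..T} (\<lambda>t. g t (flow \<xi> t) (u0 t))"

lemmas flow_primitive = trajectory_primitive[OF u0]
  and flow_0 = trajectory_0[OF u0]
  and flow_continuous = trajectory_continuous[OF u0]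

lemma flow_eqI:
  assumes "primitive (\<lambda>t. f t (z t) (u0 t)) z" "0 \<le> t"
  shows "flow (z 0) t = z t"
  by (rule lipschitz_ode.solution_unique[OF trajectory_ode[OF u0] flow_primitive assms(1) order_refl flow_0 assms(2)])

text \<open>
  Solving backwards from time \<open>c\<close> labels any state reached at that time by an initial point.
\<close>

lemma flow_through:
  assumes "0 \<le> c"
  obtains \<xi> where "flow \<xi> c = y"
proof -
  obtain z where z: "primitive (\<lambda>t. f t (z t) (u0 t)) z" "z c = y"
    using lipschitz_ode.solution_exists[OF trajectory_ode[OF u0] assms] by blast
  from flow_eqI[OF z(1) assms] z(2) show ?thesis using that by simp
qed

lemma
  assumes "0 \<le> t" "t \<le> T"
  shows flow_dist: "norm (flow \<xi> t - flow \<zeta> t) \<le> norm (\<xi> - \<zeta>) * exp (cumulative_lip T)"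
    and flow_dist_backward: "norm (flow \<xi> t - flow \<zeta> t) \<le> norm (flow \<xi> T - flow \<zeta> T) * exp (cumulative_lip T)"
proof -
  have d: "primitive (\<lambda>t. f t (flow \<xi> t) (u0 t) - f t (flow \<zeta> t) (u0 t)) (\<lambda>t. flow \<xi> t - flow \<zeta> t)"
    by (rule primitive_diff[OF flow_primitive flow_primitive])
  have le: "norm (f t (flow \<xi> t) (u0 t) - f t (flow \<zeta> t) (u0 t)) \<le> lip t * norm (flow \<xi> t - flow \<zeta> t) + 0" if "0 \<le> t" for t
    using f_lipschitz[OF that selectorsD[OF u0 that]] by simp
  have "norm (flow \<xi> t - flow \<zeta> t) \<le> (norm (flow \<xi> 0 - flow \<zeta> 0) + integral {0..T} (\<lambda>r. 0)) * exp (cumulative_lip T - cumulative_lip 0)"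
    by (rule gronwall_forward[OF d primitive_cumulative_lip lip_nonneg]) (use le assms in auto)
  then show "norm (flow \<xi> t - flow \<zeta> t) \<le> norm (\<xi> - \<zeta>) * exp (cumulative_lip T)"
    by (simp add: flow_0 cumulative_lip_0)
  have "norm (flow \<xi> t - flow \<zeta> t) \<le> (norm (flow \<xi> T - flow \<zeta> T) + integral {0..T} (\<lambda>r. 0)) * exp (cumulative_lip T - cumulative_lip 0)"
    by (rule gronwall_backward[OF d primitive_cumulative_lip lip_nonneg]) (use le assms in auto)
  then show "norm (flow \<xi> t - flow \<zeta> t) \<le> norm (flow \<xi> T - flow \<zeta> T) * exp (cumulative_lip T)"
    by (simp add: cumulative_lip_0)
qed

lemma jac_measurable: "jac \<xi> \<in> borel_measurable (lebesgue_on {0..})"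
  by (rule superposition_borel_measurable[OF _ superposition_fx u0 flow_continuous])
     (use condition_d in \<open>simp add: condition_d_def\<close>)

lemma linear_ode:
  fixes prod :: "real ^ 'm ^ 'm \<Rightarrow> real ^ 'm ^ 'm \<Rightarrow> real ^ 'm ^ 'm"
  assumes "bounded_bilinear prod"
  shows "\<exists>L l. lipschitz_ode (\<lambda>t. prod (jac \<xi> t)) L l"
proof -
  interpret bounded_bilinear prod by fact
  obtain K where K: "K > 0" "\<And>a b. norm (prod a b) \<le> norm a * norm b * K"
    using pos_bounded by blast
  have "loc_integrable (\<lambda>t. K * norm (jac \<xi> t))"
    by (intro loc_integrable_cmult loc_integrable_norm fx_loc_integrable u0 flow_continuous)
  then have "primitive (\<lambda>t. K * norm (jac \<xi> t)) (\<lambda>t. integral {0..t} (\<lambda>t. K * norm (jac \<xi> t)))"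
    by (rule primitive_integral)
  moreover have "(\<lambda>t. prod (jac \<xi> t) y) \<in> borel_measurable (lebesgue_on {0..})" for y
    by (rule borel_measurable_continuous_on[OF linear_continuous_on[OF bounded_linear_left] jac_measurable])
  moreover have "norm (prod (jac \<xi> t) y - prod (jac \<xi> t) z) \<le> K * norm (jac \<xi> t) * norm (y - z)" for t y z
    using K(2)[of "jac \<xi> t" "y - z"] by (simp add: diff_right mult_ac)
  ultimately have "lipschitz_ode (\<lambda>t. prod (jac \<xi> t)) (\<lambda>t. K * norm (jac \<xi> t)) (\<lambda>t. integral {0..t} (\<lambda>t. K * norm (jac \<xi> t)))"
    using K(1) by unfold_locales (auto simp: zero_right)
  then show ?thesis by blast
qed

lemma fund_primitive: "primitive (\<lambda>t. jac \<xi> t ** fund \<xi> t) (fund \<xi>)"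
  and fund_0: "fund \<xi> 0 = mat 1"
  unfolding fundamental_matrix_def
  using linear_ode[OF bounded_bilinear_matrix_matrix, of \<xi>] lipschitz_ode.ode_solution_solves by blast+

lemma fund_continuous: "continuous_on {0..} (fund \<xi>)"
  by (rule primitive_continuous_on[OF fund_primitive])

text \<open>
  The inverse is constructed as the solution of its own equation \<open>C' = - C B\<close>, where \<open>B\<close> is the Jacobian
  along the flow; then \<open>C ** A\<close> has derivative zero. This yields invertibility together with the
  differential equation that the costate inherits.
\<close>

lemma inverse_fund_exists:
  "\<exists>C. primitive (\<lambda>t. - (C t ** jac \<xi> t)) C \<and> (\<forall>t\<ge>0. C t ** fund \<xi> t = mat 1 \<and> fund \<xi> t ** C t = mat 1)"
proof -
  have bb: "bounded_bilinear (\<lambda>(a :: real ^ 'm ^ 'm) (b :: real ^ 'm ^ 'm). - (b ** a))"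
    unfolding bilinear_conv_bounded_bilinear[symmetric] bilinear_def
    by (auto intro!: linearI simp: matrix_matrix_mult_def vec_eq_iff sum.distrib sum_distrib_left algebra_simps)
  then obtain L l where "lipschitz_ode (\<lambda>t (b :: real ^ 'm ^ 'm). - (b ** jac \<xi> t)) L l"
    using linear_ode[OF bb, of \<xi>] by blast
  from lipschitz_ode.solution_exists[OF this, of 0 "mat 1"] obtain C where C: "primitive (\<lambda>t. - (C t ** jac \<xi> t)) C" "C 0 = mat 1"
    by auto
  have "primitive (\<lambda>t. C t ** (jac \<xi> t ** fund \<xi> t) + - (C t ** jac \<xi> t) ** fund \<xi> t) (\<lambda>t. C t ** fund \<xi> t)"
    by (rule primitive_bilinear[OF bounded_bilinear_matrix_matrix C(1) fund_primitive])
  moreover have "C t ** (jac \<xi> t ** fund \<xi> t) + - (C t ** jac \<xi> t) ** fund \<xi> t = 0" for t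
    using bounded_bilinear.minus_left[OF bounded_bilinear_matrix_matrix, of "C t ** jac \<xi> t" "fund \<xi> t"]
    by (simp add: matrix_mul_assoc)
  ultimately have p: "primitive (\<lambda>t. 0) (\<lambda>t. C t ** fund \<xi> t)" by simp
  have "C t ** fund \<xi> t = mat 1" if "0 \<le> t" for t
    using primitive_at[OF p that] by (simp add: C(2) fund_0)
  then show ?thesis using C(1) matrix_left_right_inverse by blast
qed

definition inverse_fund :: "real ^ 'm \<Rightarrow> real \<Rightarrow> real ^ 'm ^ 'm" where
  "inverse_fund \<xi> = (SOME C. primitive (\<lambda>t. - (C t ** jac \<xi> t)) C \<and>
     (\<forall>t\<ge>0. C t ** fund \<xi> t = mat 1 \<and> fund \<xi> t ** C t = mat 1))"

lemma inverse_fund_primitive: "primitive (\<lambda>t. - (inverse_fund \<xi> t ** jac \<xi> t)) (inverse_fund \<xi>)"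
  and inverse_fund_left: "0 \<le> t \<Longrightarrow> inverse_fund \<xi> t ** fund \<xi> t = mat 1"
  and inverse_fund_right: "0 \<le> t \<Longrightarrow> fund \<xi> t ** inverse_fund \<xi> t = mat 1"
  using someI_ex[OF inverse_fund_exists[of \<xi>]] unfolding inverse_fund_def[symmetric] by auto

lemma fund_invertible:
  assumes "0 \<le> t"
  shows "invertible (fund \<xi> t)" "matrix_inv (fund \<xi> t) = inverse_fund \<xi> t"
proof -
  show "invertible (fund \<xi> t)"
    unfolding invertible_def using inverse_fund_left[OF assms] inverse_fund_right[OF assms] by blast
  then have "matrix_inv (fund \<xi> t) ** fund \<xi> t = mat 1"
    unfolding matrix_inv_def invertible_def by (rule someI2_ex) auto
  then have "(matrix_inv (fund \<xi> t) ** fund \<xi> t) ** inverse_fund \<xi> t = mat 1 ** inverse_fund \<xi> t" by simp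
  then show "matrix_inv (fund \<xi> t) = inverse_fund \<xi> t"
    by (simp add: matrix_mul_assoc[symmetric] inverse_fund_right[OF assms])
qed

lemma grad_primitive: "primitive (\<lambda>t. gx t (flow \<xi> t) (u0 t) v* fund \<xi> t) (grad \<xi>)"
  and grad_0: "grad \<xi> 0 = 0"
proof -
  have gxi: "loc_integrable (\<lambda>t. gx t (flow \<xi> t) (u0 t))"
    by (rule gx_loc_integrable[OF u0 flow_continuous])
  have p: "loc_integrable (\<lambda>t. gx t (flow \<xi> t) (u0 t) v* fund \<xi> t)"
    unfolding loc_integrable_def
  proof (intro allI impI)
    fix T :: real assume "0 \<le> T"
    have c: "continuous_on {0..T} (fund \<xi>)" by (rule continuous_on_subset[OF fund_continuous]) auto
    show "(\<lambda>t. gx t (flow \<xi> t) (u0 t) v* fund \<xi> t) absolutely_integrable_on {0..T}"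
    proof (rule absolutely_integrable_bounded_measurable_product[where h="\<lambda>A v. v v* A" and f="fund \<xi>" and g="\<lambda>t. gx t (flow \<xi> t) (u0 t)"])
      show "bilinear (\<lambda>A (v :: real ^ 'm). v v* (A :: real ^ 'm ^ 'm))"
        unfolding bilinear_conv_bounded_bilinear by (rule bounded_bilinear.flip[OF bounded_bilinear_vector_matrix])
      show "fund \<xi> \<in> borel_measurable (lebesgue_on {0..T})"
        by (rule continuous_imp_measurable_on_sets_lebesgue[OF c]) auto
      show "bounded (fund \<xi> ` {0..T})"
        by (rule compact_imp_bounded[OF compact_continuous_image[OF c]]) auto
      show "(\<lambda>t. gx t (flow \<xi> t) (u0 t)) absolutely_integrable_on {0..T}"
        using gxi \<open>0 \<le> T\<close> by (simp add: loc_integrable_def)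
    qed auto
  qed
  have eq: "grad \<xi> t = integral {0..t} (\<lambda>t. gx t (flow \<xi> t) (u0 t) v* fund \<xi> t)" if "0 \<le> t" for t
    unfolding payoff_gradient_def by (rule set_lebesgue_integral_loc_integrable[OF p that])
  show "primitive (\<lambda>t. gx t (flow \<xi> t) (u0 t) v* fund \<xi> t) (grad \<xi>)"
    by (rule primitive_cong[OF primitive_integral[OF p]]) (auto simp: eq)
  show "grad \<xi> 0 = 0" by (simp add: eq)
qed

end

section \<open>Expansion of the flow and of the payoff\<close>

lemma lipschitz_on_tube:
  fixes a :: "real \<Rightarrow> 'x::euclidean_space \<Rightarrow> 'u::euclidean_space \<Rightarrow> 'y::euclidean_space"
  assumes "locally_lipschitz U a" "0 \<le> T"
  obtains L where "loc_integrable L" "\<And>t. 0 \<le> t \<Longrightarrow> 0 \<le> L t"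
    "\<And>t y z p. t \<in> {0..T} \<Longrightarrow> y \<in> cball 0 R \<Longrightarrow> z \<in> cball 0 R \<Longrightarrow> p \<in> U t \<Longrightarrow>
      norm (a t y p - a t z p) \<le> L t * norm (y - z)"
proof -
  have "compact ({0..T} \<times> cball (0::'x) R) \<and> {0..T} \<times> cball (0::'x) R \<subseteq> {0..} \<times> UNIV"
    by (auto intro: compact_Times)
  from assms(1)[unfolded locally_lipschitz_def, THEN spec, of "{0..T} \<times> cball 0 R", THEN mp, OF this]
  obtain L where L: "L \<in> L1_loc" "\<forall>t x' x''. (t, x') \<in> {0..T} \<times> cball 0 R \<and> (t, x'') \<in> {0..T} \<times> cball 0 R \<longrightarrow>
           (\<forall>p\<in>U t. norm (a t x' p - a t x'' p) \<le> L t * norm (x' - x''))"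
    by blast
  show ?thesis
    by (rule that[of L]) (use L in \<open>auto simp: L1_loc_iff\<close>)
qed

context reference_control
begin

lemma flow_tube:
  obtains R where "\<And>\<eta> t. norm \<eta> \<le> 1 \<Longrightarrow> t \<in> {0..T} \<Longrightarrow> flow (\<xi> + \<eta>) t \<in> cball 0 R"
proof -
  have "continuous_on {0..T} (flow \<xi>)" by (rule continuous_on_subset[OF flow_continuous]) auto
  then have "bounded (flow \<xi> ` {0..T})" by (intro compact_imp_bounded compact_continuous_image) auto
  then obtain R where R: "\<And>t. t \<in> {0..T} \<Longrightarrow> norm (flow \<xi> t) \<le> R" unfolding bounded_iff by blast
  have "flow (\<xi> + \<eta>) t \<in> cball 0 (R + exp (cumulative_lip T))" if "norm \<eta> \<le> 1" "t \<in> {0..T}" for \<eta> t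
  proof -
    have "norm (flow (\<xi> + \<eta>) t - flow \<xi> t) \<le> norm \<eta> * exp (cumulative_lip T)"
      using flow_dist[of t T "\<xi> + \<eta>" \<xi>] that by simp
    also have "\<dots> \<le> exp (cumulative_lip T)" using that(1) by simp
    finally show ?thesis
      using norm_triangle_sub[of "flow (\<xi> + \<eta>) t" "flow \<xi> t"] R[OF that(2)] by simp
  qed
  then show ?thesis by (rule that)
qed

text \<open>
  The remainder solves the variational equation with an inhomogeneity that is quadratic in \<open>\<eta>\<close>: the
  derivative of \<open>f\<close> is Lipschitz on a tube containing all trajectories with \<open>norm \<eta> \<le> 1\<close>, and these
  deviate by \<open>O(norm \<eta>)\<close>. Gronwall's inequality concludes.
\<close>

lemma flow_expansion:
  assumes "0 \<le> T"
  shows "\<exists>C\<ge>0. \<forall>\<eta>. norm \<eta> \<le> 1 \<longrightarrow> (\<forall>t\<in>{0..T}. norm (flow (\<xi> + \<eta>) t - flow \<xi> t - fund \<xi> t *v \<eta>) \<le> C * (norm \<eta>)\<^sup>2)"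
proof -
  obtain R where tube: "\<And>\<eta> t. norm \<eta> \<le> 1 \<Longrightarrow> t \<in> {0..T} \<Longrightarrow> flow (\<xi> + \<eta>) t \<in> cball 0 R"
    by (rule flow_tube[where T=T and \<xi>=\<xi>]) (rule that)
  define c where "c = exp (cumulative_lip T)"
  obtain K where K: "K > 0" "\<And>(A :: real ^ 'm ^ 'm) (h :: real ^ 'm). norm (A *v h) \<le> norm A * norm h * K"
    using bounded_bilinear.pos_bounded[OF bounded_bilinear_matrix_vector[where 'n='m and 'm='m]] by blast
  have "locally_lipschitz U fx" using condition_d by (simp add: condition_d_def)
  then obtain L where L: "loc_integrable L" "\<And>t. 0 \<le> t \<Longrightarrow> 0 \<le> L t"
    "\<And>t y z p. t \<in> {0..T} \<Longrightarrow> y \<in> cball 0 R \<Longrightarrow> z \<in> cball 0 R \<Longrightarrow> p \<in> U t \<Longrightarrow> norm (fx t y p - fx t z p) \<le> L t * norm (y - z)"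
    using lipschitz_on_tube[OF _ assms, of U fx R] by blast
  define b where "b t = integral {0..t} (\<lambda>t. K * norm (jac \<xi> t))" for t
  have b: "primitive (\<lambda>t. K * norm (jac \<xi> t)) b"
    unfolding b_def by (intro primitive_integral loc_integrable_cmult loc_integrable_norm fx_loc_integrable u0 flow_continuous)
  define C where "C = K * c\<^sup>2 * integral {0..T} L * exp (b T - b 0)"
  have L_int: "L integrable_on {0..T}" by (rule loc_integrable_integrable[OF L(1)]) simp
  have "0 \<le> integral {0..T} L" by (rule integral_nonneg[OF L_int]) (use L(2) in auto)
  then have "0 \<le> C" using K(1) by (simp add: C_def)
  moreover have "norm (flow (\<xi> + \<eta>) t - flow \<xi> t - fund \<xi> t *v \<eta>) \<le> C * (norm \<eta>)\<^sup>2"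
    if \<eta>: "norm \<eta> \<le> 1" and t: "t \<in> {0..T}" for \<eta> t
  proof -
    define z where "z = flow (\<xi> + \<eta>)"
    define r where "r t = z t - flow \<xi> t - fund \<xi> t *v \<eta>" for t
    define p where "p t = f t (z t) (u0 t) - f t (flow \<xi> t) (u0 t) - (jac \<xi> t ** fund \<xi> t) *v \<eta>" for t
    have "primitive (\<lambda>t. (jac \<xi> t ** fund \<xi> t) *v \<eta>) (\<lambda>t. fund \<xi> t *v \<eta>)"
      by (rule primitive_linear[OF fund_primitive bounded_bilinear.bounded_linear_left[OF bounded_bilinear_matrix_vector]])
    then have r: "primitive p r"
      unfolding p_def r_def z_def by (intro primitive_diff flow_primitive)
    have z_dist: "norm (z t - flow \<xi> t) \<le> c * norm \<eta>" if "t \<in> {0..T}" for t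
      using flow_dist[of t T "\<xi> + \<eta>" \<xi>] that by (simp add: z_def c_def mult.commute)
    have in_tube: "flow \<xi> t \<in> cball 0 R" "z t \<in> cball 0 R" if "t \<in> {0..T}" for t
      using tube[of 0 t] tube[of \<eta> t] \<eta> that by (simp_all add: z_def)
    have p_le: "norm (p t) \<le> (K * norm (jac \<xi> t)) * norm (r t) + K * (c * norm \<eta>)\<^sup>2 * L t" if t: "t \<in> {0..T}" for t
    proof -
      have "0 \<le> t" using t by simp
      have ut: "u0 t \<in> U t" by (rule selectorsD[OF u0 \<open>0 \<le> t\<close>])
      have eq: "p t = jac \<xi> t *v r t + (f t (z t) (u0 t) - f t (flow \<xi> t) (u0 t) - jac \<xi> t *v (z t - flow \<xi> t))"
        by (simp add: p_def r_def matrix_vector_mult_diff_distrib matrix_vector_mul_assoc)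
      have "norm (f t (z t) (u0 t) - f t (flow \<xi> t) (u0 t) - jac \<xi> t *v (z t - flow \<xi> t)) \<le> (K * L t) * (norm (z t - flow \<xi> t))\<^sup>2"
      proof (rule quadratic_remainder[where S="cball 0 R" and \<Phi>="\<lambda>y. f t y (u0 t)" and \<Phi>'="\<lambda>y h. fx t y (u0 t) *v h"])
        fix y w h :: "real ^ 'm" assume "y \<in> cball 0 R" "w \<in> cball 0 R"
        then have 1: "norm (fx t y (u0 t) - fx t w (u0 t)) \<le> L t * norm (y - w)" by (rule L(3)[OF t _ _ ut])
        have "norm (fx t y (u0 t) *v h - fx t w (u0 t) *v h) \<le> norm (fx t y (u0 t) - fx t w (u0 t)) * norm h * K"
          using K(2) by (simp add: matrix_vector_mult_diff_rdistrib[symmetric])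
        also have "\<dots> \<le> (L t * norm (y - w)) * norm h * K"
          using 1 K(1) by (intro mult_right_mono) auto
        finally show "norm (fx t y (u0 t) *v h - fx t w (u0 t) *v h) \<le> K * L t * norm (y - w) * norm h"
          by (simp add: mult_ac)
      qed (use in_tube[OF t] f_derivative[OF \<open>0 \<le> t\<close>] K(1) L(2)[OF \<open>0 \<le> t\<close>] in auto)
      also have "\<dots> \<le> (K * L t) * (c * norm \<eta>)\<^sup>2"
        using z_dist[OF t] K(1) L(2)[OF \<open>0 \<le> t\<close>] by (intro mult_left_mono power_mono) auto
      finally have 2: "norm (f t (z t) (u0 t) - f t (flow \<xi> t) (u0 t) - jac \<xi> t *v (z t - flow \<xi> t)) \<le> K * (c * norm \<eta>)\<^sup>2 * L t"
        by (simp add: mult_ac)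
      have 3: "norm (jac \<xi> t *v r t) \<le> (K * norm (jac \<xi> t)) * norm (r t)"
        using K(2)[of "jac \<xi> t" "r t"] by (simp add: mult_ac)
      show ?thesis unfolding eq by (rule order_trans[OF norm_triangle_ineq add_mono[OF 3 2]])
    qed
    have "norm (r t) \<le> (norm (r 0) + integral {0..T} (\<lambda>t. K * (c * norm \<eta>)\<^sup>2 * L t)) * exp (b T - b 0)"
    proof (rule gronwall_forward[OF r b])
      show "(\<lambda>t. K * (c * norm \<eta>)\<^sup>2 * L t) integrable_on {0..T}"
        by (intro loc_integrable_integrable loc_integrable_cmult L(1)) simp
    qed (use K(1) L(2) p_le t in auto)
    also have "norm (r 0) = 0" by (simp add: r_def z_def flow_0 fund_0)
    also have "integral {0..T} (\<lambda>t. K * (c * norm \<eta>)\<^sup>2 * L t) = K * (c * norm \<eta>)\<^sup>2 * integral {0..T} L"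
      by (rule integral_mult_right)
    also have "(0 + K * (c * norm \<eta>)\<^sup>2 * integral {0..T} L) * exp (b T - b 0) = C * (norm \<eta>)\<^sup>2"
      by (simp add: C_def power_mult_distrib mult_ac)
    finally show ?thesis by (simp add: r_def z_def)
  qed
  ultimately show ?thesis by blast
qed

lemma val_primitive: "primitive (\<lambda>t. g t (flow \<xi> t) (u0 t)) (val \<xi>)"
  using primitive_integral[OF g_loc_integrable[OF u0 flow_continuous]] unfolding val_def[abs_def] .

lemma val_0: "val \<xi> 0 = 0"
  by (simp add: val_def)

text \<open>
  The integrand of the remainder splits into the quadratic remainder of \<open>g\<close> and the remainder of the
  flow tested with the gradient of \<open>g\<close>. Differentiability is proved at every \<open>\<xi>\<close>, since the mean value
  argument of \<open>uniform_value_expansion\<close> runs over the whole segment from \<open>0\<close> to \<open>\<xi>\<close>.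
\<close>

lemma val_has_derivative:
  assumes "0 \<le> T"
  shows "((\<lambda>\<xi>. val \<xi> T) has_derivative (\<lambda>\<eta>. \<eta> \<bullet> grad \<xi> T)) (at \<xi>)"
proof -
  obtain R where tube: "\<And>\<eta> t. norm \<eta> \<le> 1 \<Longrightarrow> t \<in> {0..T} \<Longrightarrow> flow (\<xi> + \<eta>) t \<in> cball 0 R"
    by (rule flow_tube[where T=T and \<xi>=\<xi>]) (rule that)
  define c where "c = exp (cumulative_lip T)"
  obtain C where C: "0 \<le> C" "\<And>\<eta> t. norm \<eta> \<le> 1 \<Longrightarrow> t \<in> {0..T} \<Longrightarrow> norm (flow (\<xi> + \<eta>) t - flow \<xi> t - fund \<xi> t *v \<eta>) \<le> C * (norm \<eta>)\<^sup>2"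
    using flow_expansion[OF assms] by blast
  have "locally_lipschitz U gx" using condition_d by (simp add: condition_d_def)
  then obtain L where L: "loc_integrable L" "\<And>t. 0 \<le> t \<Longrightarrow> 0 \<le> L t"
    "\<And>t y z p. t \<in> {0..T} \<Longrightarrow> y \<in> cball 0 R \<Longrightarrow> z \<in> cball 0 R \<Longrightarrow> p \<in> U t \<Longrightarrow> norm (gx t y p - gx t z p) \<le> L t * norm (y - z)"
    using lipschitz_on_tube[OF _ assms, of U gx R] by blast
  define G where "G t = gx t (flow \<xi> t) (u0 t)" for t
  have G: "loc_integrable G"
    unfolding G_def by (intro gx_loc_integrable u0 flow_continuous)
  have int: "L integrable_on {0..T}" "(\<lambda>t. norm (G t)) integrable_on {0..T}"
    by (rule loc_integrable_integrable; use L(1) loc_integrable_norm[OF G] in simp)+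
  define C' where "C' = c\<^sup>2 * integral {0..T} L + C * integral {0..T} (\<lambda>t. norm (G t))"
  have main: "norm (val (\<xi> + \<eta>) T - val \<xi> T - \<eta> \<bullet> grad \<xi> T) \<le> C' * (norm \<eta>)\<^sup>2" if \<eta>: "norm \<eta> \<le> 1" for \<eta>
  proof -
    define z where "z = flow (\<xi> + \<eta>)"
    define p where "p t = g t (z t) (u0 t) - g t (flow \<xi> t) (u0 t) - \<eta> \<bullet> (G t v* fund \<xi> t)" for t
    have P: "primitive p (\<lambda>t. val (\<xi> + \<eta>) t - val \<xi> t - \<eta> \<bullet> grad \<xi> t)"
      unfolding p_def z_def G_def
      by (intro primitive_diff val_primitive primitive_linear[OF grad_primitive] bounded_linear_inner_right)
    have z_dist: "norm (z t - flow \<xi> t) \<le> c * norm \<eta>" if "t \<in> {0..T}" for t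
      using flow_dist[of t T "\<xi> + \<eta>" \<xi>] that by (simp add: z_def c_def mult.commute)
    have in_tube: "flow \<xi> t \<in> cball 0 R" "z t \<in> cball 0 R" if "t \<in> {0..T}" for t
      using tube[of 0 t] tube[of \<eta> t] \<eta> that by (simp_all add: z_def)
    have p_le: "norm (p t) \<le> (c * norm \<eta>)\<^sup>2 * L t + (C * (norm \<eta>)\<^sup>2) * norm (G t)" if t: "t \<in> {0..T}" for t
    proof -
      have "0 \<le> t" using t by simp
      have ut: "u0 t \<in> U t" by (rule selectorsD[OF u0 \<open>0 \<le> t\<close>])
      have eq: "p t = (g t (z t) (u0 t) - g t (flow \<xi> t) (u0 t) - (z t - flow \<xi> t) \<bullet> G t)
          + (flow (\<xi> + \<eta>) t - flow \<xi> t - fund \<xi> t *v \<eta>) \<bullet> G t"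
      proof -
        have "\<eta> \<bullet> (G t v* fund \<xi> t) = (fund \<xi> t *v \<eta>) \<bullet> G t"
          by (metis dot_lmul_matrix inner_commute)
        then show ?thesis by (simp add: p_def z_def inner_diff_left)
      qed
      have "norm (g t (z t) (u0 t) - g t (flow \<xi> t) (u0 t) - (z t - flow \<xi> t) \<bullet> G t) \<le> L t * (norm (z t - flow \<xi> t))\<^sup>2"
        unfolding G_def
      proof (rule quadratic_remainder[where S="cball 0 R" and \<Phi>="\<lambda>y. g t y (u0 t)" and \<Phi>'="\<lambda>y h. h \<bullet> gx t y (u0 t)"])
        fix y w h :: "real ^ 'm" assume "y \<in> cball 0 R" "w \<in> cball 0 R"
        then have 1: "norm (gx t y (u0 t) - gx t w (u0 t)) \<le> L t * norm (y - w)" by (rule L(3)[OF t _ _ ut])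
        have "norm (h \<bullet> gx t y (u0 t) - h \<bullet> gx t w (u0 t)) \<le> norm h * norm (gx t y (u0 t) - gx t w (u0 t))"
          using Cauchy_Schwarz_ineq2[of h "gx t y (u0 t) - gx t w (u0 t)"] by (simp add: inner_diff_right)
        also have "\<dots> \<le> norm h * (L t * norm (y - w))"
          using 1 by (intro mult_left_mono) auto
        finally show "norm (h \<bullet> gx t y (u0 t) - h \<bullet> gx t w (u0 t)) \<le> L t * norm (y - w) * norm h"
          by (simp add: mult_ac)
      qed (use in_tube[OF t] g_derivative[OF \<open>0 \<le> t\<close>] L(2)[OF \<open>0 \<le> t\<close>] in auto)
      also have "\<dots> \<le> L t * (c * norm \<eta>)\<^sup>2"
        using z_dist[OF t] L(2)[OF \<open>0 \<le> t\<close>] by (intro mult_left_mono power_mono) auto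
      finally have 2: "norm (g t (z t) (u0 t) - g t (flow \<xi> t) (u0 t) - (z t - flow \<xi> t) \<bullet> G t) \<le> (c * norm \<eta>)\<^sup>2 * L t"
        by (simp add: mult_ac)
      have "norm ((flow (\<xi> + \<eta>) t - flow \<xi> t - fund \<xi> t *v \<eta>) \<bullet> G t) \<le> norm (flow (\<xi> + \<eta>) t - flow \<xi> t - fund \<xi> t *v \<eta>) * norm (G t)"
        by (simp add: Cauchy_Schwarz_ineq2)
      also have "\<dots> \<le> (C * (norm \<eta>)\<^sup>2) * norm (G t)"
        by (intro mult_right_mono C(2) \<eta> t) simp
      finally show ?thesis unfolding eq by (rule order_trans[OF norm_triangle_ineq add_mono[OF 2]])
    qed
    have i: "(\<lambda>t. (c * norm \<eta>)\<^sup>2 * L t) integrable_on {0..T}" "(\<lambda>t. (C * (norm \<eta>)\<^sup>2) * norm (G t)) integrable_on {0..T}"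
      by (intro loc_integrable_integrable loc_integrable_cmult loc_integrable_norm L(1) G; simp)+
    have "norm ((val (\<xi> + \<eta>) T - val \<xi> T - \<eta> \<bullet> grad \<xi> T) - (val (\<xi> + \<eta>) 0 - val \<xi> 0 - \<eta> \<bullet> grad \<xi> 0))
        \<le> integral {0..T} (\<lambda>t. (c * norm \<eta>)\<^sup>2 * L t + (C * (norm \<eta>)\<^sup>2) * norm (G t))"
      by (rule primitive_norm_diff_le[OF P order_refl assms integrable_add[OF i] p_le])
    also have "\<dots> = integral {0..T} (\<lambda>t. (c * norm \<eta>)\<^sup>2 * L t) + integral {0..T} (\<lambda>t. (C * (norm \<eta>)\<^sup>2) * norm (G t))"
      by (rule Henstock_Kurzweil_Integration.integral_add[OF i])
    also have "\<dots> = C' * (norm \<eta>)\<^sup>2"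
      by (simp add: C'_def power_mult_distrib algebra_simps)
    finally show ?thesis by (simp add: val_0 grad_0)
  qed
  show ?thesis
  proof (rule has_derivativeI_sandwich[where e=1 and H="\<lambda>y. C' * norm (y - \<xi>)"])
    show "bounded_linear (\<lambda>\<eta>. \<eta> \<bullet> grad \<xi> T)" by (rule bounded_linear_inner_left)
    fix y assume y: "y \<noteq> \<xi>" "dist y \<xi> < 1"
    have "norm (val y T - val \<xi> T - (y - \<xi>) \<bullet> grad \<xi> T) \<le> C' * (norm (y - \<xi>))\<^sup>2"
      using main[of "y - \<xi>"] y by (simp add: dist_norm)
    then show "norm (val y T - val \<xi> T - (y - \<xi>) \<bullet> grad \<xi> T) / norm (y - \<xi>) \<le> C' * norm (y - \<xi>)"
      using y by (simp add: divide_le_eq power2_eq_square mult_ac)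
  next
    have "((\<lambda>y. C' * norm (y - \<xi>)) \<longlongrightarrow> C' * norm (\<xi> - \<xi>)) (at \<xi>)" by (intro tendsto_intros)
    then show "((\<lambda>y. C' * norm (y - \<xi>)) \<longlongrightarrow> 0) (at \<xi>)" by simp
  qed simp
qed

text \<open>
  The only place where the uniform convergence of the payoff gradients enters: by the mean value theorem
  the linearisation error at \<open>0\<close> is at most \<open>norm \<xi>\<close> times the oscillation of the gradient, uniformly in
  time.
\<close>

lemma uniform_value_expansion:
  assumes unif: "((\<lambda>\<xi>. sup_norm (\<lambda>T. grad \<xi> T - grad 0 T)) \<longlongrightarrow> 0) (at 0)" and "0 < e"
  shows "\<exists>d>0. \<forall>\<xi> T. norm \<xi> < d \<longrightarrow> 0 \<le> T \<longrightarrow> \<bar>val \<xi> T - val 0 T - \<xi> \<bullet> grad 0 T\<bar> \<le> e * norm \<xi>"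
proof -
  have "\<forall>\<^sub>F \<xi> in at 0. sup_norm (\<lambda>T. grad \<xi> T - grad 0 T) < ereal e"
    using unif by (rule order_tendstoD) (use \<open>0 < e\<close> in simp)
  then obtain d where "d > 0" and d: "\<And>\<xi>. \<xi> \<noteq> 0 \<Longrightarrow> norm \<xi> < d \<Longrightarrow> sup_norm (\<lambda>T. grad \<xi> T - grad 0 T) < ereal e"
    by (auto simp: eventually_at)
  have close: "norm (grad \<xi> T - grad 0 T) \<le> e" if "norm \<xi> < d" "0 \<le> T" for \<xi> T
  proof (cases "\<xi> = 0")
    case False
    have "ereal (norm (grad \<xi> T - grad 0 T)) \<le> sup_norm (\<lambda>T. grad \<xi> T - grad 0 T)"
      unfolding sup_norm_def by (rule SUP_upper) (use that in simp)
    also have "\<dots> < ereal e" by (rule d[OF False that(1)])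
    finally show ?thesis by simp
  qed (use \<open>0 < e\<close> in simp)
  have "\<bar>val \<xi> T - val 0 T - \<xi> \<bullet> grad 0 T\<bar> \<le> e * norm \<xi>" if \<xi>: "norm \<xi> < d" and T: "0 \<le> T" for \<xi> T
  proof -
    have "norm (val \<xi> T - val 0 T - (\<xi> - 0) \<bullet> grad 0 T) \<le> norm (\<xi> - 0) * e"
    proof (rule differentiable_bound_linearization[where S="ball 0 d" and f'="\<lambda>\<zeta> \<eta>. \<eta> \<bullet> grad \<zeta> T" and a=0])
      show "0 + t *\<^sub>R (\<xi> - 0) \<in> ball 0 d" if "t \<in> {0..1}" for t
        using that \<xi> mult_right_mono[of t 1 "norm \<xi>"] by auto
      show "((\<lambda>\<xi>. val \<xi> T) has_derivative (\<lambda>\<eta>. \<eta> \<bullet> grad \<zeta> T)) (at \<zeta> within ball 0 d)" for \<zeta>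
        by (rule has_derivative_at_withinI[OF val_has_derivative[OF T]])
      show "onorm ((\<lambda>\<eta>. \<eta> \<bullet> grad \<zeta> T) - (\<lambda>\<eta>. \<eta> \<bullet> grad 0 T)) \<le> e" if "\<zeta> \<in> ball 0 d" for \<zeta>
      proof (rule onorm_le)
        fix \<eta>
        have "norm (((\<lambda>\<eta>. \<eta> \<bullet> grad \<zeta> T) - (\<lambda>\<eta>. \<eta> \<bullet> grad 0 T)) \<eta>) \<le> norm \<eta> * norm (grad \<zeta> T - grad 0 T)"
          using Cauchy_Schwarz_ineq2[of \<eta> "grad \<zeta> T - grad 0 T"] by (simp add: inner_diff_right)
        also have "\<dots> \<le> norm \<eta> * e"
          using close[of \<zeta> T] that T by (intro mult_left_mono) auto
        finally show "norm (((\<lambda>\<eta>. \<eta> \<bullet> grad \<zeta> T) - (\<lambda>\<eta>. \<eta> \<bullet> grad 0 T)) \<eta>) \<le> e * norm \<eta>" by (simp add: mult.commute)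
      qed
    qed (use \<open>d > 0\<close> in simp)
    then show ?thesis by (simp add: mult.commute)
  qed
  with \<open>d > 0\<close> show ?thesis by blast
qed

end

section \<open>Needle variations\<close>

definition right_lebesgue_point :: "(real \<Rightarrow> 'a::euclidean_space) \<Rightarrow> real \<Rightarrow> bool" where
  "right_lebesgue_point p s \<longleftrightarrow> ((\<lambda>h. (1 / h) *\<^sub>R integral {s..s + h} p) \<longlongrightarrow> p s) (at_right 0)"

lemma right_lebesgue_point_AE:
  assumes "loc_integrable p"
  shows "AE s in lebesgue_on {0..}. right_lebesgue_point p s"
proof -
  define F where "F = (\<lambda>t. integral {0..t} p)"
  have F: "primitive p F" unfolding F_def by (rule primitive_integral[OF assms])
  show ?thesis
    using primitive_has_vector_derivative_AE[OF F]
  proof eventually_elim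
    case (elim s)
    then have s: "0 < s" "(F has_vector_derivative p s) (at s)" by auto
    from s(2) have "((\<lambda>h. norm (F (s + h) - F s - h *\<^sub>R p s) / norm h) \<longlongrightarrow> 0) (at 0)"
      unfolding has_vector_derivative_def has_derivative_at by simp
    then have lim: "((\<lambda>h. norm (F (s + h) - F s - h *\<^sub>R p s) / norm h) \<longlongrightarrow> 0) (at_right 0)"
      by (rule tendsto_within_subset) simp
    have "((\<lambda>h. (1 / h) *\<^sub>R integral {s..s + h} p - p s) \<longlongrightarrow> 0) (at_right 0)"
    proof (rule Lim_null_comparison[OF _ lim])
      show "\<forall>\<^sub>F h in at_right 0. norm ((1 / h) *\<^sub>R integral {s..s + h} p - p s) \<le> norm (F (s + h) - F s - h *\<^sub>R p s) / norm h"
        using eventually_at_right_less[of 0]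
      proof eventually_elim
        case (elim h)
        have "(1 / h) *\<^sub>R integral {s..s + h} p - p s = (1 / h) *\<^sub>R (F (s + h) - F s - h *\<^sub>R p s)"
          using primitive_diff_eq[OF F, of s "s + h"] s elim by (simp add: scaleR_diff_right)
        then show ?case using elim by simp
      qed
    qed
    then show ?case unfolding right_lebesgue_point_def by (subst (asm) Lim_null[symmetric])
  qed
qed

context reference_control
begin

text \<open>
  The needle lives on the open interval \<open>(s, s + h)\<close>, so that on \<open>[0, s]\<close> and from time \<open>s + h\<close> on,
  endpoints included, the equation is the one for \<open>u0\<close>.
\<close>

definition needle :: "(real \<Rightarrow> 'u) \<Rightarrow> real \<Rightarrow> real \<Rightarrow> real \<Rightarrow> 'u" where
  "needle v s h t = (if s < t \<and> t < s + h then v t else u0 t)"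

lemma needle_selector:
  assumes "v \<in> selectors U"
  shows "needle v s h \<in> selectors U"
proof -
  have "{t \<in> space (restrict_space borel {0..}). s < t \<and> t < s + h} = {s<..<s + h} \<inter> {0..}"
    by (auto simp: space_restrict_space)
  moreover have "{s<..<s + h} \<inter> {0..} \<in> sets (restrict_space borel {0::real..})"
    unfolding sets_restrict_space by (rule image_eqI[where x="{s<..<s + h}"]) auto
  ultimately have "{t \<in> space (restrict_space borel {0..}). s < t \<and> t < s + h} \<in> sets (restrict_space borel {0..})"
    by simp
  moreover have "v \<in> borel_measurable (restrict_space borel {0..})" "u0 \<in> borel_measurable (restrict_space borel {0..})"
    using assms u0 by (simp_all add: selectors_def)
  ultimately have "(\<lambda>t. if s < t \<and> t < s + h then v t else u0 t) \<in> borel_measurable (restrict_space borel {0..})"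
    by (intro measurable_If)
  moreover have "needle v s h t \<in> U t" if "0 \<le> t" for t
    using selectorsD[OF assms that] selectorsD[OF u0 that] by (simp add: needle_def)
  ultimately show ?thesis
    by (simp add: selectors_def needle_def[abs_def])
qed

definition velocity_gap :: "(real \<Rightarrow> 'u) \<Rightarrow> real \<Rightarrow> real ^ 'm" where
  "velocity_gap v t = f t (flow 0 t) (v t) - f t (flow 0 t) (u0 t)"

definition payoff_gap :: "(real \<Rightarrow> 'u) \<Rightarrow> real \<Rightarrow> real" where
  "payoff_gap v t = g t (flow 0 t) (v t) - g t (flow 0 t) (u0 t)"

lemma velocity_gap_loc_integrable: "v \<in> selectors U \<Longrightarrow> loc_integrable (velocity_gap v)"
  unfolding velocity_gap_def by (intro loc_integrable_diff f_loc_integrable u0 flow_continuous)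

lemma payoff_gap_loc_integrable: "v \<in> selectors U \<Longrightarrow> loc_integrable (payoff_gap v)"
  unfolding payoff_gap_def by (intro loc_integrable_diff g_loc_integrable u0 flow_continuous)

text \<open>
  Gronwall's bound for the deviation of the trajectory while the needle acts.
\<close>

definition needle_bound :: "(real \<Rightarrow> 'u) \<Rightarrow> real \<Rightarrow> real \<Rightarrow> real" where
  "needle_bound v s h = integral {s..s + h} (\<lambda>t. norm (velocity_gap v t)) * exp (cumulative_lip (s + h) - cumulative_lip s)"

abbreviation needle_traj :: "(real \<Rightarrow> 'u) \<Rightarrow> real \<Rightarrow> real \<Rightarrow> real \<Rightarrow> real ^ 'm" where
  "needle_traj v s h \<equiv> trajectory f (needle v s h) 0"

text \<open>
  All four facts compare the perturbed trajectory with a trajectory of \<open>u0\<close> by Gronwall's inequality;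
  only while the needle acts is there an inhomogeneity, the velocity gap.
\<close>

lemma
  assumes v: "v \<in> selectors U" and "0 \<le> s" "0 < h"
  shows needle_before: "t \<in> {0..s} \<Longrightarrow> needle_traj v s h t = flow 0 t"
    and needle_during: "t \<in> {s..s + h} \<Longrightarrow> norm (needle_traj v s h t - flow 0 t) \<le> needle_bound v s h"
    and needle_end: "norm (needle_traj v s h (s + h) - flow 0 (s + h) - integral {s..s + h} (velocity_gap v))
        \<le> integral {s..s + h} lip * needle_bound v s h"
    and needle_after: "flow \<xi> (s + h) = needle_traj v s h (s + h) \<Longrightarrow> s + h \<le> t \<Longrightarrow> needle_traj v s h t = flow \<xi> t"
proof -
  define u where "u = needle v s h"
  define x where "x = needle_traj v s h"
  have u: "u \<in> selectors U" unfolding u_def by (rule needle_selector[OF v])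
  have x: "primitive (\<lambda>t. f t (x t) (u t)) x" "x 0 = 0"
    unfolding x_def u_def using trajectory_primitive[OF needle_selector[OF v]] trajectory_0[OF needle_selector[OF v]] by auto
  define p where "p \<xi> t = f t (x t) (u t) - f t (flow \<xi> t) (u0 t)" for \<xi> t
  have P: "primitive (p \<xi>) (\<lambda>t. x t - flow \<xi> t)" for \<xi>
    unfolding p_def by (intro primitive_diff x flow_primitive)
  have p_le: "norm (p \<xi> t) \<le> lip t * norm (x t - flow \<xi> t) + 0" if "0 \<le> t" "t \<le> s \<or> s + h \<le> t" for t \<xi>
    using f_lipschitz[OF that(1) selectorsD[OF u0 that(1)]] that(2) \<open>0 < h\<close> by (auto simp: p_def u_def needle_def)
  have before: "x t = flow 0 t" if t: "t \<in> {0..s}" for t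
  proof -
    have "norm (x t - flow 0 t) \<le> (norm (x 0 - flow 0 0) + integral {0..s} (\<lambda>r. 0)) * exp (cumulative_lip s - cumulative_lip 0)"
      by (rule gronwall_forward[OF P primitive_cumulative_lip lip_nonneg]) (use p_le t in auto)
    then show ?thesis by (simp add: x flow_0)
  qed
  then show "t \<in> {0..s} \<Longrightarrow> needle_traj v s h t = flow 0 t" by (simp add: x_def)
  show "needle_traj v s h t = flow \<xi> t" if eq: "flow \<xi> (s + h) = needle_traj v s h (s + h)" and t: "s + h \<le> t"
  proof -
    have "norm (x t - flow \<xi> t) \<le> (norm (x (s + h) - flow \<xi> (s + h)) + integral {s + h..t} (\<lambda>r. 0)) * exp (cumulative_lip t - cumulative_lip (s + h))"
      by (rule gronwall_forward[OF P primitive_cumulative_lip lip_nonneg]) (use p_le assms t in auto)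
    then show ?thesis using eq by (simp add: x_def)
  qed
  have gap_int: "(\<lambda>t. norm (velocity_gap v t)) integrable_on {s..s + h}"
    by (rule loc_integrable_integrable[OF loc_integrable_norm[OF velocity_gap_loc_integrable[OF v]] \<open>0 \<le> s\<close>])
  have during: "norm (x t - flow 0 t) \<le> needle_bound v s h" if t: "t \<in> {s..s + h}" for t
  proof -
    have "norm (x t - flow 0 t) \<le> (norm (x s - flow 0 s) + integral {s..s + h} (\<lambda>t. norm (velocity_gap v t))) * exp (cumulative_lip (s + h) - cumulative_lip s)"
    proof (rule gronwall_forward[OF P primitive_cumulative_lip lip_nonneg gap_int])
      fix r assume r: "r \<in> {s..s + h}"
      then have "0 \<le> r" using \<open>0 \<le> s\<close> by simp
      show "norm (p 0 r) \<le> lip r * norm (x r - flow 0 r) + norm (velocity_gap v r)"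
      proof (cases "s < r \<and> r < s + h")
        case True
        then have "p 0 r = (f r (x r) (v r) - f r (flow 0 r) (v r)) + velocity_gap v r"
          by (simp add: p_def u_def needle_def velocity_gap_def)
        then show ?thesis
          using f_lipschitz[OF \<open>0 \<le> r\<close> selectorsD[OF v \<open>0 \<le> r\<close>], of "x r" "flow 0 r"]
            norm_triangle_ineq[of "f r (x r) (v r) - f r (flow 0 r) (v r)" "velocity_gap v r"] by simp
      next
        case False
        then have "r \<le> s \<or> s + h \<le> r" by auto
        from p_le[OF \<open>0 \<le> r\<close> this, of 0] show ?thesis using norm_ge_zero[of "velocity_gap v r"] by linarith
      qed
    qed (use assms t in auto)
    then show ?thesis using before[of s] \<open>0 \<le> s\<close> by (simp add: needle_bound_def)
  qed
  then show "t \<in> {s..s + h} \<Longrightarrow> norm (needle_traj v s h t - flow 0 t) \<le> needle_bound v s h" by (simp add: x_def)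
  show "norm (needle_traj v s h (s + h) - flow 0 (s + h) - integral {s..s + h} (velocity_gap v))
        \<le> integral {s..s + h} lip * needle_bound v s h"
  proof -
    define q where "q t = f t (x t) (v t) - f t (flow 0 t) (v t)" for t
    have q: "loc_integrable q"
      unfolding q_def by (intro loc_integrable_diff f_loc_integrable v flow_continuous primitive_continuous_on[OF x(1)])
    note int = loc_integrable_integrable[OF _ \<open>0 \<le> s\<close>]
    have "x (s + h) - flow 0 (s + h) = integral {s..s + h} (p 0)"
      using primitive_diff_eq[OF P[of 0], of s "s + h"] before[of s] assms by simp
    also have "\<dots> = integral {s..s + h} (\<lambda>t. q t + velocity_gap v t)"
      by (rule integral_spike[of "{s, s + h}"]) (auto simp: p_def u_def needle_def q_def velocity_gap_def)
    also have "\<dots> = integral {s..s + h} q + integral {s..s + h} (velocity_gap v)"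
      by (rule Henstock_Kurzweil_Integration.integral_add[OF int[OF q] int[OF velocity_gap_loc_integrable[OF v]]])
    finally have "x (s + h) - flow 0 (s + h) - integral {s..s + h} (velocity_gap v) = integral {s..s + h} q" by simp
    also have "norm \<dots> \<le> integral {s..s + h} (\<lambda>t. lip t * needle_bound v s h)"
    proof (rule integral_norm_bound_integral[OF int[OF q]])
      show "(\<lambda>t. lip t * needle_bound v s h) integrable_on {s..s + h}"
        using int[OF loc_integrable_cmult[OF lip_loc_integrable, of "needle_bound v s h"]] by (simp add: mult.commute)
      fix t assume t: "t \<in> {s..s + h}"
      then have "0 \<le> t" using \<open>0 \<le> s\<close> by simp
      have "norm (q t) \<le> lip t * norm (x t - flow 0 t)"
        unfolding q_def by (rule f_lipschitz[OF \<open>0 \<le> t\<close> selectorsD[OF v \<open>0 \<le> t\<close>]])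
      also have "\<dots> \<le> lip t * needle_bound v s h"
        by (rule mult_left_mono[OF during[OF t] lip_nonneg[OF \<open>0 \<le> t\<close>]])
      finally show "norm (q t) \<le> lip t * needle_bound v s h" .
    qed
    also have "\<dots> = integral {s..s + h} lip * needle_bound v s h" by (rule integral_mult_left)
    finally show ?thesis by (simp add: x_def)
  qed
qed

text \<open>
  The payoff difference is split at \<open>s\<close> and \<open>s + h\<close>: it vanishes before the needle, and after it the
  perturbed trajectory is the one of \<open>u0\<close> started at \<open>\<xi>\<close>.
\<close>

lemma needle_payoff:
  assumes v: "v \<in> selectors U" and "0 \<le> s" "0 < h" and \<xi>: "flow \<xi> (s + h) = needle_traj v s h (s + h)"
    and T: "s + h \<le> T"
  shows "payoff f g T (needle v s h) - payoff f g T u0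
    = integral {s..s + h} (\<lambda>t. g t (needle_traj v s h t) (v t) - g t (flow 0 t) (u0 t))
      + (val \<xi> T - val 0 T) - (val \<xi> (s + h) - val 0 (s + h))"
proof -
  define u where "u = needle v s h"
  define x where "x = needle_traj v s h"
  have u: "u \<in> selectors U" unfolding u_def by (rule needle_selector[OF v])
  have xc: "continuous_on {0..} x" unfolding x_def by (rule trajectory_continuous[OF needle_selector[OF v]])
  define q where "q t = g t (x t) (u t) - g t (flow 0 t) (u0 t)" for t
  define Q where "Q t = integral {0..t} q" for t
  have q: "loc_integrable q" unfolding q_def by (intro loc_integrable_diff g_loc_integrable u u0 xc flow_continuous)
  have Q: "primitive q Q" unfolding Q_def by (rule primitive_integral[OF q])
  have "0 \<le> T" "0 \<le> s + h" using assms by auto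
  have "payoff f g T u - payoff f g T u0 = integral {0..T} (\<lambda>t. g t (x t) (u t)) - integral {0..T} (\<lambda>t. g t (flow 0 t) (u0 t))"
    using payoff_eq_integral[OF u \<open>0 \<le> T\<close>] payoff_eq_integral[OF u0 \<open>0 \<le> T\<close>] by (simp add: x_def u_def)
  also have "\<dots> = integral {0..T} q"
    unfolding q_def
    by (rule Henstock_Kurzweil_Integration.integral_diff[symmetric];
        intro loc_integrable_integrable g_loc_integrable u u0 xc flow_continuous order_refl)
  also have "\<dots> = (Q s - Q 0) + (Q (s + h) - Q s) + (Q T - Q (s + h))" by (simp add: Q_def)
  also have "Q s - Q 0 = 0"
  proof -
    have "integral {0..s} q = integral {0..s} (\<lambda>t. 0)"
      by (rule Henstock_Kurzweil_Integration.integral_cong)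
         (use needle_before[OF assms(1-3)] in \<open>auto simp: q_def x_def u_def needle_def\<close>)
    then show ?thesis by (simp add: Q_def)
  qed
  also have "Q (s + h) - Q s = integral {s..s + h} (\<lambda>t. g t (x t) (v t) - g t (flow 0 t) (u0 t))"
  proof -
    have "Q (s + h) - Q s = integral {s..s + h} q"
      by (rule primitive_diff_eq[OF Q]) (use assms in auto)
    also have "\<dots> = integral {s..s + h} (\<lambda>t. g t (x t) (v t) - g t (flow 0 t) (u0 t))"
      by (rule integral_spike[of "{s, s + h}"]) (auto simp: q_def u_def needle_def)
    finally show ?thesis .
  qed
  also have "Q T - Q (s + h) = (val \<xi> T - val 0 T) - (val \<xi> (s + h) - val 0 (s + h))"
  proof -
    have "Q T - Q (s + h) = integral {s + h..T} q"
      by (rule primitive_diff_eq[OF Q]) (use assms in auto)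
    also have "\<dots> = integral {s + h..T} (\<lambda>t. g t (flow \<xi> t) (u0 t) - g t (flow 0 t) (u0 t))"
      by (rule Henstock_Kurzweil_Integration.integral_cong)
         (use needle_after[OF assms(1-3) \<xi>] in \<open>auto simp: q_def x_def u_def needle_def\<close>)
    also have "\<dots> = (val \<xi> T - val 0 T) - (val \<xi> (s + h) - val 0 (s + h))"
      by (rule primitive_diff_eq[OF primitive_diff[OF val_primitive val_primitive], symmetric]) (use assms in auto)
    finally show ?thesis .
  qed
  finally show ?thesis by (simp add: x_def u_def)
qed

text \<open>
  First-order expansion in the length \<open>h\<close> of the needle at a point \<open>s\<close> where all relevant integrals are
  differentiable from the right. The deviation at time \<open>s + h\<close> is \<open>h\<close> times the velocity gap up to
  \<open>o(h)\<close>; pulled back to time \<open>0\<close> it is the displacement \<open>\<xi> h\<close> of the initial point, with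
  \<open>\<xi> h / h\<close> converging to the vector \<open>w\<close> below.
\<close>

lemma needle_inequality_at:
  assumes v: "v \<in> selectors U" and "0 \<le> s"
    and opt: "\<And>e. 0 < e \<Longrightarrow> \<exists>T. \<forall>u\<in>selectors U. \<forall>t\<ge>T. payoff f g t u - e \<le> payoff f g t u0"
    and unif: "((\<lambda>\<xi>. sup_norm (\<lambda>T. grad \<xi> T - grad 0 T)) \<longlongrightarrow> 0) (at 0)"
    and \<tau>: "filterlim \<tau> at_top sequentially" and lim: "(\<lambda>n. grad 0 (\<tau> n)) \<longlonglongrightarrow> Istar"
    and rate_f: "right_lebesgue_point (velocity_gap v) s" and rate_g: "right_lebesgue_point (payoff_gap v) s"
    and rate_norm: "right_lebesgue_point (\<lambda>t. norm (velocity_gap v t)) s" and rate_lip: "right_lebesgue_point lip s"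
    and rate_L: "right_lebesgue_point L s" and L: "loc_integrable L" "\<And>t. 0 \<le> t \<Longrightarrow> 0 \<le> L t"
    and g_lip: "\<And>t y p. t \<in> {s..s + 1} \<Longrightarrow> norm (y - flow 0 t) \<le> 1 \<Longrightarrow> p \<in> U t \<Longrightarrow>
      norm (g t y p - g t (flow 0 t) p) \<le> L t * norm (y - flow 0 t)"
  shows "payoff_gap v s + (inverse_fund 0 s *v velocity_gap v s) \<bullet> (Istar - grad 0 s) \<le> 0"
proof -
  let ?F = "at_right (0::real)"
  define x where "x h = needle_traj v s h" for h
  define Y where "Y h = needle_bound v s h" for h
  define q where "q h = x h (s + h) - flow 0 (s + h)" for h
  define w where "w = inverse_fund 0 s *v velocity_gap v s"
  have h_pos: "\<forall>\<^sub>F h in ?F. 0 < h \<and> h < 1"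
    using eventually_at_right_less[of "0::real"] eventually_at_right_field[of _ "0::real"]
    by (auto simp: eventually_at_right_field intro: exI[of _ 1])
  have "\<forall>h. \<exists>\<xi>. 0 < h \<longrightarrow> flow \<xi> (s + h) = x h (s + h)"
    using flow_through \<open>0 \<le> s\<close> by (metis add_nonneg_nonneg less_imp_le)
  then obtain \<xi> where \<xi>: "\<And>h. 0 < h \<Longrightarrow> flow (\<xi> h) (s + h) = x h (s + h)" by metis
  have shift: "((\<lambda>h. F (s + h)) \<longlongrightarrow> F s) ?F" if "continuous_on {0..} F" for F :: "real \<Rightarrow> 'z::topological_space"
  proof (rule continuous_on_tendsto_compose[OF that])
    have "((\<lambda>h. s + h) \<longlongrightarrow> s + 0) ?F" by (intro tendsto_intros)
    then show "((\<lambda>h. s + h) \<longlongrightarrow> s) ?F" by simp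
    show "\<forall>\<^sub>F h in ?F. s + h \<in> {0..}" using h_pos by eventually_elim (use \<open>0 \<le> s\<close> in simp)
  qed (use \<open>0 \<le> s\<close> in simp)
  have h0: "((\<lambda>h. h) \<longlongrightarrow> 0) ?F" by (rule tendsto_ident_at)
  \<comment> \<open>The deviation on the needle is of order \<open>h\<close>.\<close>
  have Y_rate: "((\<lambda>h. Y h / h) \<longlongrightarrow> norm (velocity_gap v s)) ?F"
  proof -
    have "((\<lambda>h. ((1 / h) *\<^sub>R integral {s..s + h} (\<lambda>t. norm (velocity_gap v t))) * exp (cumulative_lip (s + h) - cumulative_lip s))
        \<longlongrightarrow> norm (velocity_gap v s) * exp (cumulative_lip s - cumulative_lip s)) ?F"
      using rate_norm unfolding right_lebesgue_point_def
      by (intro tendsto_intros shift primitive_continuous_on[OF primitive_cumulative_lip])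
    then show ?thesis by (simp add: Y_def needle_bound_def)
  qed
  have small: "((\<lambda>h. h * k h) \<longlongrightarrow> 0) ?F" if "(k \<longlongrightarrow> c) ?F" for k :: "real \<Rightarrow> real" and c
    using tendsto_mult[OF h0 that] by simp
  have Y_0: "(Y \<longlongrightarrow> 0) ?F"
    by (rule Lim_transform_eventually[OF small[OF Y_rate]])
       (use h_pos in \<open>eventually_elim, simp\<close>)
  have q_rate: "((\<lambda>h. (1 / h) *\<^sub>R q h) \<longlongrightarrow> velocity_gap v s) ?F"
  proof -
    have "((\<lambda>h. (1 / h) *\<^sub>R (q h - integral {s..s + h} (velocity_gap v))) \<longlongrightarrow> 0) ?F"
    proof (rule Lim_null_comparison)
      show "\<forall>\<^sub>F h in ?F. norm ((1 / h) *\<^sub>R (q h - integral {s..s + h} (velocity_gap v))) \<le> ((1 / h) *\<^sub>R integral {s..s + h} lip) * Y h"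
        using h_pos
      proof eventually_elim
        case (elim h)
        have "norm (q h - integral {s..s + h} (velocity_gap v)) \<le> integral {s..s + h} lip * Y h"
          using needle_end[OF v \<open>0 \<le> s\<close>, of h] elim by (simp add: q_def x_def Y_def)
        then have "norm (q h - integral {s..s + h} (velocity_gap v)) / h \<le> integral {s..s + h} lip * Y h / h"
          using elim by (intro divide_right_mono) auto
        then show ?case using elim by simp
      qed
      show "((\<lambda>h. ((1 / h) *\<^sub>R integral {s..s + h} lip) * Y h) \<longlongrightarrow> 0) ?F"
        using tendsto_mult[OF rate_lip[unfolded right_lebesgue_point_def] Y_0] by simp
    qed
    from tendsto_add[OF this rate_f[unfolded right_lebesgue_point_def]] show ?thesis
      by (simp add: scaleR_diff_right)
  qed
  \<comment> \<open>The initial point of the shifted trajectory, to first order.\<close>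
  define c where "c = exp (cumulative_lip (s + 1))"
  have \<xi>_le: "\<forall>\<^sub>F h in ?F. norm (\<xi> h) \<le> norm (q h) * c"
    using h_pos
  proof eventually_elim
    case (elim h)
    have "norm (flow (\<xi> h) 0 - flow 0 0) \<le> norm (flow (\<xi> h) (s + h) - flow 0 (s + h)) * exp (cumulative_lip (s + h))"
      by (rule flow_dist_backward) (use elim \<open>0 \<le> s\<close> in auto)
    then have "norm (\<xi> h) \<le> norm (q h) * exp (cumulative_lip (s + h))"
      using \<xi>[of h] elim by (simp add: flow_0 q_def)
    also have "\<dots> \<le> norm (q h) * c"
      using primitive_mono[OF primitive_cumulative_lip, of "s + h" "s + 1"] lip_nonneg elim \<open>0 \<le> s\<close>
      by (intro mult_left_mono) (auto simp: c_def)
    finally show ?case .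
  qed
  have q_norm: "((\<lambda>h. norm (q h) / h) \<longlongrightarrow> norm (velocity_gap v s)) ?F"
    by (rule Lim_transform_eventually[OF tendsto_norm[OF q_rate]]) (use h_pos in \<open>eventually_elim, simp\<close>)
  have q_0: "((\<lambda>h. norm (q h)) \<longlongrightarrow> 0) ?F"
    by (rule Lim_transform_eventually[OF small[OF q_norm]])
       (use h_pos in \<open>eventually_elim, simp\<close>)
  have \<xi>_0: "(\<xi> \<longlongrightarrow> 0) ?F"
    by (rule Lim_null_comparison[OF \<xi>_le]) (use tendsto_mult_right[OF q_0, of c] in simp)
  have \<xi>_small: "\<forall>\<^sub>F h in ?F. norm (\<xi> h) < d" if "0 < d" for d
    using tendsto_norm[OF \<xi>_0] that by (intro order_tendstoD(2)) auto
  obtain C where C: "0 \<le> C" "\<And>\<eta> t. norm \<eta> \<le> 1 \<Longrightarrow> t \<in> {0..s + 1} \<Longrightarrow> norm (flow (0 + \<eta>) t - flow 0 t - fund 0 t *v \<eta>) \<le> C * (norm \<eta>)\<^sup>2"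
    using flow_expansion[of "s + 1" 0] \<open>0 \<le> s\<close> by auto
  have \<xi>_rate: "((\<lambda>h. (1 / h) *\<^sub>R \<xi> h) \<longlongrightarrow> w) ?F"
  proof -
    have "((\<lambda>h. (1 / h) *\<^sub>R (q h - fund 0 (s + h) *v \<xi> h)) \<longlongrightarrow> 0) ?F"
    proof (rule Lim_null_comparison)
      show "\<forall>\<^sub>F h in ?F. norm ((1 / h) *\<^sub>R (q h - fund 0 (s + h) *v \<xi> h)) \<le> C * c\<^sup>2 * (norm (q h) * (norm (q h) / h))"
        using h_pos \<xi>_small[OF zero_less_one] \<xi>_le
      proof eventually_elim
        case (elim h)
        have "norm (q h - fund 0 (s + h) *v \<xi> h) \<le> C * (norm (\<xi> h))\<^sup>2"
          using C(2)[of "\<xi> h" "s + h"] elim \<xi>[of h] \<open>0 \<le> s\<close> by (simp add: q_def)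
        also have "\<dots> \<le> C * (norm (q h) * c)\<^sup>2"
          using elim C(1) by (intro mult_left_mono power_mono) auto
        finally have "norm (q h - fund 0 (s + h) *v \<xi> h) / h \<le> C * (norm (q h) * c)\<^sup>2 / h"
          using elim by (intro divide_right_mono) auto
        then show ?case using elim by (simp add: power2_eq_square mult_ac)
      qed
      show "((\<lambda>h. C * c\<^sup>2 * (norm (q h) * (norm (q h) / h))) \<longlongrightarrow> 0) ?F"
        using tendsto_mult_left[OF tendsto_mult[OF q_0 q_norm], of "C * c\<^sup>2"] by simp
    qed
    from tendsto_diff[OF q_rate this]
    have 1: "((\<lambda>h. (1 / h) *\<^sub>R (fund 0 (s + h) *v \<xi> h)) \<longlongrightarrow> velocity_gap v s) ?F"
      by (simp add: scaleR_diff_right)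
    have "((\<lambda>h. inverse_fund 0 (s + h) *v ((1 / h) *\<^sub>R (fund 0 (s + h) *v \<xi> h))) \<longlongrightarrow> w) ?F"
      unfolding w_def
      by (rule bounded_bilinear.tendsto[OF bounded_bilinear_matrix_vector shift[OF primitive_continuous_on[OF inverse_fund_primitive]] 1])
    then show ?thesis
    proof (rule Lim_transform_eventually)
      show "\<forall>\<^sub>F h in ?F. inverse_fund 0 (s + h) *v ((1 / h) *\<^sub>R (fund 0 (s + h) *v \<xi> h)) = (1 / h) *\<^sub>R \<xi> h"
        using h_pos
      proof eventually_elim
        case (elim h)
        then have "inverse_fund 0 (s + h) ** fund 0 (s + h) = mat 1"
          using \<open>0 \<le> s\<close> by (intro inverse_fund_left) auto
        then show ?case
          by (simp add: matrix_vector_mult_scaleR matrix_vector_mul_assoc)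
      qed
    qed
  qed
  \<comment> \<open>The direct gain on the needle, to first order.\<close>
  define gain where "gain h = integral {s..s + h} (\<lambda>t. g t (x h t) (v t) - g t (flow 0 t) (u0 t))" for h
  have gain_rate: "((\<lambda>h. gain h / h) \<longlongrightarrow> payoff_gap v s) ?F"
  proof -
    have "((\<lambda>h. (gain h - integral {s..s + h} (payoff_gap v)) / h) \<longlongrightarrow> 0) ?F"
    proof (rule Lim_null_comparison)
      have "\<forall>\<^sub>F h in ?F. Y h < 1" using Y_0 by (rule order_tendstoD) simp
      with h_pos show "\<forall>\<^sub>F h in ?F. norm ((gain h - integral {s..s + h} (payoff_gap v)) / h) \<le> ((1 / h) *\<^sub>R integral {s..s + h} L) * Y h"
      proof eventually_elim
        case (elim h)
        note int = loc_integrable_integrable[OF _ \<open>0 \<le> s\<close>]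
        have xc: "continuous_on {0..} (x h)" unfolding x_def by (rule trajectory_continuous[OF needle_selector[OF v]])
        have i1: "(\<lambda>t. g t (x h t) (v t) - g t (flow 0 t) (u0 t)) integrable_on {s..s + h}"
          by (intro int loc_integrable_diff g_loc_integrable v u0 xc flow_continuous)
        have i2: "(\<lambda>t. g t (x h t) (v t) - g t (flow 0 t) (v t)) integrable_on {s..s + h}"
          by (intro int loc_integrable_diff g_loc_integrable v u0 xc flow_continuous)
        have "gain h - integral {s..s + h} (payoff_gap v) = integral {s..s + h} (\<lambda>t. (g t (x h t) (v t) - g t (flow 0 t) (u0 t)) - payoff_gap v t)"
          unfolding gain_def
          by (rule Henstock_Kurzweil_Integration.integral_diff[symmetric, OF i1 int[OF payoff_gap_loc_integrable[OF v]]])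
        also have "\<dots> = integral {s..s + h} (\<lambda>t. g t (x h t) (v t) - g t (flow 0 t) (v t))"
          by (simp add: payoff_gap_def)
        also have "norm \<dots> \<le> integral {s..s + h} (\<lambda>t. L t * Y h)"
        proof (rule integral_norm_bound_integral[OF i2])
          show "(\<lambda>t. L t * Y h) integrable_on {s..s + h}"
            using int[OF loc_integrable_cmult[OF L(1), of "Y h"]] by (simp add: mult.commute)
          fix t assume t: "t \<in> {s..s + h}"
          then have "0 \<le> t" using \<open>0 \<le> s\<close> by simp
          have d: "norm (x h t - flow 0 t) \<le> Y h"
            using needle_during[OF v \<open>0 \<le> s\<close> _ t] elim by (simp add: x_def Y_def)
          have "norm (g t (x h t) (v t) - g t (flow 0 t) (v t)) \<le> L t * norm (x h t - flow 0 t)"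
            by (rule g_lip) (use t d elim selectorsD[OF v \<open>0 \<le> t\<close>] in auto)
          also have "\<dots> \<le> L t * Y h" by (rule mult_left_mono[OF d L(2)[OF \<open>0 \<le> t\<close>]])
          finally show "norm (g t (x h t) (v t) - g t (flow 0 t) (v t)) \<le> L t * Y h" .
        qed
        also have "\<dots> = integral {s..s + h} L * Y h" by (rule integral_mult_left)
        finally have "norm (gain h - integral {s..s + h} (payoff_gap v)) / h \<le> integral {s..s + h} L * Y h / h"
          using elim by (intro divide_right_mono) auto
        then show ?case using elim by simp
      qed
      show "((\<lambda>h. ((1 / h) *\<^sub>R integral {s..s + h} L) * Y h) \<longlongrightarrow> 0) ?F"
        using tendsto_mult[OF rate_L[unfolded right_lebesgue_point_def] Y_0] by simp
    qed
    from tendsto_add[OF this rate_g[unfolded right_lebesgue_point_def]] show ?thesis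
      by (simp add: diff_divide_distrib)
  qed
  \<comment> \<open>For fixed \<open>h\<close> the horizon goes to infinity along \<open>\<tau>\<close>; the error \<open>e\<close> of the payoff expansion enters twice, at the horizon and at \<open>s + h\<close>.\<close>
  have bound: "payoff_gap v s + w \<bullet> (Istar - grad 0 s) \<le> 2 * e * norm w" if "0 < e" for e
  proof -
    note e = that
    obtain d where "0 < d" and d: "\<And>\<xi> T. norm \<xi> < d \<Longrightarrow> 0 \<le> T \<Longrightarrow> \<bar>val \<xi> T - val 0 T - \<xi> \<bullet> grad 0 T\<bar> \<le> e * norm \<xi>"
      using uniform_value_expansion[OF unif e] by blast
    have ineq: "\<forall>\<^sub>F h in ?F. gain h / h + ((1 / h) *\<^sub>R \<xi> h) \<bullet> (Istar - grad 0 (s + h)) \<le> 2 * e * norm ((1 / h) *\<^sub>R \<xi> h)"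
      using h_pos \<xi>_small[OF \<open>0 < d\<close>]
    proof eventually_elim
      case (elim h)
      have "(\<lambda>n. gain h + (\<xi> h \<bullet> grad 0 (\<tau> n) - e * norm (\<xi> h)) - (\<xi> h \<bullet> grad 0 (s + h) + e * norm (\<xi> h)))
          \<longlonglongrightarrow> gain h + (\<xi> h \<bullet> Istar - e * norm (\<xi> h)) - (\<xi> h \<bullet> grad 0 (s + h) + e * norm (\<xi> h))"
        by (intro tendsto_intros lim)
      moreover have "\<exists>N. \<forall>n\<ge>N. gain h + (\<xi> h \<bullet> grad 0 (\<tau> n) - e * norm (\<xi> h)) - (\<xi> h \<bullet> grad 0 (s + h) + e * norm (\<xi> h)) \<le> \<delta>" if "0 < \<delta>" for \<delta>
      proof -
        obtain T where T: "\<And>u t. u\<in>selectors U \<Longrightarrow> T \<le> t \<Longrightarrow> payoff f g t u - \<delta> \<le> payoff f g t u0"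
          using opt[OF \<open>0 < \<delta>\<close>] by blast
        have "\<forall>\<^sub>F n in sequentially. max T (s + h) \<le> \<tau> n"
          using \<tau> unfolding filterlim_at_top by blast
        then obtain N where N: "\<And>n. n \<ge> N \<Longrightarrow> max T (s + h) \<le> \<tau> n" by (auto simp: eventually_sequentially)
        have "gain h + (\<xi> h \<bullet> grad 0 (\<tau> n) - e * norm (\<xi> h)) - (\<xi> h \<bullet> grad 0 (s + h) + e * norm (\<xi> h)) \<le> \<delta>" if "N \<le> n" for n
        proof -
          have n: "T \<le> \<tau> n" "s + h \<le> \<tau> n" using N[OF that] by auto
          have "payoff f g (\<tau> n) (needle v s h) - payoff f g (\<tau> n) u0 = gain h + (val (\<xi> h) (\<tau> n) - val 0 (\<tau> n)) - (val (\<xi> h) (s + h) - val 0 (s + h))"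
            unfolding gain_def x_def using elim \<xi>[of h]
            by (intro needle_payoff[OF v \<open>0 \<le> s\<close>] n) (auto simp: x_def)
          moreover have "payoff f g (\<tau> n) (needle v s h) - \<delta> \<le> payoff f g (\<tau> n) u0"
            by (rule T[OF needle_selector[OF v] n(1)])
          moreover have "\<bar>val (\<xi> h) (\<tau> n) - val 0 (\<tau> n) - \<xi> h \<bullet> grad 0 (\<tau> n)\<bar> \<le> e * norm (\<xi> h)"
            by (rule d) (use elim n \<open>0 \<le> s\<close> in auto)
          moreover have "\<bar>val (\<xi> h) (s + h) - val 0 (s + h) - \<xi> h \<bullet> grad 0 (s + h)\<bar> \<le> e * norm (\<xi> h)"
            by (rule d) (use elim \<open>0 \<le> s\<close> in auto)
          ultimately show ?thesis by linarith
        qed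
        then show ?thesis by blast
      qed
      ultimately have "gain h + (\<xi> h \<bullet> Istar - e * norm (\<xi> h)) - (\<xi> h \<bullet> grad 0 (s + h) + e * norm (\<xi> h)) \<le> \<delta>" if "0 < \<delta>" for \<delta>
        using LIMSEQ_le_const2 that by blast
      then have "gain h + (\<xi> h \<bullet> Istar - e * norm (\<xi> h)) - (\<xi> h \<bullet> grad 0 (s + h) + e * norm (\<xi> h)) \<le> 0"
        by (rule field_le_epsilon[where y=0, simplified])
      then have "gain h + \<xi> h \<bullet> (Istar - grad 0 (s + h)) \<le> 2 * e * norm (\<xi> h)"
        by (simp add: inner_diff_right)
      then have "(gain h + \<xi> h \<bullet> (Istar - grad 0 (s + h))) / h \<le> (2 * e * norm (\<xi> h)) / h"
        using elim by (intro divide_right_mono) auto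
      then show ?case using elim by (simp add: add_divide_distrib)
    qed
    show ?thesis
    proof (rule tendsto_le[OF _ _ _ ineq])
      show "((\<lambda>h. 2 * e * norm ((1 / h) *\<^sub>R \<xi> h)) \<longlongrightarrow> 2 * e * norm w) ?F"
        by (intro tendsto_intros \<xi>_rate)
      show "((\<lambda>h. gain h / h + ((1 / h) *\<^sub>R \<xi> h) \<bullet> (Istar - grad 0 (s + h))) \<longlongrightarrow> payoff_gap v s + w \<bullet> (Istar - grad 0 s)) ?F"
        by (intro tendsto_add gain_rate tendsto_inner \<xi>_rate tendsto_diff tendsto_const shift primitive_continuous_on[OF grad_primitive])
    qed simp
  qed
  have "payoff_gap v s + w \<bullet> (Istar - grad 0 s) \<le> 0 + \<delta>" if "0 < \<delta>" for \<delta>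
  proof -
    define e where "e = \<delta> / (2 * (norm w + 1))"
    have "0 < norm w + 1" by (simp add: add_nonneg_pos)
    then have "0 < e" and "2 * e * norm w \<le> \<delta>"
      using that by (auto simp: e_def field_simps)
    with bound[OF \<open>0 < e\<close>] show ?thesis by simp
  qed
  then have "payoff_gap v s + w \<bullet> (Istar - grad 0 s) \<le> 0" by (rule field_le_epsilon)
  then show ?thesis by (simp add: w_def)
qed

text \<open>
  The Lipschitz rate of \<open>g\<close> depends on the time horizon, so one rate is fixed for every natural horizon
  and \<open>s\<close> is taken to be a right Lebesgue point of all of them.
\<close>

lemma needle_inequality_AE:
  assumes v: "v \<in> selectors U"
    and opt: "\<And>e. 0 < e \<Longrightarrow> \<exists>T. \<forall>u\<in>selectors U. \<forall>t\<ge>T. payoff f g t u - e \<le> payoff f g t u0"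
    and unif: "((\<lambda>\<xi>. sup_norm (\<lambda>T. grad \<xi> T - grad 0 T)) \<longlongrightarrow> 0) (at 0)"
    and \<tau>: "filterlim \<tau> at_top sequentially" and lim: "(\<lambda>n. grad 0 (\<tau> n)) \<longlonglongrightarrow> Istar"
  shows "AE s in lebesgue_on {0..}. payoff_gap v s + (inverse_fund 0 s *v velocity_gap v s) \<bullet> (Istar - grad 0 s) \<le> 0"
proof -
  have "\<exists>L. loc_integrable L \<and> (\<forall>t\<ge>0. 0 \<le> L t) \<and> (\<forall>t\<in>{0..real N}. \<forall>y p. norm (y - flow 0 t) \<le> 1 \<longrightarrow> p \<in> U t \<longrightarrow>
      norm (g t y p - g t (flow 0 t) p) \<le> L t * norm (y - flow 0 t))" for N
  proof -
    have "bounded (flow 0 ` {0..real N})"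
      by (intro compact_imp_bounded compact_continuous_image continuous_on_subset[OF flow_continuous]) auto
    then obtain R where R: "\<And>t. t \<in> {0..real N} \<Longrightarrow> norm (flow 0 t) \<le> R" unfolding bounded_iff by blast
    have "locally_lipschitz U g" using condition_fg by (simp add: condition_fg_def)
    then obtain L where L: "loc_integrable L" "\<And>t. 0 \<le> t \<Longrightarrow> 0 \<le> L t"
      "\<And>t y z p. t \<in> {0..real N} \<Longrightarrow> y \<in> cball 0 (R + 1) \<Longrightarrow> z \<in> cball 0 (R + 1) \<Longrightarrow> p \<in> U t \<Longrightarrow> norm (g t y p - g t z p) \<le> L t * norm (y - z)"
      using lipschitz_on_tube[of U g "real N" "R + 1"] by auto
    have "norm (g t y p - g t (flow 0 t) p) \<le> L t * norm (y - flow 0 t)"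
      if "t \<in> {0..real N}" "norm (y - flow 0 t) \<le> 1" "p \<in> U t" for t y p
      by (rule L(3)) (use that R[OF that(1)] norm_triangle_sub[of y "flow 0 t"] in auto)
    then show ?thesis using L(1,2) by blast
  qed
  then obtain L where L: "\<And>N. loc_integrable (L N)" "\<And>N t. 0 \<le> t \<Longrightarrow> 0 \<le> L N t"
    "\<And>N t y p. t \<in> {0..real N} \<Longrightarrow> norm (y - flow 0 t) \<le> 1 \<Longrightarrow> p \<in> U t \<Longrightarrow>
      norm (g t y p - g t (flow 0 t) p) \<le> L N t * norm (y - flow 0 t)"
    by metis
  have "AE s in lebesgue_on {0..}. \<forall>N. right_lebesgue_point (L N) s"
    unfolding AE_all_countable by (intro allI right_lebesgue_point_AE L(1))
  moreover have "AE s in lebesgue_on {0..}. s \<in> space (lebesgue_on {0..})"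
    by (rule AE_space)
  ultimately show ?thesis
    using right_lebesgue_point_AE[OF velocity_gap_loc_integrable[OF v]] right_lebesgue_point_AE[OF payoff_gap_loc_integrable[OF v]]
      right_lebesgue_point_AE[OF loc_integrable_norm[OF velocity_gap_loc_integrable[OF v]]] right_lebesgue_point_AE[OF lip_loc_integrable]
  proof eventually_elim
    case (elim s)
    have "0 \<le> s" using elim(2) by simp
    obtain N where N: "s + 1 \<le> real N" using real_arch_simple by blast
    show ?case
      by (rule needle_inequality_at[where L="L N", OF v \<open>0 \<le> s\<close> opt unif \<tau> lim elim(3,4,5,6) _ L(1) L(2)])
         (use elim(1) L(3)[of _ N] N \<open>0 \<le> s\<close> in auto)
  qed
qed

end

context reference_control
begin

section \<open>The maximum principle\<close>

definition costate :: "real ^ 'm \<Rightarrow> real \<Rightarrow> real ^ 'm" where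
  "costate Istar t = (1 / (1 + norm Istar)) *\<^sub>R ((Istar - grad 0 t) v* inverse_fund 0 t)"

text \<open>
  The product rule for \<open>(Istar - grad 0) v* inverse_fund 0\<close>: differentiating the first factor gives the
  gradient of \<open>g\<close>, because the fundamental matrix cancels, and differentiating the second one gives the
  term with the Jacobian.
\<close>

lemma costate_primitive:
  "primitive (\<lambda>t. - (costate Istar t v* jac 0 t + (1 / (1 + norm Istar)) *\<^sub>R gx t (flow 0 t) (u0 t))) (costate Istar)"
proof -
  define k where "k = 1 / (1 + norm Istar)"
  interpret vm: bounded_bilinear "(v*) :: real ^ 'm \<Rightarrow> real ^ 'm ^ 'm \<Rightarrow> real ^ 'm"
    by (rule bounded_bilinear_vector_matrix)
  have "primitive (\<lambda>t. - (gx t (flow 0 t) (u0 t) v* fund 0 t)) (\<lambda>t. Istar + - grad 0 t)"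
    by (intro primitive_shift primitive_minus grad_primitive)
  from primitive_linear[OF primitive_bilinear[OF bounded_bilinear_vector_matrix this inverse_fund_primitive] bounded_linear_scaleR_right[of k]]
  show ?thesis
  proof (rule primitive_cong)
    fix t :: real assume t: "0 \<le> t"
    have 1: "(Istar + - grad 0 t) v* (- (inverse_fund 0 t ** jac 0 t)) = - (((Istar - grad 0 t) v* inverse_fund 0 t) v* jac 0 t)"
      by (simp add: vm.minus_right vector_matrix_mul_assoc)
    have 2: "(- (gx t (flow 0 t) (u0 t) v* fund 0 t)) v* inverse_fund 0 t = - gx t (flow 0 t) (u0 t)"
      by (simp add: vm.minus_left vector_matrix_mul_assoc inverse_fund_right[OF t])
    show "k *\<^sub>R ((Istar + - grad 0 t) v* (- (inverse_fund 0 t ** jac 0 t)) + (- (gx t (flow 0 t) (u0 t) v* fund 0 t)) v* inverse_fund 0 t)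
        = - (costate Istar t v* jac 0 t + (1 / (1 + norm Istar)) *\<^sub>R gx t (flow 0 t) (u0 t))"
      unfolding 1 2 by (simp add: costate_def k_def vm.scaleR_left algebra_simps)
  qed (simp add: costate_def k_def)
qed

text \<open>
  By the definition of the costate, the difference of the Hamiltonians at \<open>p\<close> and \<open>u0 t\<close> is a positive
  multiple of the left-hand side of the needle inequality. That inequality is available for countably
  many selectors with dense values, and both sides depend continuously on the control value.
\<close>

lemma maximum_condition:
  assumes U: "condition_u U"
    and opt: "\<And>e. 0 < e \<Longrightarrow> \<exists>T. \<forall>u\<in>selectors U. \<forall>t\<ge>T. payoff f g t u - e \<le> payoff f g t u0"
    and unif: "((\<lambda>\<xi>. sup_norm (\<lambda>T. grad \<xi> T - grad 0 T)) \<longlongrightarrow> 0) (at 0)"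
    and \<tau>: "filterlim \<tau> at_top sequentially" and lim: "(\<lambda>n. grad 0 (\<tau> n)) \<longlonglongrightarrow> Istar"
  shows "AE t in lebesgue_on {0..}. \<forall>p\<in>U t. hamiltonian f g (flow 0 t) t p (1 / (1 + norm Istar)) (costate Istar t)
      \<le> hamiltonian f g (flow 0 t) t (u0 t) (1 / (1 + norm Istar)) (costate Istar t)"
proof -
  define k where "k = 1 / (1 + norm Istar)"
  have "k > 0" by (simp add: k_def add_pos_nonneg)
  obtain v N where v: "\<And>i. v i \<in> selectors U" and N: "negligible N"
    and dense: "\<And>t p e. 0 \<le> t \<Longrightarrow> t \<notin> N \<Longrightarrow> p \<in> U t \<Longrightarrow> 0 < e \<Longrightarrow> \<exists>i :: nat. dist (v i t) p < e"
    by (rule dense_selectors[OF U u0]) (rule that)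
  have "AE t in lebesgue_on {0..}. \<forall>i. payoff_gap (v i) t + (inverse_fund 0 t *v velocity_gap (v i) t) \<bullet> (Istar - grad 0 t) \<le> 0"
    unfolding AE_all_countable
  proof
    fix i
    show "AE t in lebesgue_on {0..}. payoff_gap (v i) t + (inverse_fund 0 t *v velocity_gap (v i) t) \<bullet> (Istar - grad 0 t) \<le> 0"
      by (rule needle_inequality_AE[OF v _ unif \<tau> lim]) (rule opt)
  qed
  moreover have "AE t in lebesgue_on {0..}. t \<notin> N"
    unfolding AE_half_line_iff_negligible by (rule negligible_subset[OF N]) auto
  moreover have "AE t in lebesgue_on {0..}. t \<in> space (lebesgue_on {0..})"
    by (rule AE_space)
  ultimately show ?thesis
  proof eventually_elim
    case (elim t)
    then have t: "0 \<le> t" "t \<notin> N" by auto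
    define H where "H p = hamiltonian f g (flow 0 t) t p k (costate Istar t)" for p
    have H_diff: "H p - H (u0 t) = k * (g t (flow 0 t) p - g t (flow 0 t) (u0 t)
        + (inverse_fund 0 t *v (f t (flow 0 t) p - f t (flow 0 t) (u0 t))) \<bullet> (Istar - grad 0 t))" for p
    proof -
      have "(inverse_fund 0 t *v (f t (flow 0 t) p - f t (flow 0 t) (u0 t))) \<bullet> (Istar - grad 0 t)
        = ((Istar - grad 0 t) v* inverse_fund 0 t) \<bullet> (f t (flow 0 t) p - f t (flow 0 t) (u0 t))"
        by (metis dot_lmul_matrix inner_commute)
      moreover have "costate Istar t = k *\<^sub>R ((Istar - grad 0 t) v* inverse_fund 0 t)"
        by (simp only: costate_def k_def)
      ultimately show ?thesis
        by (simp only: H_def hamiltonian_def inner_scaleR_left inner_diff_right) (simp only: algebra_simps)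
    qed
    have Hv: "H (v i t) \<le> H (u0 t)" for i
    proof -
      have "H (v i t) - H (u0 t) \<le> 0"
        unfolding H_diff using elim(1) \<open>k > 0\<close>
        by (auto simp: payoff_gap_def velocity_gap_def intro!: mult_nonneg_nonpos)
      then show ?thesis by simp
    qed
    show ?case
    proof
      fix p assume p: "p \<in> U t"
      have "\<forall>n. \<exists>i. dist (v i t) p < 1 / real (Suc n)"
        by (intro allI dense[OF t p]) simp
      from choice[OF this] obtain i where i: "\<And>n. dist (v (i n) t) p < 1 / real (Suc n)" by blast
      have conv: "(\<lambda>n. v (i n) t) \<longlonglongrightarrow> p"
      proof (rule tendsto_dist_iff[THEN iffD2, OF Lim_null_comparison])
        show "\<forall>\<^sub>F n in sequentially. norm (dist (v (i n) t) p) \<le> 1 / real (Suc n)"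
          by (rule always_eventually) (use i in \<open>simp add: less_imp_le\<close>)
        show "(\<lambda>n. 1 / real (Suc n)) \<longlonglongrightarrow> 0" by (rule LIMSEQ_Suc[OF lim_1_over_n])
      qed
      have vU: "v (i n) t \<in> U t" for n by (rule selectorsD[OF v t(1)])
      have slice: "continuous_on (U t) (\<lambda>p. a t y p)" if "caratheodory U a"
        for a :: "real \<Rightarrow> real ^ 'm \<Rightarrow> 'u \<Rightarrow> 'b::euclidean_space" and y
      proof -
        have "continuous_on (UNIV \<times> U t) (\<lambda>(y, p). a t y p)"
          using that t by (simp add: caratheodory_def)
        then have "continuous_on (U t) (\<lambda>p. (\<lambda>(y, p). a t y p) (y, p))"
          by (rule continuous_on_compose2) (auto intro!: continuous_intros)
        then show ?thesis by simp
      qed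
      have "continuous_on (U t) (\<lambda>p. f t (flow 0 t) p)" "continuous_on (U t) (\<lambda>p. g t (flow 0 t) p)"
        using slice[of f "flow 0 t"] slice[of g "flow 0 t"] condition_fg by (simp_all add: condition_fg_def)
      then have H_cont: "continuous_on (U t) H"
        unfolding H_def[abs_def] hamiltonian_def by (intro continuous_intros)
      have "\<forall>\<^sub>F n in sequentially. v (i n) t \<in> U t" by (rule always_eventually) (simp add: vU)
      from continuous_on_tendsto_compose[OF H_cont conv p this]
      have H_lim: "(\<lambda>n. H (v (i n) t)) \<longlonglongrightarrow> H p" .
      have "H p \<le> H (u0 t)" by (rule LIMSEQ_le_const2[OF H_lim]) (simp add: Hv)
      then show "hamiltonian f g (flow 0 t) t p (1 / (1 + norm Istar)) (costate Istar t)
          \<le> hamiltonian f g (flow 0 t) t (u0 t) (1 / (1 + norm Istar)) (costate Istar t)"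
        by (simp only: H_def k_def)
    qed
  qed
qed

lemma hamiltonian_gradient:
  assumes "0 \<le> t"
  shows "GDERIV (\<lambda>y. hamiltonian f g y t (u0 t) l \<psi>) y :> \<psi> v* fx t y (u0 t) + l *\<^sub>R gx t y (u0 t)"
  unfolding gderiv_def hamiltonian_def
proof -
  have "((\<lambda>y. \<psi> \<bullet> f t y (u0 t) + l * g t y (u0 t)) has_derivative (\<lambda>h. \<psi> \<bullet> (fx t y (u0 t) *v h) + l * (h \<bullet> gx t y (u0 t)))) (at y)"
    by (rule has_derivative_add[OF has_derivative_inner_right[OF f_derivative[OF assms]] has_derivative_mult_right[OF g_derivative[OF assms]]])
  then show "((\<lambda>y. \<psi> \<bullet> f t y (u0 t) + l * g t y (u0 t)) has_derivative (\<lambda>h. h \<bullet> (\<psi> v* fx t y (u0 t) + l *\<^sub>R gx t y (u0 t)))) (at y)"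
    by (simp add: inner_add_right dot_lmul_matrix[symmetric] inner_commute)
qed

end

lemma SUP_ereal_eq_attained:
  assumes "p0 \<in> A" "\<And>p. p \<in> A \<Longrightarrow> h p \<le> h p0"
  shows "(SUP p\<in>A. ereal (h p)) = ereal (h p0)"
  by (rule antisym) (auto intro!: SUP_least SUP_upper assms)

theorem proposition6:
  fixes U :: "real \<Rightarrow> 'u::euclidean_space set"
    and f :: "real \<Rightarrow> real ^ 'm \<Rightarrow> 'u \<Rightarrow> real ^ 'm"
    and g :: "real \<Rightarrow> real ^ 'm \<Rightarrow> 'u \<Rightarrow> real"
    and fx :: "real \<Rightarrow> real ^ 'm \<Rightarrow> 'u \<Rightarrow> real ^ 'm ^ 'm"
    and gx :: "real \<Rightarrow> real ^ 'm \<Rightarrow> 'u \<Rightarrow> real ^ 'm"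
    and x0 :: "real \<Rightarrow> real ^ 'm" and u0 :: "real \<Rightarrow> 'u"
    and Istar :: "real ^ 'm" and \<tau> :: "nat \<Rightarrow> real"
  assumes "condition_u U"
    and "condition_fg U f g"
    and "superposition_measurable U f" and "superposition_measurable U g"
    and "condition_d U f g fx gx"
    and "uniformly_overtaking_optimal_pair U f g x0 u0"
    and "bounded (payoff_gradient f fx gx u0 0 ` {0..})"
    and "((\<lambda>\<xi>. sup_norm (\<lambda>T. payoff_gradient f fx gx u0 \<xi> T - payoff_gradient f fx gx u0 0 T))
           \<longlongrightarrow> 0) (at 0)"
    and "filterlim \<tau> at_top sequentially"
    and "(\<lambda>n. payoff_gradient f fx gx u0 0 (\<tau> n)) \<longlonglongrightarrow> Istar"
  shows "\<exists>lam0 \<psi>0. (x0, u0, lam0, \<psi>0) \<in> pmp_solutions U f g \<and>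
    Liminf at_top (\<lambda>t. ereal (norm (\<psi>0 t v* fundamental_matrix f fx u0 0 t))) = 0 \<and>
    lam0 = 1 / (1 + norm Istar) \<and> lam0 > 0 \<and>
    (\<forall>T\<ge>0. invertible (fundamental_matrix f fx u0 0 T) \<and>
      \<psi>0 T = lam0 *\<^sub>R (
        (Istar - (LINT t:{0..T}|lebesgue.
            gx t (x0 t) (u0 t) v* fundamental_matrix f fx u0 0 t))
        v* matrix_inv (fundamental_matrix f fx u0 0 T)))"
proof -
  have u0: "u0 \<in> selectors U" and opt: "\<And>e. 0 < e \<Longrightarrow> \<exists>T. \<forall>u\<in>selectors U. \<forall>t\<ge>T. payoff f g t u - e \<le> payoff f g t u0"
    and x0: "\<And>t. 0 \<le> t \<Longrightarrow> x0 t = trajectory f u0 0 t"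
    using assms(6) unfolding uniformly_overtaking_optimal_pair_def uniformly_overtaking_optimal_def by blast+
  interpret reference_control U f g fx gx u0
    by unfold_locales (use assms u0 in auto)
  define lam where "lam = 1 / (1 + norm Istar)"
  have lam: "0 < lam" "lam \<le> 1" by (simp_all add: lam_def add_pos_nonneg)
  let ?\<psi> = "costate Istar"
  have max: "AE t in lebesgue_on {0..}. \<forall>p\<in>U t. hamiltonian f g (flow 0 t) t p lam (?\<psi> t) \<le> hamiltonian f g (flow 0 t) t (u0 t) lam (?\<psi> t)"
    unfolding lam_def by (rule maximum_condition[OF assms(1) opt assms(8,9,10)])
  have half_line: "AE t in lebesgue_on {0::real..}. 0 \<le> t"
    unfolding AE_half_line_iff_negligible by (rule negligible_subset[OF negligible_empty]) auto
  have x0_primitive: "primitive (\<lambda>t. f t (x0 t) (u0 t)) x0"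
    by (rule primitive_cong[OF flow_primitive[of 0]]) (simp_all add: x0)
  have "(x0, u0, lam, ?\<psi>) \<in> pmp_solutions U f g"
    unfolding pmp_solutions_def mem_Collect_eq case_prod_conv
  proof (intro conjI)
    show "continuous_on {0..} x0" by (rule primitive_continuous_on[OF x0_primitive])
    show "locally_abs_continuous x0" by (rule primitive_abs_continuous[OF x0_primitive])
    show "u0 \<in> selectors U" by (rule u0)
    show "lam \<in> {0..1}" using lam by simp
    show "continuous_on {0..} ?\<psi>" by (rule primitive_continuous_on[OF costate_primitive])
    show "locally_abs_continuous ?\<psi>" by (rule primitive_abs_continuous[OF costate_primitive])
    show "x0 0 = 0" by (simp add: x0 flow_0)
    have "inverse_fund 0 0 = mat 1" using inverse_fund_left[of 0 0] by (simp add: fund_0)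
    then have "norm (?\<psi> 0) = lam * norm Istar"
      using lam by (simp add: costate_def grad_0 lam_def)
    then have "norm (?\<psi> 0) + lam = lam * (1 + norm Istar)" by (simp add: algebra_simps)
    also have "\<dots> = 1" using norm_ge_zero[of Istar] unfolding lam_def by (simp add: add_nonneg_eq_0_iff)
    finally show "norm (?\<psi> 0) + lam = 1" .
    show "AE t in lebesgue_on {0..}. (x0 has_vector_derivative f t (x0 t) (u0 t)) (at t within {0..})"
      by (rule primitive_has_vector_derivative_within_AE[OF x0_primitive])
    show "AE t in lebesgue_on {0..}. \<exists>D. GDERIV (\<lambda>y. hamiltonian f g y t (u0 t) lam (?\<psi> t)) (x0 t) :> D \<and>
            (?\<psi> has_vector_derivative - D) (at t within {0..})"
      using primitive_has_vector_derivative_within_AE[OF costate_primitive[of Istar]] half_line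
    proof eventually_elim
      case (elim t)
      show ?case
        using hamiltonian_gradient[OF elim(2), of lam "?\<psi> t" "flow 0 t"] elim x0[OF elim(2)]
        unfolding lam_def by auto
    qed
    show "AE t in lebesgue_on {0..}. (SUP p\<in>U t. ereal (hamiltonian f g (x0 t) t p lam (?\<psi> t))) = ereal (hamiltonian f g (x0 t) t (u0 t) lam (?\<psi> t))"
      using max half_line
    proof eventually_elim
      case (elim t)
      show ?case
        by (rule SUP_ereal_eq_attained) (use elim selectorsD[OF u0 elim(2)] x0[OF elim(2)] in auto)
    qed
  qed
  moreover have "Liminf at_top (\<lambda>t. ereal (norm (?\<psi> t v* fund 0 t))) = 0"
  proof (rule antisym)
    have eq: "norm (?\<psi> t v* fund 0 t) = lam * norm (Istar - grad 0 t)" if "0 \<le> t" for t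
    proof -
      have "?\<psi> t v* fund 0 t = lam *\<^sub>R (Istar - grad 0 t)"
        using bounded_bilinear.scaleR_left[OF bounded_bilinear_vector_matrix, of lam "(Istar - grad 0 t) v* inverse_fund 0 t" "fund 0 t"]
        by (simp add: costate_def lam_def vector_matrix_mul_assoc inverse_fund_left[OF that])
      then show ?thesis using lam by simp
    qed
    have "(\<lambda>n. lam * norm (Istar - grad 0 (\<tau> n))) \<longlonglongrightarrow> lam * norm (Istar - Istar)"
      by (intro tendsto_intros assms(10))
    moreover have "\<forall>\<^sub>F n in sequentially. 0 \<le> \<tau> n" using assms(9) unfolding filterlim_at_top by blast
    then have "\<forall>\<^sub>F n in sequentially. lam * norm (Istar - grad 0 (\<tau> n)) = norm (?\<psi> (\<tau> n) v* fund 0 (\<tau> n))"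
      by eventually_elim (simp add: eq)
    ultimately have "(\<lambda>n. norm (?\<psi> (\<tau> n) v* fund 0 (\<tau> n))) \<longlonglongrightarrow> lam * norm (Istar - Istar)"
      by (rule Lim_transform_eventually)
    then have "(\<lambda>n. norm (?\<psi> (\<tau> n) v* fund 0 (\<tau> n))) \<longlonglongrightarrow> 0" by simp
    then have lim0: "(\<lambda>n. ereal (norm (?\<psi> (\<tau> n) v* fund 0 (\<tau> n)))) \<longlonglongrightarrow> 0"
      by (simp add: zero_ereal_def)
    show "Liminf at_top (\<lambda>t. ereal (norm (?\<psi> t v* fund 0 t))) \<le> 0"
    proof (rule ccontr)
      assume "\<not> Liminf at_top (\<lambda>t. ereal (norm (?\<psi> t v* fund 0 t))) \<le> 0"
      from dense[OF this[unfolded not_le]]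
      obtain y where y: "0 < y" "y < Liminf at_top (\<lambda>t. ereal (norm (?\<psi> t v* fund 0 t)))" by blast
      have "\<forall>\<^sub>F n in sequentially. y < ereal (norm (?\<psi> (\<tau> n) v* fund 0 (\<tau> n)))"
        by (rule eventually_compose_filterlim[OF less_LiminfD[OF y(2)] assms(9)])
      then have "\<forall>\<^sub>F n in sequentially. y \<le> ereal (norm (?\<psi> (\<tau> n) v* fund 0 (\<tau> n)))"
        by eventually_elim simp
      with lim0 have "y \<le> 0" by (rule tendsto_lowerbound) simp
      with y(1) show False by simp
    qed
    show "0 \<le> Liminf at_top (\<lambda>t. ereal (norm (?\<psi> t v* fund 0 t)))"
      by (rule Liminf_bounded) simp
  qed
  moreover have "?\<psi> T = lam *\<^sub>R ((Istar - (LINT t:{0..T}|lebesgue. gx t (x0 t) (u0 t) v* fund 0 t)) v* matrix_inv (fund 0 T))"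
    if "0 \<le> T" for T
  proof -
    have "(LINT t:{0..T}|lebesgue. gx t (x0 t) (u0 t) v* fund 0 t) = grad 0 T"
      unfolding payoff_gradient_def by (rule set_lebesgue_integral_cong) (auto simp: x0)
    then show ?thesis by (simp add: costate_def lam_def fund_invertible(2)[OF that])
  qed
  ultimately show ?thesis
    using lam fund_invertible(1) by (intro exI[of _ lam] exI[of _ ?\<psi>]) (simp add: lam_def)
qed

end
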